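(* Let $\nu\ge0$. There exists a constant $C=C(\nu)>0$, depending only on $\nu$, such that for all $b,T,N>0$ and all $u_0\in L^2(\mathbb{R}^+)$ with $\operatorname{supp}u_0\subset[0,N]$, $$\int_{\mathbb{R}^+}|u_0(x)|^2dx\le e^{C\left(1+\frac{bN}{T}\right)}\int_{[0,b]^c}|u(x,T;u_0)|^2dx.$$
   Context: $\mathbb{R}^+=(0,\infty)$, $L^2(\mathbb{R}^+)=L^2(\mathbb{R}^+;\mathbb{C})$, $C_0^\infty(\mathbb{R}^+)$ denotes complex-valued smooth functions with compact support in $(0,\infty)$, and $E^c=\mathbb{R}^+\setminus E$. For $\nu\ge0$, $H_\nu$ is the Friedrichs extension in $L^2(\mathbb{R}^+)$ of the operator $-\partial_x^2+(\nu^2-\frac14)\frac1{x^2}$ with domain $C_0^\infty(\mathbb{R}^+)$. For $u_0\in L^2(\mathbb{R}^+)$, $u(x,t;u_0)=(e^{-itH_\nu}u_0)(x)$ denotes the solution of $i\partial_tu=H_\nu u$, $u(\cdot,0)=u_0$. *)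

theory Defs
  imports "HOL-Analysis.Analysis"
begin

section \<open>Square-integrable functions and operators in \<open>L\<^sup>2\<close>\<close>

text \<open>
  Elements of \<open>L\<^sup>2\<close> are represented by functions; equality in \<open>L\<^sup>2\<close> is equality almost
  everywhere.
\<close>

definition l2 :: "'a measure \<Rightarrow> ('a \<Rightarrow> complex) set" where
  "l2 M = {f. f \<in> borel_measurable M \<and> integrable M (\<lambda>x. (cmod (f x))\<^sup>2)}"

definition l2_inner :: "'a measure \<Rightarrow> ('a \<Rightarrow> complex) \<Rightarrow> ('a \<Rightarrow> complex) \<Rightarrow> complex" where
  "l2_inner M f g = (LINT x|M. f x * cnj (g x))"

definition l2_tendsto ::
  "'a measure \<Rightarrow> ('i \<Rightarrow> 'a \<Rightarrow> complex) \<Rightarrow> ('a \<Rightarrow> complex) \<Rightarrow> 'i filter \<Rightarrow> bool" where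
  "l2_tendsto M f g F \<longleftrightarrow> ((\<lambda>i. LINT x|M. (cmod (f i x - g x))\<^sup>2) \<longlongrightarrow> 0) F"

text \<open>
  An unbounded operator \<open>A\<close> is given by its graph, the set of pairs \<open>(f, A f)\<close> with \<open>f\<close> in the
  domain.  For a densely defined operator the second component of a pair in the adjoint graph is
  determined almost everywhere by the first.
\<close>

type_synonym 'a l2_operator = "(('a \<Rightarrow> complex) \<times> ('a \<Rightarrow> complex)) set"

definition l2_adjoint :: "'a measure \<Rightarrow> 'a l2_operator \<Rightarrow> 'a l2_operator" where
  "l2_adjoint M S = {(f, g). f \<in> l2 M \<and> g \<in> l2 M \<and>
     (\<forall>(\<phi>, \<psi>) \<in> S. l2_inner M \<psi> f = l2_inner M \<phi> g)}"

text \<open>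
  The domain of the closure of the quadratic form \<open>s(\<phi>) = \<langle>S \<phi>, \<phi>\<rangle>\<close>: the \<open>L\<^sup>2\<close> limits of sequences
  from the domain of \<open>S\<close> that are Cauchy with respect to the form.
\<close>

definition l2_form_domain :: "'a measure \<Rightarrow> 'a l2_operator \<Rightarrow> ('a \<Rightarrow> complex) set" where
  "l2_form_domain M S = {f. f \<in> l2 M \<and>
     (\<exists>\<phi> \<psi>. (\<forall>n::nat. (\<phi> n, \<psi> n) \<in> S) \<and> l2_tendsto M \<phi> f sequentially \<and>
       (\<forall>\<epsilon>>0. \<exists>K. \<forall>m\<ge>K. \<forall>n\<ge>K.
          cmod (l2_inner M (\<lambda>x. \<psi> m x - \<psi> n x) (\<lambda>x. \<phi> m x - \<phi> n x)) < \<epsilon>))}"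

text \<open>
  The Friedrichs extension of a densely defined symmetric operator that is bounded below, as the
  restriction of the adjoint to the form domain.
\<close>

definition friedrichs_extension :: "'a measure \<Rightarrow> 'a l2_operator \<Rightarrow> 'a l2_operator" where
  "friedrichs_extension M S = {(f, g). (f, g) \<in> l2_adjoint M S \<and> f \<in> l2_form_domain M S}"


section \<open>Unitary groups\<close>

text \<open>
  Linearity and preservation of the inner product imply that \<open>U t\<close> respects equality almost
  everywhere, and the group law makes \<open>U t\<close> surjective.
\<close>

definition unitary_group ::
  "'a measure \<Rightarrow> (real \<Rightarrow> ('a \<Rightarrow> complex) \<Rightarrow> 'a \<Rightarrow> complex) \<Rightarrow> bool" where
  "unitary_group M U \<longleftrightarrow>
     (\<forall>t. \<forall>f\<in>l2 M. U t f \<in> l2 M) \<and>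
     (\<forall>t a b. \<forall>f\<in>l2 M. \<forall>g\<in>l2 M.
        AE x in M. U t (\<lambda>y. a * f y + b * g y) x = a * U t f x + b * U t g x) \<and>
     (\<forall>t. \<forall>f\<in>l2 M. \<forall>g\<in>l2 M. l2_inner M (U t f) (U t g) = l2_inner M f g) \<and>
     (\<forall>f\<in>l2 M. AE x in M. U 0 f x = f x) \<and>
     (\<forall>s t. \<forall>f\<in>l2 M. AE x in M. U (s + t) f x = U s (U t f) x) \<and>
     (\<forall>f\<in>l2 M. l2_tendsto M (\<lambda>t. U t f) f (at 0))"

definition group_generator ::
  "'a measure \<Rightarrow> (real \<Rightarrow> ('a \<Rightarrow> complex) \<Rightarrow> 'a \<Rightarrow> complex) \<Rightarrow> 'a l2_operator" where
  "group_generator M U = {(f, g). f \<in> l2 M \<and> g \<in> l2 M \<and>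
     l2_tendsto M (\<lambda>h x. (U h f x - f x) / of_real h) g (at 0)}"

text \<open>
  \<open>U t = exp (- i t H)\<close>: by Stone's theorem, for self-adjoint \<open>H\<close> there is, up to equality almost
  everywhere, exactly one strongly continuous unitary group with generator \<open>- i H\<close>.
  For \<open>u\<^sub>0\<close> in \<open>L\<^sup>2\<close>, \<open>U t u\<^sub>0\<close> is the solution of \<open>i \<partial>\<^sub>t u = H u\<close>, \<open>u(0) = u\<^sub>0\<close>.
\<close>

definition schroedinger_group ::
  "'a measure \<Rightarrow> 'a l2_operator \<Rightarrow> (real \<Rightarrow> ('a \<Rightarrow> complex) \<Rightarrow> 'a \<Rightarrow> complex) \<Rightarrow> bool" where
  "schroedinger_group M H U \<longleftrightarrow>
     unitary_group M U \<and> group_generator M U = {(f, \<lambda>x. - \<i> * g x) | f g. (f, g) \<in> H}"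


section \<open>The Bessel-type operator on the half-line\<close>

abbreviation half_line :: "real measure" where
  "half_line \<equiv> lebesgue_on {0<..}"

definition vderiv :: "(real \<Rightarrow> complex) \<Rightarrow> real \<Rightarrow> complex" where
  "vderiv f x = vector_derivative f (at x)"

text \<open>Test functions on \<open>(0, \<infinity>)\<close>, extended by zero to the real line.\<close>

definition test_functions :: "(real \<Rightarrow> complex) set" where
  "test_functions = {\<phi>. (\<forall>n x. (vderiv ^^ n) \<phi> differentiable (at x)) \<and>
     (\<exists>a b. 0 < a \<and> (\<forall>x. x \<notin> {a..b} \<longrightarrow> \<phi> x = 0))}"

definition bessel_minimal :: "real \<Rightarrow> real l2_operator" where
  "bessel_minimal \<nu> =
     {(\<phi>, \<lambda>x. - (vderiv ^^ 2) \<phi> x + of_real ((\<nu>\<^sup>2 - 1/4) * (1 / x\<^sup>2)) * \<phi> x) | \<phi>.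
        \<phi> \<in> test_functions}"

definition bessel_friedrichs :: "real \<Rightarrow> real l2_operator" where
  "bessel_friedrichs \<nu> = friedrichs_extension half_line (bessel_minimal \<nu>)"

end

theory Submission
  imports Defs
begin

text \<open>
  Let \<open>c = \<nu> + 1/2\<close> and \<open>v = U T u\<^sub>0\<close>. The kernel of the propagator is a Bessel function, so
  \<open>exp (- i x\<^sup>2 / 4T) v(x) = x\<^sup>c G(x\<^sup>2)\<close> with \<open>G\<close> entire, whose \<open>k\<close>-th Taylor coefficient is at most
  \<open>2 (N / 4T)\<^bsup>\<nu> + 1 + 2k\<^esup> / (k! \<Gamma>(\<nu> + 1 + k))\<close> times the norm of \<open>u\<^sub>0\<close>. Up to a remainder that is small compared
  with this norm, \<open>G\<close> is on \<open>[0, 2b]\<close> a polynomial of degree \<open>n \<approx> K (1 + b N / T)\<close>, and Lagrange interpolation bounds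
  the mass of such a polynomial on \<open>[0, b]\<close> by \<open>exp (8 n)\<close> times its mass on \<open>[b, 2b]\<close>.

  The kernel itself is not needed. The Gaussians \<open>x\<^sup>c exp (- x\<^sup>2 / p)\<close> lie in the domain of the Friedrichs extension and
  solve the equation explicitly, by \<open>p \<mapsto> p + 4 i t\<close>. Pairing \<open>v\<close> with them determines the moments
  of \<open>exp (- i x\<^sup>2 / 4T) v\<close> against \<open>x\<^sup>c exp (- m x\<^sup>2)\<close>, which agree with those of the power series; by the
  Weierstrass theorem in the variable \<open>exp (- x\<^sup>2)\<close> these moments determine the function.
\<close>


section \<open>Square-integrable functions\<close>


text \<open>Unitarity closes the estimate: \<open>v\<close> has the total mass of
  \<open>u\<^sub>0\<close>, so a remainder of at most a quarter of that mass is absorbed on the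
  left. What decides is a competition between two exponentials in n. The squared remainder after n
  terms carries the factor exp (- 16 n), because the exponential series that majorizes the
  coefficients may be evaluated at exp 8 times the relevant argument; interpolation loses only exp
  (8 n). The price of the larger argument is a factor exponential in b N / T, and this forces n to
  grow linearly in 1 + b N / T. The Friedrichs extension is an adjoint restricted to a form closure,
  so each Gaussian needs an explicit sequence of test functions. For \<nu> = 0 the Gaussian behaves
  like sqrt x at the origin, and cutoffs that rescale one fixed profile leave a form error bounded
  away from 0; this dictates a logarithmic scale. The group is known only through its generator, so
  the explicit Gaussians are identified with its orbits by an isometry argument.\<close>

lemma borel_measurable_cnj [measurable]:
  assumes "f \<in> borel_measurable M"
  shows "(\<lambda>x. cnj (f x)) \<in> borel_measurable M"
  using borel_measurable_continuous_on[OF _ assms, of cnj] by (simp add: continuous_on_cnj)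

lemma real_product_integrable:
  fixes u v :: "'a \<Rightarrow> real"
  assumes "u \<in> borel_measurable M" "v \<in> borel_measurable M"
    and "integrable M (\<lambda>x. (u x)\<^sup>2)" "integrable M (\<lambda>x. (v x)\<^sup>2)"
  shows "integrable M (\<lambda>x. u x * v x)"
proof (rule Bochner_Integration.integrable_bound)
  show "integrable M (\<lambda>x. (u x)\<^sup>2 + (v x)\<^sup>2)" using assms by auto
  show "(\<lambda>x. u x * v x) \<in> borel_measurable M" using assms by measurable
  have "\<bar>a * b\<bar> \<le> a\<^sup>2 + b\<^sup>2" for a b :: real
  proof -
    have "2 * (\<bar>a\<bar> * \<bar>b\<bar>) \<le> a\<^sup>2 + b\<^sup>2" using sum_squares_bound[of "\<bar>a\<bar>" "\<bar>b\<bar>"] by simp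
    moreover have "0 \<le> \<bar>a\<bar> * \<bar>b\<bar>" by simp
    ultimately show ?thesis unfolding abs_mult by linarith
  qed
  then show "AE x in M. norm (u x * v x) \<le> norm ((u x)\<^sup>2 + (v x)\<^sup>2)" by simp
qed

lemma integral_mult_le_sqrt:
  fixes u v :: "'a \<Rightarrow> real"
  assumes m: "u \<in> borel_measurable M" "v \<in> borel_measurable M"
    and i: "integrable M (\<lambda>x. (u x)\<^sup>2)" "integrable M (\<lambda>x. (v x)\<^sup>2)"
  shows "(LINT x|M. u x * v x) \<le> sqrt (LINT x|M. (u x)\<^sup>2) * sqrt (LINT x|M. (v x)\<^sup>2)"
proof -
  define A B where "A = sqrt (LINT x|M. (u x)\<^sup>2)" and "B = sqrt (LINT x|M. (v x)\<^sup>2)"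
  have AB: "0 \<le> A" "0 \<le> B" "A\<^sup>2 = (LINT x|M. (u x)\<^sup>2)" "B\<^sup>2 = (LINT x|M. (v x)\<^sup>2)"
    unfolding A_def B_def by auto
  have *: "(LINT x|M. u x * v x) \<le> (A + e) * (B + e)" if "e > 0" for e
  proof -
    \<comment> \<open>The optimal weight in 2 u v \<le> t u^2 + v^2 / t would be B / A. Adding
      \<open>e\<close> keeps it defined and positive when a norm vanishes; \<open>e\<close> tends to
      0 at the end.\<close>
    define t where "t = (B + e) / (A + e)"
    have t: "t > 0" "t * (A + e) = B + e" "(B + e) / t = A + e"
      using that AB by (auto simp: t_def divide_simps)
    have p: "u x * v x \<le> (t / 2) * (u x)\<^sup>2 + (1 / (2 * t)) * (v x)\<^sup>2" for x
    proof -
      have "0 \<le> (t * u x - v x)\<^sup>2" by simp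
      then have "2 * t * (u x * v x) \<le> t * t * (u x)\<^sup>2 + (v x)\<^sup>2"
        by (simp add: power2_eq_square algebra_simps)
      then show ?thesis using t(1) by (simp add: divide_simps) (simp add: algebra_simps)
    qed
    have "(LINT x|M. u x * v x) \<le> (LINT x|M. (t / 2) * (u x)\<^sup>2 + (1 / (2 * t)) * (v x)\<^sup>2)"
      by (intro integral_mono real_product_integrable m i p) (use i in auto)
    also have "\<dots> = (t / 2) * A\<^sup>2 + (1 / (2 * t)) * B\<^sup>2"
      using i by (simp add: AB)
    also have "\<dots> \<le> (t / 2) * (A + e)\<^sup>2 + (1 / (2 * t)) * (B + e)\<^sup>2"
      using t AB that by (intro add_mono mult_left_mono power_mono) auto
    also have "\<dots> = (t * (A + e)) * (A + e) / 2 + ((B + e) / t) * (B + e) / 2"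
      by (simp add: power2_eq_square)
    also have "\<dots> = (A + e) * (B + e)" unfolding t(2,3) by (simp add: algebra_simps)
    finally show ?thesis .
  qed
  have "((\<lambda>e. (A + e) * (B + e)) \<longlongrightarrow> (A + 0) * (B + 0)) (at_right 0)"
    by (intro tendsto_intros)
  moreover have "\<forall>\<^sub>F e in at_right 0. (LINT x|M. u x * v x) \<le> (A + e) * (B + e)"
    using * by (auto simp: eventually_at_filter)
  ultimately have "(LINT x|M. u x * v x) \<le> (A + 0) * (B + 0)"
    by (rule tendsto_lowerbound) simp
  then show ?thesis by (simp add: A_def B_def)
qed

lemma l2_measurable: "f \<in> l2 M \<Longrightarrow> f \<in> borel_measurable M"
  and l2_integrable: "f \<in> l2 M \<Longrightarrow> integrable M (\<lambda>x. (cmod (f x))\<^sup>2)"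
  by (auto simp: l2_def)

lemma l2_product_integrable:
  assumes "f \<in> l2 M" "g \<in> l2 M"
  shows "integrable M (\<lambda>x. f x * cnj (g x))"
proof (rule Bochner_Integration.integrable_bound)
  show "integrable M (\<lambda>x. cmod (f x) * cmod (g x))"
    using assms by (intro real_product_integrable) (auto simp: l2_def)
  show "(\<lambda>x. f x * cnj (g x)) \<in> borel_measurable M"
    using assms[THEN l2_measurable] by measurable
qed (auto simp: norm_mult)

lemma l2_dominated:
  assumes "f \<in> borel_measurable M" "g \<in> l2 M" "AE x in M. cmod (f x) \<le> cmod (g x)"
  shows "f \<in> l2 M"
  unfolding l2_def
proof (intro CollectI conjI)
  show "integrable M (\<lambda>x. (cmod (f x))\<^sup>2)"
  proof (rule Bochner_Integration.integrable_bound)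
    show "integrable M (\<lambda>x. (cmod (g x))\<^sup>2)" using assms(2) by (rule l2_integrable)
    show "AE x in M. norm ((cmod (f x))\<^sup>2) \<le> norm ((cmod (g x))\<^sup>2)"
      using assms(3) by eventually_elim (auto intro: power_mono)
  qed (use assms in measurable)
qed (use assms in auto)

lemma cmod_add_square_le:
  assumes "t > 0"
  shows "(cmod (a + b))\<^sup>2 \<le> (1 + t) * (cmod a)\<^sup>2 + (1 + 1 / t) * (cmod b)\<^sup>2"
proof -
  have "(cmod (a + b))\<^sup>2 \<le> (cmod a + cmod b)\<^sup>2"
    by (intro power_mono norm_triangle_ineq) auto
  moreover have "0 \<le> (t * cmod a - cmod b)\<^sup>2 / t" using assms by simp
  moreover have "(t * cmod a - cmod b)\<^sup>2 / t = t * (cmod a)\<^sup>2 + (cmod b)\<^sup>2 / t - 2 * cmod a * cmod b"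
    using assms by (simp add: power2_eq_square field_simps)
  ultimately show ?thesis by (simp add: power2_eq_square algebra_simps)
qed

lemma l2_scale:
  assumes "f \<in> l2 M"
  shows "(\<lambda>x. c * f x) \<in> l2 M"
  using assms by (auto simp: l2_def norm_mult power_mult_distrib)

lemma l2_add:
  assumes "f \<in> l2 M" "g \<in> l2 M"
  shows "(\<lambda>x. f x + g x) \<in> l2 M"
  unfolding l2_def
proof (intro CollectI conjI)
  note [measurable] = assms[THEN l2_measurable]
  show "(\<lambda>x. f x + g x) \<in> borel_measurable M" by measurable
  show "integrable M (\<lambda>x. (cmod (f x + g x))\<^sup>2)"
  proof (rule Bochner_Integration.integrable_bound)
    show "integrable M (\<lambda>x. (1 + 1) * (cmod (f x))\<^sup>2 + (1 + 1 / 1) * (cmod (g x))\<^sup>2)"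
      using assms[THEN l2_integrable] by auto
    show "AE x in M. norm ((cmod (f x + g x))\<^sup>2)
        \<le> norm ((1 + 1) * (cmod (f x))\<^sup>2 + (1 + 1 / 1) * (cmod (g x))\<^sup>2)"
    proof (rule AE_I2)
      fix x
      have "0 \<le> (1 + 1) * (cmod (f x))\<^sup>2 + (1 + 1 / 1) * (cmod (g x))\<^sup>2" by simp
      with cmod_add_square_le[of 1 "f x" "g x"] show "norm ((cmod (f x + g x))\<^sup>2)
          \<le> norm ((1 + 1) * (cmod (f x))\<^sup>2 + (1 + 1 / 1) * (cmod (g x))\<^sup>2)"
        by (simp only: real_norm_def abs_of_nonneg zero_le_power2)
    qed
  qed measurable
qed

lemma l2_diff:
  assumes "f \<in> l2 M" "g \<in> l2 M"
  shows "(\<lambda>x. f x - g x) \<in> l2 M"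
  using l2_add[OF assms(1) l2_scale[OF assms(2), of "-1"]] by simp

section \<open>The norm of L^2 and its triangle inequality\<close>

definition l2_norm :: "'a measure \<Rightarrow> ('a \<Rightarrow> complex) \<Rightarrow> real" where
  "l2_norm M f = sqrt (LINT x|M. (cmod (f x))\<^sup>2)"

lemma l2_norm_nonneg: "0 \<le> l2_norm M f"
  and l2_norm_square: "(l2_norm M f)\<^sup>2 = (LINT x|M. (cmod (f x))\<^sup>2)"
  by (auto simp: l2_norm_def)

lemma l2_norm_scale: "l2_norm M (\<lambda>x. c * f x) = cmod c * l2_norm M f"
  by (simp add: l2_norm_def norm_mult power_mult_distrib real_sqrt_mult)

lemma l2_norm_cong_AE:
  assumes "f \<in> borel_measurable M" "g \<in> borel_measurable M" "AE x in M. f x = g x"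
  shows "l2_norm M f = l2_norm M g"
  unfolding l2_norm_def
  by (intro arg_cong[of _ _ sqrt] integral_cong_AE) (use assms in \<open>auto elim: eventually_mono\<close>)

lemma l2_norm_eq_0_iff:
  assumes "f \<in> l2 M"
  shows "l2_norm M f = 0 \<longleftrightarrow> (AE x in M. f x = 0)"
  using integral_nonneg_eq_0_iff_AE[OF l2_integrable[OF assms]] by (simp add: l2_norm_def)

lemma l2_norm_triangle:
  assumes f: "f \<in> l2 M" and g: "g \<in> l2 M"
  shows "l2_norm M (\<lambda>x. f x + g x) \<le> l2_norm M f + l2_norm M g"
proof -
  note [measurable] = f[THEN l2_measurable] g[THEN l2_measurable]
  have i: "integrable M (\<lambda>x. (cmod (f x))\<^sup>2)" "integrable M (\<lambda>x. (cmod (g x))\<^sup>2)"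
    "integrable M (\<lambda>x. cmod (f x) * cmod (g x))"
    using f g by (auto intro!: real_product_integrable simp: l2_def)
  have "(LINT x|M. (cmod (f x + g x))\<^sup>2)
      \<le> (LINT x|M. (cmod (f x))\<^sup>2 + 2 * (cmod (f x) * cmod (g x)) + (cmod (g x))\<^sup>2)"
  proof (intro integral_mono)
    show "integrable M (\<lambda>x. (cmod (f x + g x))\<^sup>2)" using l2_add[OF f g] by (rule l2_integrable)
    show "(cmod (f x + g x))\<^sup>2 \<le> (cmod (f x))\<^sup>2 + 2 * (cmod (f x) * cmod (g x)) + (cmod (g x))\<^sup>2" for x
      using power_mono[OF norm_triangle_ineq[of "f x" "g x"], of 2] by (simp add: power2_eq_square algebra_simps)
  qed (use i in auto)
  also have "\<dots> = (l2_norm M f)\<^sup>2 + 2 * (LINT x|M. cmod (f x) * cmod (g x)) + (l2_norm M g)\<^sup>2"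
    using i by (simp add: l2_norm_square)
  also have "\<dots> \<le> (l2_norm M f)\<^sup>2 + 2 * (l2_norm M f * l2_norm M g) + (l2_norm M g)\<^sup>2"
    using integral_mult_le_sqrt[of "\<lambda>x. cmod (f x)" M "\<lambda>x. cmod (g x)"] i by (simp add: l2_norm_def)
  also have "\<dots> = (l2_norm M f + l2_norm M g)\<^sup>2" by (simp add: power2_eq_square algebra_simps)
  finally show ?thesis
    by (simp add: l2_norm_square[symmetric] abs_le_square_iff[symmetric] l2_norm_nonneg)
qed

lemma l2_norm_diff_abs_le:
  assumes f: "f \<in> l2 M" and g: "g \<in> l2 M"
  shows "\<bar>l2_norm M f - l2_norm M g\<bar> \<le> l2_norm M (\<lambda>x. f x - g x)"
proof -
  have "l2_norm M f \<le> l2_norm M (\<lambda>x. f x - g x) + l2_norm M g"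
    using l2_norm_triangle[OF l2_diff[OF f g] g] by simp
  moreover have "l2_norm M g \<le> l2_norm M (\<lambda>x. g x - f x) + l2_norm M f"
    using l2_norm_triangle[OF l2_diff[OF g f] f] by simp
  moreover have "l2_norm M (\<lambda>x. g x - f x) = l2_norm M (\<lambda>x. f x - g x)"
    using l2_norm_scale[of M "-1" "\<lambda>x. f x - g x"] by simp
  ultimately show ?thesis by linarith
qed

lemma l2_tendsto_iff_norm: "l2_tendsto M f g F \<longleftrightarrow> ((\<lambda>i. l2_norm M (\<lambda>x. f i x - g x)) \<longlongrightarrow> 0) F"
  unfolding l2_tendsto_def l2_norm_def
proof
  assume "((\<lambda>i. LINT x|M. (cmod (f i x - g x))\<^sup>2) \<longlongrightarrow> 0) F"
  from tendsto_real_sqrt[OF this] show "((\<lambda>i. sqrt (LINT x|M. (cmod (f i x - g x))\<^sup>2)) \<longlongrightarrow> 0) F" by simp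
next
  assume "((\<lambda>i. sqrt (LINT x|M. (cmod (f i x - g x))\<^sup>2)) \<longlongrightarrow> 0) F"
  from tendsto_power[OF this, of 2] show "((\<lambda>i. LINT x|M. (cmod (f i x - g x))\<^sup>2) \<longlongrightarrow> 0) F" by simp
qed


section \<open>Polynomials on adjacent intervals\<close>


lemma lagrange_interpolation:
  fixes p :: "complex poly" and s :: "nat \<Rightarrow> complex"
  assumes inj: "inj_on s {..<n}" and deg: "degree p < n"
  shows "poly p z = (\<Sum>j<n. poly p (s j) * (\<Prod>i\<in>{..<n} - {j}. (z - s i) / (s j - s i)))"
proof -
  define L where "L j = (\<Prod>i\<in>{..<n} - {j}. smult (1 / (s j - s i)) [:- s i, 1:])" for j
  define q where "q = (\<Sum>j<n. smult (poly p (s j)) (L j))"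
  have pL: "poly (L j) x = (\<Prod>i\<in>{..<n} - {j}. (x - s i) / (s j - s i))" for j x
    by (simp add: L_def poly_prod diff_divide_distrib)
  have L: "poly (L j) (s k) = (if j = k then 1 else 0)" if "j < n" "k < n" for j k
  proof (cases "j = k")
    case True
    have "s j - s i \<noteq> 0" if "i \<in> {..<n} - {j}" for i
      using inj \<open>j < n\<close> that by (auto dest: inj_onD)
    with True show ?thesis by (auto simp: pL intro!: prod.neutral)
  next
    case False
    then have "poly (L j) (s k) = 0" unfolding pL using that by (intro prod_zero) auto
    with False show ?thesis by simp
  qed
  have dL: "degree (L j) \<le> n - 1" if "j < n" for j
  proof -
    have "degree (L j) \<le> sum (degree \<circ> (\<lambda>i. smult (1 / (s j - s i)) [:- s i, 1:])) ({..<n} - {j})"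
      unfolding L_def by (rule degree_prod_sum_le) simp
    also have "\<dots> \<le> (\<Sum>i\<in>{..<n} - {j}. 1)" by (intro sum_mono) auto
    also have "\<dots> = n - 1" using that by simp
    finally show ?thesis .
  qed
  have "p = q"
  proof (rule poly_eqI_degree[where A = "s ` {..<n}"])
    fix x assume "x \<in> s ` {..<n}"
    then obtain k where k: "k < n" "x = s k" by auto
    have "poly q x = (\<Sum>j<n. poly p (s j) * (if j = k then 1 else 0))"
      unfolding q_def k(2) by (simp add: poly_sum L k(1))
    also have "\<dots> = (\<Sum>j<n. if j = k then poly p (s j) else 0)" by (intro sum.cong) auto
    also have "\<dots> = poly p x" using k by (simp add: sum.delta)
    finally show "poly p x = poly q x" by simp
  next
    have c: "card (s ` {..<n}) = n" using inj by (simp add: card_image)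
    show "degree p < card (s ` {..<n})" using c deg by simp
    have "degree q \<le> n - 1" unfolding q_def
      by (intro degree_sum_le) (use dL in auto)
    then show "degree q < card (s ` {..<n})" using c deg by simp
  qed
  then have "poly p z = poly q z" by simp
  also have "\<dots> = (\<Sum>j<n. poly p (s j) * (\<Prod>i\<in>{..<n} - {j}. (z - s i) / (s j - s i)))"
    unfolding q_def by (simp add: poly_sum pL)
  finally show ?thesis .
qed

text \<open>These products are the Lagrange denominators at equispaced nodes; the two factorials
  collect the nodes below and above \<open>j\<close>.\<close>

lemma prod_abs_diff_nat:
  assumes "j < n"
  shows "(\<Prod>i\<in>{..<n} - {j}. \<bar>real j - real i\<bar>) = fact j * fact (n - 1 - j)"
proof -
  have s: "{..<n} - {j} = {..<j} \<union> {Suc j..<n}" using assms by auto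
  have "(\<Prod>i<j. \<bar>real j - real i\<bar>) = (\<Prod>i<j. real (Suc (j - Suc i)))"
    by (intro prod.cong) auto
  also have "\<dots> = (\<Prod>i<j. real (Suc i))" by (rule prod.nat_diff_reindex)
  also have "\<dots> = fact j" by (simp add: fact_prod_Suc lessThan_atLeast0)
  finally have 1: "(\<Prod>i<j. \<bar>real j - real i\<bar>) = fact j" .
  have "(\<Prod>i\<in>{Suc j..<n}. \<bar>real j - real i\<bar>) = (\<Prod>i\<in>{0 + Suc j..<(n - 1 - j) + Suc j}. \<bar>real j - real i\<bar>)"
    using assms by (intro prod.cong) auto
  also have "\<dots> = (\<Prod>i\<in>{0..<n - 1 - j}. \<bar>real j - real (i + Suc j)\<bar>)"
    by (rule prod.shift_bounds_nat_ivl)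
  also have "\<dots> = (\<Prod>i\<in>{0..<n - 1 - j}. real (Suc i))" by (intro prod.cong) auto
  also have "\<dots> = fact (n - 1 - j)" by (simp add: fact_prod_Suc)
  finally have 2: "(\<Prod>i\<in>{Suc j..<n}. \<bar>real j - real i\<bar>) = fact (n - 1 - j)" .
  have "(\<Prod>i\<in>{..<j} \<union> {Suc j..<n}. \<bar>real j - real i\<bar>)
      = (\<Prod>i<j. \<bar>real j - real i\<bar>) * (\<Prod>i\<in>{Suc j..<n}. \<bar>real j - real i\<bar>)"
    by (rule prod.union_disjoint) auto
  then show ?thesis unfolding s 1 2 .
qed

lemma power_div_fact_le_exp:
  fixes x :: real
  assumes "0 \<le> x"
  shows "x ^ k / fact k \<le> exp x"
proof -
  have "(\<Sum>i\<in>{k}. x ^ i /\<^sub>R fact i) \<le> (\<Sum>i. x ^ i /\<^sub>R fact i)"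
    using assms summable_exp_generic[of x] by (intro sum_le_suminf) auto
  then show ?thesis by (simp add: exp_def divide_inverse mult.commute)
qed

lemma four_le_exp_2: "(4::real) \<le> exp 2"
  using exp_lower_Taylor_quadratic[of "2::real"] by simp

text \<open>Each numerator is at most 4 b^2. The nodes y before squaring lie in [b, 2 b], so y_j^2 -
  y_i^2 = (y_j - y_i) (y_j + y_i) is at least |j - i| (b / n) 2 b in modulus. Every factor is thus
  at most 2 n / |j - i|, and the product is at most 4^(n-1) n^(n-1) / (n-1)!, which exp (2 n) exp n
  dominates.\<close>

lemma lagrange_weight_le:
  fixes b \<theta> z :: real
  assumes b: "0 < b" and n: "j < n" and \<theta>: "0 \<le> \<theta>" "\<theta> \<le> b / n" and z: "0 \<le> z" "z \<le> b\<^sup>2"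
    and s: "\<And>i::nat. s i = complex_of_real ((b + i * (b / n) + \<theta>)\<^sup>2)"
  shows "cmod (\<Prod>i\<in>{..<n} - {j}. (of_real z - s i) / (s j - s i)) \<le> exp (3 * real n)"
proof -
  define y where "y i = b + real i * (b / n) + \<theta>" for i :: nat
  have n0: "real n > 0" using n by simp
  have y: "b \<le> y i" "y i \<le> 2 * b" if "i < n" for i
  proof -
    show "b \<le> y i" using b \<theta> n0 by (simp add: y_def)
    have "real i * (b / n) + \<theta> \<le> real (n - 1) * (b / n) + b / n"
      using that b \<theta> n0 by (intro add_mono mult_right_mono) auto
    also have "\<dots> = b" using n0 that by (simp add: of_nat_diff field_simps)
    finally show "y i \<le> 2 * b" by (simp add: y_def)
  qed
  have ratio: "cmod ((of_real z - s i) / (s j - s i)) \<le> 2 * real n / \<bar>real j - real i\<bar>"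
    if i: "i \<in> {..<n} - {j}" for i
  proof -
    have "cmod (of_real z - s i) = \<bar>z - (y i)\<^sup>2\<bar>"
      unfolding s y_def[symmetric] by (metis norm_of_real of_real_diff real_norm_def)
    also have "\<dots> \<le> 4 * b\<^sup>2"
    proof -
      have "(y i)\<^sup>2 \<le> (2 * b)\<^sup>2" using y[of i] i b by (intro power_mono) auto
      moreover have "0 \<le> (y i)\<^sup>2" "0 \<le> b\<^sup>2" "(2 * b)\<^sup>2 = 4 * b\<^sup>2" by auto
      ultimately show ?thesis using z by (intro abs_leI) linarith+
    qed
    finally have num: "cmod (of_real z - s i) \<le> 4 * b\<^sup>2" .
    have "cmod (s j - s i) = \<bar>(y j)\<^sup>2 - (y i)\<^sup>2\<bar>"
      unfolding s y_def[symmetric] by (metis norm_of_real of_real_diff real_norm_def)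
    also have "(y j)\<^sup>2 - (y i)\<^sup>2 = (real j - real i) * (b / n) * (y j + y i)"
      by (simp add: y_def power2_eq_square algebra_simps)
    also have "\<bar>\<dots>\<bar> = \<bar>real j - real i\<bar> * (b / n) * (y j + y i)"
      using y[of i] y[of j] i n b by (simp add: abs_mult)
    also have "\<dots> \<ge> \<bar>real j - real i\<bar> * (b / n) * (b + b)"
      using y[of i] y[of j] i n b by (intro mult_left_mono add_mono) auto
    finally have den: "\<bar>real j - real i\<bar> * (b / n) * (2 * b) \<le> cmod (s j - s i)" by simp
    have ji: "\<bar>real j - real i\<bar> > 0" using i by auto
    have "cmod ((of_real z - s i) / (s j - s i)) \<le> 4 * b\<^sup>2 / (\<bar>real j - real i\<bar> * (b / n) * (2 * b))"
      unfolding norm_divide using num den ji b n0 by (intro frac_le) auto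
    also have "\<dots> = 2 * real n / \<bar>real j - real i\<bar>"
      using ji b n0 by (simp add: field_simps power2_eq_square)
    finally show ?thesis .
  qed
  have "cmod (\<Prod>i\<in>{..<n} - {j}. (of_real z - s i) / (s j - s i))
      \<le> (\<Prod>i\<in>{..<n} - {j}. 2 * real n / \<bar>real j - real i\<bar>)"
    unfolding prod_norm[symmetric] by (intro prod_mono conjI ratio) auto
  also have "\<dots> = (2 * real n) ^ (n - 1) / (fact j * fact (n - 1 - j))"
    using n by (simp add: prod_dividef prod_abs_diff_nat)
  also have "\<dots> = (2 * real n) ^ (n - 1) * real ((n - 1) choose j) / fact (n - 1)"
  proof -
    have "(fact (n - 1) :: real) = fact j * fact (n - 1 - j) * real ((n - 1) choose j)"
      using binomial_fact_lemma[of j "n - 1"] n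
      by (metis (mono_tags, lifting) Suc_pred' less_Suc_eq_le of_nat_fact of_nat_mult less_nat_zero_code not_gr_zero)
    then show ?thesis using n by (simp add: field_simps)
  qed
  also have "\<dots> \<le> (2 * real n) ^ (n - 1) * 2 ^ (n - 1) / fact (n - 1)"
  proof -
    have "(n - 1) choose j \<le> 2 ^ (n - 1)" by (rule binomial_le_pow2)
    then have "real ((n - 1) choose j) \<le> 2 ^ (n - 1)"
      by (metis of_nat_le_iff of_nat_numeral of_nat_power)
    then show ?thesis by (intro divide_right_mono mult_left_mono) auto
  qed
  also have "\<dots> = 4 ^ (n - 1) * (real n ^ (n - 1) / fact (n - 1))"
  proof -
    have "(4::real) ^ (n - 1) = 2 ^ (n - 1) * 2 ^ (n - 1)"
      by (simp flip: power_mult_distrib)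
    then show ?thesis by (simp add: power_mult_distrib)
  qed
  also have "\<dots> \<le> (exp 2) ^ n * exp (real n)"
  proof (intro mult_mono power_div_fact_le_exp)
    have "(4::real) ^ (n - 1) \<le> 4 ^ n" by (intro power_increasing) auto
    also have "\<dots> \<le> (exp 2) ^ n" by (intro power_mono four_le_exp_2) auto
    finally show "(4::real) ^ (n - 1) \<le> (exp 2) ^ n" .
  qed auto
  also have "\<dots> = exp (3 * real n)"
    by (simp add: exp_of_nat_mult[symmetric] exp_add[symmetric] mult.commute)
  finally show ?thesis .
qed

text \<open>Letting the shift run over one mesh width makes the nodes sweep the whole interval; this
  turns values at nodes into a mean square.\<close>

lemma integral_subdivide:
  fixes F :: "real \<Rightarrow> real"
  assumes cont: "continuous_on UNIV F" and h: "0 \<le> h"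
  shows "(\<Sum>j<m. integral {0..h} (\<lambda>\<theta>. F (b + real j * h + \<theta>))) = integral {b..b + real m * h} F"
proof (induction m)
  case (Suc m)
  have io: "F integrable_on {c..d}" for c d
    by (intro integrable_continuous_interval continuous_on_subset[OF cont]) auto
  have "integral {0..h} (F \<circ> (\<lambda>\<theta>. \<theta> + (b + real m * h)))
      = integral {0 + (b + real m * h)..h + (b + real m * h)} F"
    by (intro integral_shift continuous_on_subset[OF cont]) auto
  then have "integral {0..h} (\<lambda>\<theta>. F (b + real m * h + \<theta>)) = integral {b + real m * h..b + real (Suc m) * h} F"
    by (simp add: o_def algebra_simps)
  moreover have "integral {b..b + real m * h} F + integral {b + real m * h..b + real (Suc m) * h} F
      = integral {b..b + real (Suc m) * h} F"
    using h io by (intro Henstock_Kurzweil_Integration.integral_combine) (auto simp: algebra_simps)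
  ultimately show ?case using Suc.IH by simp
qed simp

text \<open>Lagrange interpolation in \<open>x\<^sup>2\<close> at the nodes \<open>b + j b / n + \<theta>\<close> in \<open>[b, 2 b]\<close>, averaged over the shift \<open>\<theta>\<close>.\<close>

lemma even_polynomial_le_integral:
  fixes a :: "nat \<Rightarrow> complex" and b x :: real and n :: nat
  defines "Q \<equiv> \<lambda>s. \<Sum>k<n. a k * of_real s ^ k"
  assumes b: "0 < b" and n: "0 < n" and x: "0 \<le> x" "x \<le> b"
  shows "(cmod (Q (x\<^sup>2)))\<^sup>2 \<le> exp (8 * real n) / b * integral {b..2 * b} (\<lambda>y. (cmod (Q (y\<^sup>2)))\<^sup>2)"
proof -
  define p where "p = (\<Sum>k<n. monom (a k) k)"
  have Q: "Q s = poly p (of_real s)" for s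
    by (simp add: Q_def p_def poly_sum poly_monom)
  have deg: "degree p < n"
    using n unfolding p_def
    by (intro le_less_trans[OF degree_sum_le[of _ _ "n - 1"]]) (auto intro: order_trans[OF degree_monom_le])
  define h where "h = b / real n"
  have h: "0 < h" using b n by (simp add: h_def)
  define F where "F y = (cmod (Q (y\<^sup>2)))\<^sup>2" for y
  have contF: "continuous_on S F" for S
    unfolding F_def Q_def by (intro continuous_intros)
  have pt: "(cmod (Q (x\<^sup>2)))\<^sup>2 \<le> real n * exp (6 * real n) * (\<Sum>j<n. F (b + real j * h + \<theta>))"
    if \<theta>: "\<theta> \<in> {0..h}" for \<theta>
  proof -
    define s where "s i = complex_of_real ((b + real i * (b / n) + \<theta>)\<^sup>2)" for i :: nat
    have inj: "inj_on s {..<n}"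
    proof (rule inj_onI)
      fix i j assume "s i = s j"
      then have "(b + real i * (b / n) + \<theta>)\<^sup>2 = (b + real j * (b / n) + \<theta>)\<^sup>2"
        unfolding s_def using of_real_eq_iff by blast
      then have "b + real i * (b / n) + \<theta> = b + real j * (b / n) + \<theta>"
        by (rule power2_eq_imp_eq) (use b \<theta> in auto)
      then show "i = j" using b n by simp
    qed
    define w where "w j = (\<Prod>i\<in>{..<n} - {j}. (of_real (x\<^sup>2) - s i) / (s j - s i))" for j
    have w: "cmod (w j) \<le> exp (3 * real n)" if "j < n" for j
      unfolding w_def using b that \<theta> x
      by (intro lagrange_weight_le[where b = b and \<theta> = \<theta>]) (auto simp: h_def s_def power_mono)
    have Qs: "(cmod (poly p (s j)))\<^sup>2 = F (b + real j * h + \<theta>)" for j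
      by (simp add: F_def Q s_def h_def)
    have "cmod (Q (x\<^sup>2)) = cmod (\<Sum>j<n. poly p (s j) * w j)"
      unfolding Q w_def using lagrange_interpolation[OF inj deg, of "of_real (x\<^sup>2)"] by simp
    also have "\<dots> \<le> (\<Sum>j<n. cmod (poly p (s j)) * exp (3 * real n))"
      by (intro sum_norm_le) (auto simp: norm_mult intro!: mult_left_mono w)
    finally have "(cmod (Q (x\<^sup>2)))\<^sup>2 \<le> (\<Sum>j<n. cmod (poly p (s j)) * exp (3 * real n))\<^sup>2"
      by (intro power_mono) auto
    also have "\<dots> \<le> (\<Sum>j<n. (cmod (poly p (s j)))\<^sup>2) * (\<Sum>j<n. (exp (3 * real n))\<^sup>2)"
      by (rule Cauchy_Schwarz_ineq_sum)
    also have "(exp (3 * real n))\<^sup>2 = exp (6 * real n)"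
      by (simp add: power2_eq_square exp_add[symmetric])
    finally show ?thesis by (simp add: Qs mult.commute mult.left_commute)
  qed
  have "h * (cmod (Q (x\<^sup>2)))\<^sup>2 = integral {0..h} (\<lambda>\<theta>. (cmod (Q (x\<^sup>2)))\<^sup>2)"
    using h by simp
  also have "\<dots> \<le> integral {0..h} (\<lambda>\<theta>. real n * exp (6 * real n) * (\<Sum>j<n. F (b + real j * h + \<theta>)))"
    by (intro integral_le pt integrable_continuous_interval continuous_intros
        continuous_on_compose2[OF contF[of UNIV]]) auto
  also have "\<dots> = real n * exp (6 * real n) * (\<Sum>j<n. integral {0..h} (\<lambda>\<theta>. F (b + real j * h + \<theta>)))"
    unfolding integral_mult_right
    by (subst integral_sum) (auto intro!: integrable_continuous_interval continuous_intros
        continuous_on_compose2[OF contF[of UNIV]])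
  also have "\<dots> = real n * exp (6 * real n) * integral {b..2 * b} F"
    using h n integral_subdivide[OF contF, of h b n] by (simp add: h_def)
  finally have "h * (cmod (Q (x\<^sup>2)))\<^sup>2 \<le> real n * exp (6 * real n) * integral {b..2 * b} F" .
  then have "(cmod (Q (x\<^sup>2)))\<^sup>2 \<le> (real n)\<^sup>2 * exp (6 * real n) / b * integral {b..2 * b} F"
    using b n by (simp add: h_def field_simps power2_eq_square)
  \<comment> \<open>The exponent 8 is 6 from the squared weights plus 2 for n^2, where one factor n
    comes from Cauchy-Schwarz and the other from the mesh width \<open>h = b / n\<close>.\<close>
  also have "\<dots> \<le> exp (8 * real n) / b * integral {b..2 * b} F"
  proof (intro mult_right_mono divide_right_mono)
    have "(real n)\<^sup>2 \<le> (exp (real n))\<^sup>2"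
      using exp_ge_add_one_self[of "real n"] by (intro power_mono) linarith+
    then have "(real n)\<^sup>2 * exp (6 * real n) \<le> (exp (real n))\<^sup>2 * exp (6 * real n)" by simp
    also have "\<dots> = exp (8 * real n)"
      by (simp add: power2_eq_square exp_add[symmetric])
    finally show "(real n)\<^sup>2 * exp (6 * real n) \<le> exp (8 * real n)" .
    show "0 \<le> integral {b..2 * b} F"
      by (intro integral_nonneg integrable_continuous_interval contF) (auto simp: F_def)
  qed (use b in auto)
  finally show ?thesis by (simp add: F_def[abs_def])
qed


section \<open>Gaussian moments\<close>


lemma half_line_AE_iff: "(AE x in half_line. P x) \<longleftrightarrow> (AE x in lebesgue. 0 < x \<longrightarrow> P x)"
  by (subst AE_restrict_space_iff) auto

lemma half_line_measurable_continuous: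
  "continuous_on {0<..} f \<Longrightarrow> f \<in> borel_measurable half_line"
  by (rule continuous_imp_measurable_on_sets_lebesgue) auto

lemma has_integral_open_half_line:
  fixes f :: "real \<Rightarrow> 'a::banach"
  assumes "(f has_integral I) {0..}"
  shows "(f has_integral I) {0<..}"
proof -
  have "((\<lambda>t. if t \<in> {0<..} then f t else 0) has_integral I) {0..}"
    by (rule has_integral_spike[OF _ _ assms, of "{0}"]) auto
  then show ?thesis by (subst (asm) has_integral_restrict) auto
qed

lemma half_line_has_integral_nonneg:
  fixes f :: "real \<Rightarrow> real"
  assumes "(f has_integral I) {0<..}" "\<And>x. 0 < x \<Longrightarrow> 0 \<le> f x"
  shows "has_bochner_integral half_line f I"
proof -
  have "f absolutely_integrable_on {0<..}"
    using assms by (intro nonnegative_absolutely_integrable_1) auto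
  then have i: "integrable half_line f"
    by (simp add: integrable_restrict_space set_integrable_def)
  moreover have "(LINT x|half_line. f x) = I"
    using lebesgue_integral_eq_integral[OF i] assms(1) by (simp add: integral_unique)
  ultimately show ?thesis by (simp add: has_bochner_integral_iff)
qed

text \<open>Substitution t = a x^2 in Euler's integral for \<open>Gamma s\<close> with s = (r + 1) /
  2.\<close>

lemma gaussian_moment:
  fixes r a :: real
  assumes r: "- 1 < r" and a: "0 < a"
  shows "has_bochner_integral half_line (\<lambda>x. x powr r * exp (- a * x\<^sup>2))
    (Gamma ((r + 1) / 2) / (2 * a powr ((r + 1) / 2)))"
proof -
  define s where "s = (r + 1) / 2"
  have s: "0 < s" "r = 2 * s - 1" using r by (simp_all add: s_def field_simps)
  define f where "f t = t powr (s - 1) / exp t" for t :: real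
  define g where "g x = a * x\<^sup>2" for x :: real
  have img: "g ` {0<..} = {0<..}"
  proof (intro equalityI subsetI)
    fix t :: real assume t: "t \<in> {0<..}"
    then have "g (sqrt (t / a)) = t" "sqrt (t / a) \<in> {0<..}" using a by (auto simp: g_def)
    then show "t \<in> g ` {0<..}" by (metis imageI)
  qed (use a in \<open>auto simp: g_def\<close>)
  have f0: "(f has_integral Gamma s) {0<..}"
    using has_integral_open_half_line[OF Gamma_integral_real[OF s(1)]] by (simp add: f_def[abs_def])
  have "f absolutely_integrable_on {0<..} \<and> integral {0<..} f = Gamma s"
    using f0 by (auto intro!: nonnegative_absolutely_integrable_1 simp: f_def integral_unique has_integral_integrable)
  moreover have "(g has_field_derivative 2 * a * x) (at x within {0<..})" for x
    unfolding g_def by (auto intro!: derivative_eq_intros)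
  moreover have "inj_on g {0<..}"
    using a by (auto simp: g_def inj_on_def)
  ultimately have abs: "(\<lambda>x. \<bar>2 * a * x\<bar> * f (g x)) absolutely_integrable_on {0<..}"
    and int: "integral {0<..} (\<lambda>x. \<bar>2 * a * x\<bar> * f (g x)) = Gamma s"
    using has_absolute_integral_change_of_variables_1'[of "{0<..}" g "\<lambda>x. 2 * a * x" f "Gamma s"]
    by (simp_all add: img)
  have "((\<lambda>x. \<bar>2 * a * x\<bar> * f (g x)) has_integral Gamma s) {0<..}"
    using set_lebesgue_integral_eq_integral(1)[OF abs] int by (simp add: has_integral_integrable_integral)
  then have base: "((\<lambda>x. (1 / (2 * a powr s)) * (\<bar>2 * a * x\<bar> * f (g x))) has_integral (1 / (2 * a powr s)) * Gamma s) {0<..}"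
    by (rule has_integral_mult_right)
  have eq: "(1 / (2 * a powr s)) * (\<bar>2 * a * x\<bar> * f (g x)) = x powr r * exp (- a * x\<^sup>2)"
    if "x \<in> {0<..}" for x
  proof -
    have x: "0 < x" using that by simp
    have "(a * x\<^sup>2) powr (s - 1) = a powr (s - 1) * x powr (2 * (s - 1))"
      using a x by (simp add: powr_mult powr_powr flip: powr_numeral)
    moreover have "a * a powr (s - 1) = a powr s" using a by (simp add: powr_mult_base)
    moreover have "x * x powr (2 * (s - 1)) = x powr r" using x s by (simp add: powr_mult_base)
    ultimately have K: "\<bar>2 * a * x\<bar> * (a * x\<^sup>2) powr (s - 1) = 2 * a powr s * x powr r"
      using a x by (simp add: mult.assoc mult.left_commute)
    have fg: "f (g x) = (a * x\<^sup>2) powr (s - 1) * exp (- a * x\<^sup>2)"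
      by (simp add: f_def g_def exp_minus divide_inverse)
    have "(1 / (2 * a powr s)) * (\<bar>2 * a * x\<bar> * f (g x))
        = (1 / (2 * a powr s)) * (\<bar>2 * a * x\<bar> * (a * x\<^sup>2) powr (s - 1)) * exp (- a * x\<^sup>2)"
      by (simp only: fg mult.assoc)
    also have "\<dots> = x powr r * exp (- a * x\<^sup>2)" unfolding K using a by simp
    finally show ?thesis .
  qed
  have "((\<lambda>x. x powr r * exp (- a * x\<^sup>2)) has_integral (1 / (2 * a powr s)) * Gamma s) {0<..}"
    by (rule has_integral_eq[OF eq base])
  from half_line_has_integral_nonneg[OF this] show ?thesis by (simp add: s_def)
qed


section \<open>Determinacy of the Gaussian moments\<close>

text \<open>Weierstrass approximation on \<open>{0..1}\<close>: a uniform error e / (H + 1) changes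
  the integral by at most e, where H is the L^1 norm of \<open>h\<close> and the 1 guards against H
  = 0. With \<open>g x = exp (- x\<^sup>2)\<close> the polynomial moments become Gaussian
  ones.\<close>

lemma polynomial_moments_imp_continuous_moments:
  fixes h g :: "'a \<Rightarrow> real"
  assumes h: "integrable M h" and g: "g \<in> borel_measurable M" "\<And>x. x \<in> space M \<Longrightarrow> g x \<in> {0..1}"
    and zero: "\<And>j::nat. (LINT x|M. h x * g x ^ j) = 0"
    and \<phi>: "continuous_on UNIV \<phi>"
  shows "(LINT x|M. h x * \<phi> (g x)) = 0"
proof -
  define H where "H = (LINT x|M. \<bar>h x\<bar>)"
  have H: "0 \<le> H" by (simp add: H_def)
  have bd: "integrable M (\<lambda>x. h x * f (g x))" if f: "continuous_on UNIV f" for f :: "real \<Rightarrow> real"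
  proof -
    have "compact (f ` {0..1})"
      by (intro compact_continuous_image continuous_on_subset[OF f]) auto
    then obtain B where B: "\<And>s. s \<in> {0..1} \<Longrightarrow> \<bar>f s\<bar> \<le> B"
      by (force dest!: compact_imp_bounded simp: bounded_iff)
    have [measurable]: "f \<in> borel_measurable borel"
      using f by (rule borel_measurable_continuous_onI)
    show ?thesis
    proof (rule Bochner_Integration.integrable_bound)
      show "integrable M (\<lambda>x. B * \<bar>h x\<bar>)" using h by auto
      show "(\<lambda>x. h x * f (g x)) \<in> borel_measurable M" using h g(1) by measurable
      show "AE x in M. norm (h x * f (g x)) \<le> norm (B * \<bar>h x\<bar>)"
      proof (rule AE_I2)
        fix x assume "x \<in> space M"
        from B[OF g(2)[OF this]] have "\<bar>f (g x)\<bar> \<le> \<bar>B\<bar>" by linarith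
        then show "norm (h x * f (g x)) \<le> norm (B * \<bar>h x\<bar>)"
          by (simp add: abs_mult mult.commute[of "\<bar>h x\<bar>"] mult_right_mono)
      qed
    qed
  qed
  have "\<bar>LINT x|M. h x * \<phi> (g x)\<bar> \<le> e" if e: "0 < e" for e
  proof -
    obtain p where p: "real_polynomial_function p" "\<And>s. s \<in> {0..1} \<Longrightarrow> \<bar>\<phi> s - p s\<bar> < e / (H + 1)"
      using Stone_Weierstrass_real_polynomial_function[of "{0..1}" \<phi> "e / (H + 1)"] e H
        continuous_on_subset[OF \<phi>, of "{0..1}"] by auto
    then obtain a n where an: "p = (\<lambda>s. \<Sum>i\<le>n. a i * s ^ i)"
      by (auto simp: real_polynomial_function_iff_sum)
    have pw: "integrable M (\<lambda>x. h x * g x ^ i)" for i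
      by (intro bd continuous_intros)
    have cp: "continuous_on UNIV p" unfolding an by (intro continuous_intros)
    have "(LINT x|M. h x * p (g x)) = (LINT x|M. (\<Sum>i\<le>n. a i * (h x * g x ^ i)))"
      unfolding an by (simp add: sum_distrib_left mult.left_commute)
    also have "\<dots> = 0" using pw by (simp add: zero)
    finally have "(LINT x|M. h x * \<phi> (g x)) = (LINT x|M. h x * \<phi> (g x)) - (LINT x|M. h x * p (g x))"
      by simp
    also have "\<dots> = (LINT x|M. h x * \<phi> (g x) - h x * p (g x))"
      by (intro Bochner_Integration.integral_diff[symmetric] bd \<phi> cp)
    also have "\<bar>\<dots>\<bar> \<le> (LINT x|M. \<bar>h x * \<phi> (g x) - h x * p (g x)\<bar>)"
      by (rule integral_abs_bound)
    also have "\<dots> \<le> (LINT x|M. e / (H + 1) * \<bar>h x\<bar>)"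
    proof (intro integral_mono)
      show "integrable M (\<lambda>x. \<bar>h x * \<phi> (g x) - h x * p (g x)\<bar>)"
        by (intro integrable_abs Bochner_Integration.integrable_diff bd \<phi> cp)
      show "integrable M (\<lambda>x. e / (H + 1) * \<bar>h x\<bar>)" using h by auto
      fix x assume "x \<in> space M"
      from p(2)[OF g(2)[OF this]] have "\<bar>\<phi> (g x) - p (g x)\<bar> \<le> e / (H + 1)" by (rule less_imp_le)
      then have "\<bar>h x\<bar> * \<bar>\<phi> (g x) - p (g x)\<bar> \<le> \<bar>h x\<bar> * (e / (H + 1))" by (intro mult_left_mono) auto
      then show "\<bar>h x * \<phi> (g x) - h x * p (g x)\<bar> \<le> e / (H + 1) * \<bar>h x\<bar>"
        by (simp add: abs_mult[symmetric] right_diff_distrib mult.commute)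
    qed
    also have "\<dots> = e * (H / (H + 1))" by (simp add: H_def)
    also have "\<dots> \<le> e * 1" using e H by (intro mult_left_mono) auto
    finally show ?thesis by simp
  qed
  then have "\<bar>LINT x|M. h x * \<phi> (g x)\<bar> \<le> 0" by (rule field_le_epsilon) simp
  then show ?thesis by simp
qed

text \<open>As exp (- x^2) is injective on the half-line, the indicator of \<open>T\<close> is a
  function of it, namely the indicator of the compact image \<open>T'\<close>. That one is the
  pointwise limit of the continuous tents \<open>\<phi> n\<close>, and |h| dominates.\<close>

lemma gaussian_moments_compact_integral:
  fixes h :: "real \<Rightarrow> real"
  assumes h: "integrable half_line h"
    and zero: "\<And>j::nat. (LINT x|half_line. h x * exp (- x\<^sup>2) ^ j) = 0"
    and T: "compact T" "T \<subseteq> {0<..}" "T \<noteq> {}"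
  shows "(LINT x|half_line. h x * indicator T x) = 0"
proof -
  define g where "g x = exp (- x\<^sup>2)" for x :: real
  define T' where "T' = g ` T"
  have T': "compact T'" "closed T'" "T' \<noteq> {}"
    using T unfolding T'_def g_def
    by (auto intro!: compact_continuous_image continuous_intros compact_imp_closed)
  have gT: "g x \<in> T' \<longleftrightarrow> x \<in> T" if "0 < x" for x
  proof
    assume "g x \<in> T'"
    then obtain y where "y \<in> T" "x\<^sup>2 = y\<^sup>2" by (auto simp: T'_def g_def)
    with T(2) that show "x \<in> T" by (metis greaterThan_iff less_imp_le power2_eq_imp_eq subsetD)
  qed (auto simp: T'_def)
  define \<phi> where "\<phi> n s = max 0 (1 - real n * infdist s T')" for n s
  have c\<phi>: "continuous_on UNIV (\<phi> n)" for n
    unfolding \<phi>_def by (intro continuous_intros)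
  have gm: "g \<in> borel_measurable half_line"
    unfolding g_def by (intro half_line_measurable_continuous continuous_intros)
  have z: "(LINT x|half_line. h x * \<phi> n (g x)) = 0" for n
    by (rule polynomial_moments_imp_continuous_moments[OF h gm _ _ c\<phi>])
      (use zero in \<open>auto simp: g_def\<close>)
  have [measurable]: "\<phi> n \<in> borel_measurable borel" for n
    using c\<phi> by (rule borel_measurable_continuous_onI)
  have Tm: "T \<in> sets half_line"
    using T compact_imp_closed[OF T(1)] by (auto simp: sets_restrict_space_iff)
  have "(\<lambda>n. LINT x|half_line. h x * \<phi> n (g x)) \<longlonglongrightarrow> (LINT x|half_line. h x * indicator T x)"
  proof (rule integral_dominated_convergence)
    show "integrable half_line (\<lambda>x. \<bar>h x\<bar>)" using h by simp
    show "(\<lambda>x. h x * indicator T x) \<in> borel_measurable half_line" using h Tm by measurable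
    show "(\<lambda>x. h x * \<phi> n (g x)) \<in> borel_measurable half_line" for n using h gm by measurable
    show "AE x in half_line. norm (h x * \<phi> n (g x)) \<le> \<bar>h x\<bar>" for n
    proof (rule AE_I2)
      fix x
      have "\<bar>\<phi> n (g x)\<bar> \<le> 1" by (auto simp: \<phi>_def infdist_nonneg)
      then show "norm (h x * \<phi> n (g x)) \<le> \<bar>h x\<bar>" by (simp add: abs_mult mult_left_le)
    qed
    show "AE x in half_line. (\<lambda>n. h x * \<phi> n (g x)) \<longlonglongrightarrow> h x * indicator T x"
    proof (rule AE_I2)
      fix x assume "x \<in> space half_line"
      then have x: "0 < x" by simp
      show "(\<lambda>n. h x * \<phi> n (g x)) \<longlonglongrightarrow> h x * indicator T x"
      proof (cases "x \<in> T")
        case True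
        then have "infdist (g x) T' = 0" using gT[OF x] by simp
        then show ?thesis using True by (simp add: \<phi>_def)
      next
        case False
        then have "infdist (g x) T' > 0"
          using gT[OF x] T' by (metis in_closed_iff_infdist_zero infdist_nonneg less_eq_real_def)
        then obtain m where m: "real m * infdist (g x) T' > 1" using reals_Archimedean3 by blast
        have "\<forall>\<^sub>F n in sequentially. h x * \<phi> n (g x) = h x * indicator T x"
          using eventually_ge_at_top[of m]
        proof eventually_elim
          fix n assume "m \<le> n"
          then have "real m * infdist (g x) T' \<le> real n * infdist (g x) T'"
            by (intro mult_right_mono) (auto simp: infdist_nonneg)
          with m False show "h x * \<phi> n (g x) = h x * indicator T x" by (simp add: \<phi>_def)
        qed
        then show ?thesis by (rule tendsto_eventually)
      qed
    qed
  qed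
  then show ?thesis unfolding z by (simp add: LIMSEQ_const_iff)
qed

text \<open>On a closed \<open>T\<close> inside the set where h > 0, the integral of h is 0 although
  h is positive there, so \<open>T\<close> is null; inner regularity makes the rest of the set
  arbitrarily small. The truncation at \<open>k\<close> makes closed subsets compact.\<close>

lemma gaussian_moments_nonpos:
  fixes h :: "real \<Rightarrow> real"
  assumes h: "integrable half_line h"
    and zero: "\<And>j::nat. (LINT x|half_line. h x * exp (- x\<^sup>2) ^ j) = 0"
  shows "AE x in half_line. h x \<le> 0"
proof -
  have hm: "h \<in> borel_measurable half_line" using h by simp
  define P where "P k = {x \<in> {0<..}. 0 < h x} \<inter> {..real k}" for k :: nat
  have P: "P k \<in> sets lebesgue" for k
  proof -
    have "{x \<in> space half_line. 0 < h x} \<in> sets half_line" using hm by measurable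
    then have "{x \<in> {0<..}. 0 < h x} \<in> sets lebesgue"
      by (simp add: sets_restrict_space_iff)
    then show ?thesis unfolding P_def by (rule sets.Int) simp
  qed
  have null: "emeasure lebesgue (P k) = 0" for k
  proof -
    have small: "emeasure lebesgue (P k) \<le> ennreal e" if e: "0 < e" for e
    proof -
      obtain T where T: "closed T" "T \<subseteq> P k" "P k - T \<in> lmeasurable" "emeasure lebesgue (P k - T) < ennreal e"
        using sets_lebesgue_inner_closed[OF P e] by metis
      have T0: "emeasure lebesgue T = 0"
      proof (cases "T = {}")
        case False
        have sub: "T \<subseteq> {0<..}" and b: "T \<subseteq> {0..real k}" using T(2) by (auto simp: P_def subset_iff)
        have cT: "compact T"
          using T(1) b by (metis bounded_closed_interval bounded_subset compact_eq_bounded_closed)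
        have z: "(LINT x|half_line. h x * indicator T x) = 0"
          by (rule gaussian_moments_compact_integral[OF h zero cT sub False])
        have Tm: "T \<in> sets half_line" using T(1) sub by (auto simp: sets_restrict_space_iff)
        have "integrable half_line (\<lambda>x. h x * indicator T x)"
          using h Tm by (intro integrable_real_mult_indicator) auto
        moreover have "AE x in half_line. 0 \<le> h x * indicator T x"
          using T(2) by (intro AE_I2) (auto simp: P_def indicator_def)
        ultimately have "AE x in half_line. h x * indicator T x = 0"
          using z integral_nonneg_eq_0_iff_AE by blast
        then have "AE x in half_line. x \<notin> T"
          using T(2) by (elim eventually_mono) (auto simp: P_def indicator_def split: if_splits)
        then have "AE x in lebesgue. x \<notin> T" unfolding half_line_AE_iff
          by (elim eventually_mono) (use sub in auto)
        then show ?thesis using T(1) by (subst (asm) AE_iff_measurable[of T]) auto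
      qed simp
      have "emeasure lebesgue (P k) \<le> emeasure lebesgue (T \<union> (P k - T))"
        using T P[of k] by (intro emeasure_mono) auto
      also have "\<dots> \<le> emeasure lebesgue T + emeasure lebesgue (P k - T)"
        using T by (intro emeasure_subadditive) auto
      finally show ?thesis using T(4) T0 by simp
    qed
    have "emeasure lebesgue (P k) \<le> 0"
    proof (rule ennreal_le_epsilon)
      fix e :: real assume "0 < e"
      then show "emeasure lebesgue (P k) \<le> 0 + ennreal e" unfolding add_0 by (rule small)
    qed
    then show ?thesis unfolding le_zero_eq .
  qed
  have "AE x in lebesgue. x \<notin> P k" for k
    using P null by (intro AE_not_in) (auto simp: null_sets_def)
  then have "AE x in lebesgue. \<forall>k. x \<notin> P k" by (simp add: AE_all_countable)
  then show ?thesis unfolding half_line_AE_iff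
  proof eventually_elim
    fix x assume x: "\<forall>k. x \<notin> P k"
    obtain k where "x \<le> real k" using real_arch_simple by blast
    with x show "0 < x \<longrightarrow> h x \<le> 0" by (force simp: P_def not_less)
  qed
qed

lemma gaussian_moments_unique:
  fixes h :: "real \<Rightarrow> complex"
  assumes h: "integrable half_line h"
    and zero: "\<And>j::nat. (LINT x|half_line. h x * of_real (exp (- x\<^sup>2) ^ j)) = 0"
  shows "AE x in half_line. h x = 0"
proof -
  have i: "integrable half_line (\<lambda>x. h x * of_real (exp (- x\<^sup>2) ^ j))" for j
  proof (rule Bochner_Integration.integrable_bound[OF h])
    have "(\<lambda>x. complex_of_real (exp (- x\<^sup>2) ^ j)) \<in> borel_measurable half_line"
      by (intro half_line_measurable_continuous continuous_intros)
    then show "(\<lambda>x. h x * of_real (exp (- x\<^sup>2) ^ j)) \<in> borel_measurable half_line"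
      using h by measurable
    show "AE x in half_line. norm (h x * of_real (exp (- x\<^sup>2) ^ j)) \<le> norm (h x)"
      by (intro AE_I2) (auto simp: norm_mult norm_power intro!: mult_left_le power_le_one)
  qed
  have Re0: "(LINT x|half_line. Re (h x) * exp (- x\<^sup>2) ^ j) = 0" for j :: nat
    using integral_Re[OF i[of j]] zero[of j] by simp
  have Im0: "(LINT x|half_line. Im (h x) * exp (- x\<^sup>2) ^ j) = 0" for j :: nat
    using integral_Im[OF i[of j]] zero[of j] by simp
  have "AE x in half_line. Re (h x) \<le> 0"
    using gaussian_moments_nonpos[of "\<lambda>x. Re (h x)"] h Re0 by simp
  moreover have "AE x in half_line. - Re (h x) \<le> 0"
    using gaussian_moments_nonpos[of "\<lambda>x. - Re (h x)"] h Re0 by simp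
  moreover have "AE x in half_line. Im (h x) \<le> 0"
    using gaussian_moments_nonpos[of "\<lambda>x. Im (h x)"] h Im0 by simp
  moreover have "AE x in half_line. - Im (h x) \<le> 0"
    using gaussian_moments_nonpos[of "\<lambda>x. - Im (h x)"] h Im0 by simp
  ultimately show ?thesis
    by eventually_elim (simp add: complex_eq_iff)
qed


section \<open>Logarithmic cutoffs\<close>


text \<open>Serves the two end points of the cutoff, where a quadratic bound replaces any
  computation of one-sided derivatives.\<close>

lemma has_vector_derivative_zero_of_quadratic:
  fixes g :: "real \<Rightarrow> 'a::real_normed_vector"
  assumes g: "\<And>y. norm (g y) \<le> K * (y - x)\<^sup>2"
  shows "(g has_vector_derivative 0) (at x)"
  unfolding has_vector_derivative_def
proof (rule has_derivativeI_sandwich[where e = 1 and H = "\<lambda>y. K * \<bar>y - x\<bar>"])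
  show "((\<lambda>y. K * \<bar>y - x\<bar>) \<longlongrightarrow> 0) (at x)"
  proof -
    have "((\<lambda>y. K * \<bar>y - x\<bar>) \<longlongrightarrow> K * \<bar>x - x\<bar>) (at x)" by (intro tendsto_intros)
    then show ?thesis by simp
  qed
  fix y assume "y \<noteq> x"
  then have "0 < \<bar>y - x\<bar>" by simp
  moreover have "norm (g y) \<le> K * \<bar>y - x\<bar> * \<bar>y - x\<bar>"
    using g[of y] by (simp add: power2_eq_square mult.assoc flip: abs_mult)
  moreover have "g x = 0" using g[of x] by simp
  ultimately show "norm (g y - g x - (y - x) *\<^sub>R 0) / norm (y - x) \<le> K * \<bar>y - x\<bar>"
    by (simp add: divide_le_eq)
qed (auto intro: bounded_linear_zero)

text \<open>The cutoff \<open>\<chi>\<^sub>L(x) = exp (1 - 1 / w(x))\<close> with \<open>w(x) = 1 - (ln x / L)\<^sup>2\<close> is logarithmic: its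
  derivative is of size \<open>1 / (L x)\<close>, which is what makes it converge in the form sense in the
  critical case \<open>\<nu> = 0\<close> of Hardy's inequality.\<close>

definition log_weight :: "real \<Rightarrow> real \<Rightarrow> real" where
  "log_weight L x = 1 - (ln x / L)\<^sup>2"

definition cutoff_extension :: "real \<Rightarrow> (real \<Rightarrow> complex) \<Rightarrow> real \<Rightarrow> complex" where
  "cutoff_extension L f x =
    (if x \<in> {exp (- L)<..<exp L} then f x * of_real (exp (1 - 1 / log_weight L x)) else 0)"

text \<open>The derivatives of a cut-off Gaussian are \<open>cutoff_extension L f\<close> with \<open>f\<close> in an algebra that is closed under
  differentiation on the support; smoothness at the end points needs only that \<open>f\<close> is bounded by a power of
  \<open>1 / w\<close>.\<close>

inductive_set cutoff_algebra :: "real \<Rightarrow> complex \<Rightarrow> (real \<Rightarrow> complex) set" for L :: real and z :: complex where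
  const: "(\<lambda>x. k) \<in> cutoff_algebra L z"
| powr: "(\<lambda>x. of_real (x powr a)) \<in> cutoff_algebra L z"
| ln: "(\<lambda>x. of_real (ln x)) \<in> cutoff_algebra L z"
| gauss: "(\<lambda>x. exp (- z * of_real (x\<^sup>2))) \<in> cutoff_algebra L z"
| weight: "(\<lambda>x. of_real (1 / log_weight L x)) \<in> cutoff_algebra L z"
| add: "f \<in> cutoff_algebra L z \<Longrightarrow> g \<in> cutoff_algebra L z \<Longrightarrow> (\<lambda>x. f x + g x) \<in> cutoff_algebra L z"
| mult: "f \<in> cutoff_algebra L z \<Longrightarrow> g \<in> cutoff_algebra L z \<Longrightarrow> (\<lambda>x. f x * g x) \<in> cutoff_algebra L z"

lemma cutoff_interval:
  assumes "0 < L" "x \<in> {exp (- L)<..<exp L}"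
  shows "0 < x" "\<bar>ln x\<bar> < L" "0 < log_weight L x" "log_weight L x \<le> 1"
proof -
  show x: "0 < x" using assms(2) by (meson exp_gt_zero greaterThanLessThan_iff less_trans)
  have "ln (exp (- L)) < ln x" "ln x < ln (exp L)"
    using assms(2) x by (subst ln_less_cancel_iff; simp)+
  then show l: "\<bar>ln x\<bar> < L" by auto
  then have "\<bar>ln x / L\<bar> < 1" using assms(1) by simp
  then show "0 < log_weight L x" by (simp add: log_weight_def abs_square_less_1)
  show "log_weight L x \<le> 1" by (simp add: log_weight_def)
qed

lemma log_weight_deriv:
  assumes "0 < x" "L \<noteq> 0"
  shows "(log_weight L has_real_derivative - 2 / L\<^sup>2 * ln x * x powr - 1) (at x)"
  unfolding log_weight_def[abs_def] using assms
  by (auto intro!: derivative_eq_intros simp: powr_minus field_simps power2_eq_square)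

lemma has_vector_derivative_of_real_complex:
  assumes "(f has_real_derivative d) (at x)"
  shows "((\<lambda>x. complex_of_real (f x)) has_vector_derivative of_real d) (at x)"
  using assms has_vector_derivative_of_real has_real_derivative_iff_has_vector_derivative by blast

lemma exp_complex_square_derivative:
  fixes z :: complex
  shows "((\<lambda>x. exp (- z * of_real (x\<^sup>2))) has_vector_derivative
    (- 2 * z * of_real x) * exp (- z * of_real (x\<^sup>2))) (at x)"
proof -
  have "((\<lambda>w. exp (- z * w\<^sup>2)) has_field_derivative exp (- z * (of_real x)\<^sup>2) * (- z * (2 * of_real x))) (at (of_real x))"
    by (auto intro!: derivative_eq_intros)
  then have "((\<lambda>x. exp (- z * (of_real x)\<^sup>2)) has_vector_derivative
      exp (- z * (of_real x)\<^sup>2) * (- z * (2 * of_real x))) (at x)"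
    by (rule has_vector_derivative_real_field)
  then show ?thesis by (simp add: mult.assoc mult.commute mult.left_commute)
qed

lemma cutoff_algebra_derivative:
  assumes L: "0 < L" and f: "f \<in> cutoff_algebra L z"
  shows "\<exists>f'\<in>cutoff_algebra L z. \<forall>x\<in>{exp (- L)<..<exp L}. (f has_vector_derivative f' x) (at x)"
  using f
proof induction
  case (const k)
  show ?case by (intro bexI[of _ "\<lambda>x. 0"] cutoff_algebra.const) auto
next
  case (powr a)
  show ?case
  proof (intro bexI[of _ "\<lambda>x. of_real a * of_real (x powr (a - 1))"] ballI)
    fix x assume "x \<in> {exp (- L)<..<exp L}"
    then have "0 < x" using cutoff_interval L by blast
    then have "((\<lambda>x. x powr a) has_real_derivative a * x powr (a - 1)) (at x)"
      by (rule has_real_derivative_powr)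
    from has_vector_derivative_of_real_complex[OF this]
    show "((\<lambda>x. complex_of_real (x powr a)) has_vector_derivative of_real a * of_real (x powr (a - 1))) (at x)"
      by simp
  qed (intro cutoff_algebra.intros)
next
  case ln
  show ?case
  proof (intro bexI[of _ "\<lambda>x. of_real (x powr - 1)"] ballI)
    fix x assume "x \<in> {exp (- L)<..<exp L}"
    then have "0 < x" using cutoff_interval L by blast
    then have "(ln has_real_derivative x powr - 1) (at x)"
      by (auto intro!: derivative_eq_intros simp: powr_minus divide_inverse)
    then show "((\<lambda>x. complex_of_real (ln x)) has_vector_derivative of_real (x powr - 1)) (at x)"
      by (rule has_vector_derivative_of_real_complex)
  qed (intro cutoff_algebra.intros)
next
  case gauss
  show ?case
  proof (intro bexI[of _ "\<lambda>x. (- 2 * z) * (of_real (x powr 1) * exp (- z * of_real (x\<^sup>2)))"] ballI)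
    fix x assume "x \<in> {exp (- L)<..<exp L}"
    then have "0 < x" using cutoff_interval L by blast
    show "((\<lambda>x. exp (- z * of_real (x\<^sup>2))) has_vector_derivative
        (- 2 * z) * (of_real (x powr 1) * exp (- z * of_real (x\<^sup>2)))) (at x)"
      using \<open>0 < x\<close> exp_complex_square_derivative[of z x] by (simp add: mult.assoc)
  qed (intro cutoff_algebra.intros)
next
  case weight
  show ?case
  proof (intro bexI[of _ "\<lambda>x. of_real (2 / L\<^sup>2) * (of_real (ln x) * (of_real (x powr - 1) *
      (of_real (1 / log_weight L x) * of_real (1 / log_weight L x))))"] ballI)
    fix x assume x: "x \<in> {exp (- L)<..<exp L}"
    note iv = cutoff_interval[OF L x]
    have "((\<lambda>x. 1 / log_weight L x) has_real_derivative
        - (- 2 / L\<^sup>2 * ln x * x powr - 1) / (log_weight L x * log_weight L x)) (at x)"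
      using iv L by (auto intro!: derivative_eq_intros log_weight_deriv)
    from has_vector_derivative_of_real_complex[OF this]
    show "((\<lambda>x. complex_of_real (1 / log_weight L x)) has_vector_derivative
        of_real (2 / L\<^sup>2) * (of_real (ln x) * (of_real (x powr - 1) *
      (of_real (1 / log_weight L x) * of_real (1 / log_weight L x))))) (at x)"
      by (simp add: mult.assoc)
  qed (intro cutoff_algebra.intros)
next
  case (add f g)
  then obtain f' g' where "f' \<in> cutoff_algebra L z" "g' \<in> cutoff_algebra L z"
    "\<And>x. x \<in> {exp (- L)<..<exp L} \<Longrightarrow> (f has_vector_derivative f' x) (at x)"
    "\<And>x. x \<in> {exp (- L)<..<exp L} \<Longrightarrow> (g has_vector_derivative g' x) (at x)" by blast
  then show ?case
    by (intro bexI[of _ "\<lambda>x. f' x + g' x"] ballI has_vector_derivative_add cutoff_algebra.add)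
next
  case (mult f g)
  then obtain f' g' where "f' \<in> cutoff_algebra L z" "g' \<in> cutoff_algebra L z"
    "\<And>x. x \<in> {exp (- L)<..<exp L} \<Longrightarrow> (f has_vector_derivative f' x) (at x)"
    "\<And>x. x \<in> {exp (- L)<..<exp L} \<Longrightarrow> (g has_vector_derivative g' x) (at x)" by blast
  then show ?case using mult.hyps
    by (intro bexI[of _ "\<lambda>x. f x * g' x + f' x * g x"] ballI has_vector_derivative_mult
        cutoff_algebra.add cutoff_algebra.mult)
qed

text \<open>Apart from \<open>1 / log_weight L x\<close>, every generator is bounded on the support.
  Since 1 / w is at least 1 there, exponents may be raised freely, and j + k serves for sums as well
  as products.\<close>

lemma cutoff_algebra_bound:
  assumes L: "0 < L" and f: "f \<in> cutoff_algebra L z"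
  shows "\<exists>C k. 0 \<le> C \<and> (\<forall>x\<in>{exp (- L)<..<exp L}. cmod (f x) \<le> C * (1 / log_weight L x) ^ k)"
proof -
  note iv = cutoff_interval[OF L]
  have mono: "a * (1 / log_weight L x) ^ j \<le> a * (1 / log_weight L x) ^ k"
    if "0 \<le> a" "j \<le> k" "x \<in> {exp (- L)<..<exp L}" for a x and j k :: nat
    using that iv[OF that(3)] by (intro mult_left_mono power_increasing) auto
  have bounded: "\<exists>C k. 0 \<le> C \<and> (\<forall>x\<in>{exp (- L)<..<exp L}. cmod (f x) \<le> C * (1 / log_weight L x) ^ k)"
    if "\<And>x. x \<in> {exp (- L)<..<exp L} \<Longrightarrow> cmod (f x) \<le> B" for f :: "real \<Rightarrow> complex" and B :: real
  proof (intro exI[of _ "\<bar>B\<bar>"] exI[of _ 0] conjI ballI)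
    fix x assume "x \<in> {exp (- L)<..<exp L}"
    from that[OF this] show "cmod (f x) \<le> \<bar>B\<bar> * (1 / log_weight L x) ^ 0" by simp
  qed simp
  show ?thesis using f
  proof induction
    case (const k)
    show ?case by (rule bounded[of _ "cmod k"]) simp
  next
    case (powr a)
    show ?case
    proof (rule bounded[of _ "exp (\<bar>a\<bar> * L)"])
      fix x assume x: "x \<in> {exp (- L)<..<exp L}"
      have "a * ln x \<le> \<bar>a\<bar> * \<bar>ln x\<bar>" by (metis abs_ge_self abs_mult)
      also have "\<dots> \<le> \<bar>a\<bar> * L" using iv[OF x] by (intro mult_left_mono) auto
      finally show "cmod (complex_of_real (x powr a)) \<le> exp (\<bar>a\<bar> * L)"
        using iv[OF x] by (simp add: powr_def)
    qed
  next
    case ln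
    show ?case by (rule bounded[of _ L]) (use iv in force)
  next
    case gauss
    show ?case
    proof (rule bounded[of _ "exp (cmod z * (exp L)\<^sup>2)"])
      fix x assume x: "x \<in> {exp (- L)<..<exp L}"
      have "Re (- z * of_real (x\<^sup>2)) \<le> cmod (- z * of_real (x\<^sup>2))" by (rule complex_Re_le_cmod)
      also have "\<dots> = cmod z * x\<^sup>2" by (simp add: norm_mult norm_power)
      also have "\<dots> \<le> cmod z * (exp L)\<^sup>2"
        using x iv[OF x] by (intro mult_left_mono power_mono) auto
      finally show "cmod (exp (- z * of_real (x\<^sup>2))) \<le> exp (cmod z * (exp L)\<^sup>2)"
        by (subst norm_exp_eq_Re) simp
    qed
  next
    case weight
    show ?case
    proof (intro exI[of _ 1] exI[of _ "1::nat"] conjI ballI)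
      fix x assume "x \<in> {exp (- L)<..<exp L}"
      then show "cmod (complex_of_real (1 / log_weight L x)) \<le> 1 * (1 / log_weight L x) ^ 1"
        using iv(3)[of x] by (simp add: norm_divide)
    qed simp
  next
    case (add f g)
    then obtain A j B k where "0 \<le> A" "0 \<le> B"
      and f: "\<And>x. x \<in> {exp (- L)<..<exp L} \<Longrightarrow> cmod (f x) \<le> A * (1 / log_weight L x) ^ j"
      and g: "\<And>x. x \<in> {exp (- L)<..<exp L} \<Longrightarrow> cmod (g x) \<le> B * (1 / log_weight L x) ^ k" by blast
    show ?case
    proof (intro exI[of _ "A + B"] exI[of _ "j + k"] conjI ballI)
      fix x assume x: "x \<in> {exp (- L)<..<exp L}"
      have "cmod (f x + g x) \<le> A * (1 / log_weight L x) ^ j + B * (1 / log_weight L x) ^ k"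
        using f[OF x] g[OF x] by (rule norm_triangle_mono)
      also have "\<dots> \<le> A * (1 / log_weight L x) ^ (j + k) + B * (1 / log_weight L x) ^ (j + k)"
        using \<open>0 \<le> A\<close> \<open>0 \<le> B\<close> by (intro add_mono mono x) auto
      finally show "cmod (f x + g x) \<le> (A + B) * (1 / log_weight L x) ^ (j + k)"
        by (simp add: distrib_right)
    qed (use \<open>0 \<le> A\<close> \<open>0 \<le> B\<close> in simp)
  next
    case (mult f g)
    then obtain A j B k where "0 \<le> A" "0 \<le> B"
      and f: "\<And>x. x \<in> {exp (- L)<..<exp L} \<Longrightarrow> cmod (f x) \<le> A * (1 / log_weight L x) ^ j"
      and g: "\<And>x. x \<in> {exp (- L)<..<exp L} \<Longrightarrow> cmod (g x) \<le> B * (1 / log_weight L x) ^ k" by blast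
    show ?case
    proof (intro exI[of _ "A * B"] exI[of _ "j + k"] conjI ballI)
      fix x assume x: "x \<in> {exp (- L)<..<exp L}"
      have "cmod (f x * g x) \<le> (A * (1 / log_weight L x) ^ j) * (B * (1 / log_weight L x) ^ k)"
        unfolding norm_mult using f[OF x] g[OF x] \<open>0 \<le> A\<close> iv[OF x]
        by (intro mult_mono) auto
      then show "cmod (f x * g x) \<le> A * B * (1 / log_weight L x) ^ (j + k)"
        by (simp add: power_add mult.assoc mult.left_commute)
    qed (use \<open>0 \<le> A\<close> \<open>0 \<le> B\<close> in simp)
  qed
qed

text \<open>With l = ln y / L the weight is (1 - l) (1 + l), which vanishes to first order at either
  end, and ln t \<le> t - 1 turns the logarithmic distance into the ordinary one. Powers of the
  weight thereby become powers of the distance to an end point.\<close>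

lemma log_weight_le_distance:
  assumes L: "0 < L" and y: "y \<in> {exp (- L)<..<exp L}"
  shows "log_weight L y \<le> 2 / L * exp L * \<bar>y - exp L\<bar>"
    and "log_weight L y \<le> 2 / L * exp L * \<bar>y - exp (- L)\<bar>"
proof -
  note iv = cutoff_interval[OF L y]
  define l where "l = ln y / L"
  have l: "\<bar>l\<bar> \<le> 1" using iv L by (simp add: l_def)
  have w: "log_weight L y = (1 - l) * (1 + l)"
    by (simp add: log_weight_def l_def power2_eq_square algebra_simps)
  have inv: "inverse y \<le> exp L"
    using y iv(1) by (metis exp_minus greaterThanLessThan_iff inverse_inverse_eq le_imp_inverse_le
        less_imp_le positive_imp_inverse_positive exp_gt_zero)
  have "log_weight L y \<le> (1 - l) * 2" unfolding w using l by (intro mult_left_mono) auto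
  also have "(1 - l) * 2 = 2 / L * (L - ln y)" using L by (simp add: l_def field_simps)
  also have "\<dots> \<le> 2 / L * (exp L * \<bar>y - exp L\<bar>)"
  proof (intro mult_left_mono)
    have "L - ln y = ln (exp L / y)" using iv by (simp add: ln_div)
    also have "\<dots> \<le> exp L / y - 1" using iv by (intro ln_le_minus_one) auto
    also have "\<dots> = inverse y * (exp L - y)" using iv by (simp add: field_simps)
    also have "\<dots> \<le> exp L * \<bar>y - exp L\<bar>" using inv y iv by (intro mult_mono) auto
    finally show "L - ln y \<le> exp L * \<bar>y - exp L\<bar>" .
  qed (use L in simp)
  finally show "log_weight L y \<le> 2 / L * exp L * \<bar>y - exp L\<bar>" by simp
  have "log_weight L y \<le> 2 * (1 + l)" unfolding w using l by (intro mult_right_mono) auto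
  also have "2 * (1 + l) = 2 / L * (L + ln y)" using L by (simp add: l_def field_simps)
  also have "\<dots> \<le> 2 / L * (exp L * \<bar>y - exp (- L)\<bar>)"
  proof (intro mult_left_mono)
    have "L + ln y = ln (y * exp L)" using iv by (simp add: ln_mult)
    also have "\<dots> \<le> y * exp L - 1" using iv by (intro ln_le_minus_one) auto
    also have "\<dots> = exp L * (y - exp (- L))" by (simp add: algebra_simps exp_minus)
    also have "\<dots> \<le> exp L * \<bar>y - exp (- L)\<bar>" by (intro mult_left_mono) auto
    finally show "L + ln y \<le> exp L * \<bar>y - exp (- L)\<bar>" .
  qed (use L in simp)
  finally show "log_weight L y \<le> 2 / L * exp L * \<bar>y - exp (- L)\<bar>" by simp
qed

text \<open>A single term of the exponential series at 1 / w, of order k + 2, beats the power k and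
  leaves w^2 to spare: the quadratic decay wanted at the end points of the cutoff.\<close>

lemma power_inverse_exp_le:
  fixes w :: real
  assumes "0 < w"
  shows "(1 / w) ^ k * exp (1 - 1 / w) \<le> exp 1 * fact (k + 2) * w\<^sup>2"
proof -
  have "(1 / w) ^ (k + 2) / fact (k + 2) \<le> exp (1 / w)"
    using assms by (intro power_div_fact_le_exp) auto
  then have "(1 / w) ^ (k + 2) \<le> exp (1 / w) * fact (k + 2)"
    by (subst (asm) pos_divide_le_eq) (auto simp del: fact_Suc)
  then have "(1 / w) ^ k * (1 / w)\<^sup>2 \<le> fact (k + 2) * exp (1 / w)"
    by (simp only: power_add mult.commute)
  then have "((1 / w) ^ k * (1 / w)\<^sup>2) * (w\<^sup>2 * exp (1 - 1 / w))
      \<le> (fact (k + 2) * exp (1 / w)) * (w\<^sup>2 * exp (1 - 1 / w))"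
    using assms by (intro mult_right_mono) auto
  moreover have "((1 / w) ^ k * (1 / w)\<^sup>2) * (w\<^sup>2 * exp (1 - 1 / w)) = (1 / w) ^ k * exp (1 - 1 / w)"
    using assms by (simp add: power_divide)
  moreover have "(fact (k + 2) * exp (1 / w)) * (w\<^sup>2 * exp (1 - 1 / w)) = exp 1 * fact (k + 2) * w\<^sup>2"
    by (simp add: exp_diff del: fact_Suc)
  ultimately show ?thesis by (simp only:)
qed

text \<open>\<open>f1\<close> is the product rule: its second summand is f times the logarithmic
  derivative w' / w^2 of the cutoff, where w' = - 2 ln x / (L^2 x). At an end point the function is
  bounded by a multiple of the squared distance, so its derivative is 0, which is also the value of
  the extension of \<open>f1\<close>.\<close>

lemma cutoff_extension_derivative:
  assumes L: "0 < L" and f: "f \<in> cutoff_algebra L z" and f': "f' \<in> cutoff_algebra L z"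
    and d: "\<And>x. x \<in> {exp (- L)<..<exp L} \<Longrightarrow> (f has_vector_derivative f' x) (at x)"
  defines "f1 \<equiv> \<lambda>x. f' x + f x * (of_real (- 2 / L\<^sup>2) * (of_real (ln x) * (of_real (x powr - 1) *
      (of_real (1 / log_weight L x) * of_real (1 / log_weight L x)))))"
  shows "f1 \<in> cutoff_algebra L z"
    and "(cutoff_extension L f has_vector_derivative cutoff_extension L f1 x) (at x)"
proof -
  show "f1 \<in> cutoff_algebra L z" unfolding f1_def
    by (intro cutoff_algebra.intros f f')
  consider "x \<in> {exp (- L)<..<exp L}" | "x < exp (- L) \<or> exp L < x" | "x = exp (- L) \<or> x = exp L"
    by force
  then show "(cutoff_extension L f has_vector_derivative cutoff_extension L f1 x) (at x)"
  proof cases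
    case 1
    note iv = cutoff_interval[OF L 1]
    define E where "E x = exp (1 - 1 / log_weight L x)" for x
    have "(E has_real_derivative E x * - (- (- 2 / L\<^sup>2 * ln x * x powr - 1) / (log_weight L x * log_weight L x))) (at x)"
      unfolding E_def[abs_def] using iv L
      by (auto intro!: derivative_eq_intros log_weight_deriv)
    from has_vector_derivative_mult[OF d[OF 1] has_vector_derivative_of_real_complex[OF this]]
    have "((\<lambda>x. f x * of_real (E x)) has_vector_derivative cutoff_extension L f1 x) (at x)"
      using 1 by (simp add: cutoff_extension_def f1_def E_def algebra_simps)
    then show ?thesis
      by (rule has_vector_derivative_transform_within_open[OF _ open_greaterThanLessThan 1])
        (simp add: cutoff_extension_def E_def)
  next
    case 2
    have "cutoff_extension L f1 x = 0" using 2 by (auto simp: cutoff_extension_def)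
    moreover have "((\<lambda>x. 0) has_vector_derivative 0) (at x)" by simp
    moreover have "open (- {exp (- L)..exp L})" "x \<in> - {exp (- L)..exp L}" using 2 by auto
    moreover have "\<And>y. y \<in> - {exp (- L)..exp L} \<Longrightarrow> 0 = cutoff_extension L f y"
      by (auto simp: cutoff_extension_def)
    ultimately show ?thesis using has_vector_derivative_transform_within_open by metis
  next
    case 3
    obtain C k where C: "0 \<le> C"
      and fC: "\<And>x. x \<in> {exp (- L)<..<exp L} \<Longrightarrow> cmod (f x) \<le> C * (1 / log_weight L x) ^ k"
      using cutoff_algebra_bound[OF L f] by blast
    define K where "K = C * (exp 1 * fact (k + 2)) * (2 / L * exp L)\<^sup>2"
    have "cmod (cutoff_extension L f y) \<le> K * (y - x)\<^sup>2" for y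
    proof (cases "y \<in> {exp (- L)<..<exp L}")
      case True
      note iv = cutoff_interval[OF L True]
      have "cmod (cutoff_extension L f y) = cmod (f y) * exp (1 - 1 / log_weight L y)"
        using True by (simp add: cutoff_extension_def norm_mult)
      also have "\<dots> \<le> (C * (1 / log_weight L y) ^ k) * exp (1 - 1 / log_weight L y)"
        by (intro mult_right_mono fC True) auto
      also have "\<dots> \<le> C * (exp 1 * fact (k + 2) * (log_weight L y)\<^sup>2)"
        unfolding mult.assoc[of C] using iv C by (intro mult_left_mono power_inverse_exp_le) auto
      also have "\<dots> \<le> C * (exp 1 * fact (k + 2) * (2 / L * exp L * \<bar>y - x\<bar>)\<^sup>2)"
        using iv C 3 log_weight_le_distance[OF L True] by (intro mult_left_mono power_mono) auto
      also have "\<dots> = K * (y - x)\<^sup>2" by (simp add: K_def power_mult_distrib power_divide del: fact_Suc)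
      finally show ?thesis .
    next
      case False
      then have "cutoff_extension L f y = 0" by (auto simp: cutoff_extension_def)
      moreover have "0 \<le> K" using C by (simp add: K_def)
      ultimately show ?thesis by simp
    qed
    then have "(cutoff_extension L f has_vector_derivative 0) (at x)"
      by (rule has_vector_derivative_zero_of_quadratic)
    moreover have "cutoff_extension L f1 x = 0" using 3 by (auto simp: cutoff_extension_def)
    ultimately show ?thesis by simp
  qed
qed

text \<open>By induction every iterated derivative is again a cutoff extension of a member of the
  algebra, hence differentiable everywhere. The support stays away from 0 because exp (- L) >
  0.\<close>

lemma cutoff_extension_test_function:
  assumes L: "0 < L" and f: "f \<in> cutoff_algebra L z"
  shows "cutoff_extension L f \<in> test_functions"
proof -
  have step: "\<exists>f1\<in>cutoff_algebra L z. \<forall>x. (cutoff_extension L f has_vector_derivative cutoff_extension L f1 x) (at x)"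
    if f: "f \<in> cutoff_algebra L z" for f
  proof -
    obtain f' where "f' \<in> cutoff_algebra L z"
      "\<And>x. x \<in> {exp (- L)<..<exp L} \<Longrightarrow> (f has_vector_derivative f' x) (at x)"
      using cutoff_algebra_derivative[OF L f] by blast
    from cutoff_extension_derivative[OF L f this] show ?thesis by blast
  qed
  have "\<exists>g\<in>cutoff_algebra L z. (vderiv ^^ n) (cutoff_extension L f) = cutoff_extension L g" for n
  proof (induction n)
    case 0
    show ?case using f by auto
  next
    case (Suc n)
    then obtain g where g: "g \<in> cutoff_algebra L z" "(vderiv ^^ n) (cutoff_extension L f) = cutoff_extension L g"
      by blast
    obtain g1 where g1: "g1 \<in> cutoff_algebra L z"
      "\<And>x. (cutoff_extension L g has_vector_derivative cutoff_extension L g1 x) (at x)"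
      using step[OF g(1)] by blast
    have "vderiv (cutoff_extension L g) = cutoff_extension L g1"
      unfolding vderiv_def using g1(2) by (intro ext vector_derivative_at)
    then show ?case using g g1 by auto
  qed
  then have "(vderiv ^^ n) (cutoff_extension L f) differentiable (at x)" for n x
    using step by (metis differentiableI_vector)
  moreover have "cutoff_extension L f x = 0" if "x \<notin> {exp (- L)..exp L}" for x
    using that by (auto simp: cutoff_extension_def)
  ultimately show ?thesis unfolding test_functions_def
    by (intro CollectI conjI allI exI[of _ "exp (- L)"] exI[of _ "exp L"]) auto
qed


section \<open>The quadratic form of the Bessel operator\<close>


lemma half_line_integrable_compact_support:
  fixes G :: "real \<Rightarrow> 'a::euclidean_space"
  assumes a: "0 < a" and cont: "continuous_on {0<..} G" and zero: "\<And>x. x \<notin> {a..b} \<Longrightarrow> 0 < x \<Longrightarrow> G x = 0"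
  shows "integrable half_line G"
    and "(LINT x|half_line. G x) = integral {a..b} G"
proof -
  have "continuous_on {a..b} G"
    using a by (intro continuous_on_subset[OF cont]) auto
  then have i: "integrable (lebesgue_on {a..b}) G"
    using continuous_imp_integrable[of a b G] by simp
  have eq: "(\<lambda>x. if x \<in> {0<..} then G x else 0) = (\<lambda>x. if x \<in> {a..b} then G x else 0)"
    using a zero by fastforce
  have "integrable lebesgue (\<lambda>x. if x \<in> {a..b} then G x else 0)"
    using i by (subst Lebesgue_Measure.integrable_restrict_UNIV) auto
  then show "integrable half_line G"
    unfolding eq[symmetric] by (subst (asm) Lebesgue_Measure.integrable_restrict_UNIV) auto
  have "(LINT x|half_line. G x) = (LINT x|lebesgue. (if x \<in> {0<..} then G x else 0))"
    by (rule Lebesgue_Measure.integral_restrict_UNIV[symmetric]) simp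
  also have "\<dots> = (LINT x|lebesgue_on {a..b}. G x)"
    unfolding eq by (rule Lebesgue_Measure.integral_restrict_UNIV) simp
  also have "\<dots> = integral {a..b} G"
    using i by (intro lebesgue_integral_eq_integral) auto
  finally show "(LINT x|half_line. G x) = integral {a..b} G" .
qed

lemma derivative_zero_outside:
  fixes F :: "real \<Rightarrow> 'a::real_normed_vector"
  assumes "\<And>x. x \<notin> {a..b} \<Longrightarrow> F x = 0" "x \<notin> {a..b}" "(F has_vector_derivative d) (at x)"
  shows "d = 0"
proof -
  have "open (- {a..b})" "x \<in> - {a..b}" using assms(2) by auto
  then have "((\<lambda>x. 0) has_vector_derivative d) (at x)"
    using has_vector_derivative_transform_within_open[OF assms(3), of "- {a..b}" "\<lambda>x. 0"] assms(1) by simp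
  then show "d = 0"
    using vector_derivative_unique_at has_vector_derivative_const by blast
qed

lemma integral_derivative_compact_support:
  fixes F G :: "real \<Rightarrow> complex"
  assumes a: "0 < a" and F: "\<And>x. 0 < x \<Longrightarrow> (F has_vector_derivative G x) (at x)"
    and cont: "continuous_on {0<..} G" and zero: "\<And>x. x \<notin> {a..b} \<Longrightarrow> F x = 0"
  shows "has_bochner_integral half_line G 0"
proof -
  \<comment> \<open>Both ends of \<open>{a / 2..b'}\<close> lie off \<open>{a..b}\<close>, so
    \<open>F\<close> vanishes there; the maximum covers an empty interval
    \<open>{a..b}\<close>.\<close>
  define b' where "b' = max a b + 1"
  have G0: "G x = 0" if "x \<notin> {a / 2..b'}" "0 < x" for x
    using that a by (intro derivative_zero_outside[OF zero _ F]) (auto simp: b'_def)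
  have a2: "0 < a / 2" using a by simp
  note * = half_line_integrable_compact_support[OF a2 cont G0]
  have "(G has_integral (F b' - F (a / 2))) {a / 2..b'}"
    using a by (intro fundamental_theorem_of_calculus has_vector_derivative_at_within[OF F]) (auto simp: b'_def)
  moreover have "F b' = 0" "F (a / 2) = 0" using a by (auto intro!: zero simp: b'_def)
  ultimately have "integral {a / 2..b'} G = 0" by (simp add: integral_unique)
  with * show ?thesis by (simp add: has_bochner_integral_iff)
qed

lemma has_vector_derivative_cnj_comp:
  "(f has_vector_derivative d) F \<Longrightarrow> ((\<lambda>x. cnj (f x)) has_vector_derivative cnj d) F"
  by (rule bounded_linear.has_vector_derivative[OF bounded_linear_cnj])

lemma continuous_on_half_line_derivative:
  assumes "\<And>x. 0 < x \<Longrightarrow> (f has_vector_derivative f' x) (at x)"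
  shows "continuous_on {0<..} f"
  using assms by (intro continuous_at_imp_continuous_on) (auto intro: has_vector_derivative_continuous)

text \<open>With \<open>c = \<nu> + 1/2\<close> one has \<open>c\<^sup>2 - c = \<nu>\<^sup>2 - 1/4\<close>, and the form of the minimal operator is the
  square of the first order operator \<open>\<partial>\<^sub>x - c / x\<close>.\<close>

lemma bessel_form_eq_square:
  fixes D D1 D2 :: "real \<Rightarrow> complex"
  assumes a: "0 < a" and zero: "\<And>x. x \<notin> {a..b} \<Longrightarrow> D x = 0"
    and D1: "\<And>x. 0 < x \<Longrightarrow> (D has_vector_derivative D1 x) (at x)"
    and D2: "\<And>x. 0 < x \<Longrightarrow> (D1 has_vector_derivative D2 x) (at x)"
    and cont: "continuous_on {0<..} D2"
  shows "l2_inner half_line (\<lambda>x. - D2 x + of_real ((\<nu>\<^sup>2 - 1/4) * (1 / x\<^sup>2)) * D x) D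
    = of_real (LINT x|half_line. (cmod (D1 x - of_real ((\<nu> + 1/2) / x) * D x))\<^sup>2)"
proof -
  define c where "c = \<nu> + 1/2"
  have c: "\<nu>\<^sup>2 - 1/4 = c\<^sup>2 - c" by (simp add: c_def power2_eq_square field_simps)
  note [continuous_intros] = continuous_on_half_line_derivative[OF D1] continuous_on_half_line_derivative[OF D2] cont
  \<comment> \<open>\<open>F\<close> is the boundary term of completing the square: with N = D' - (c
    / x) D, the integrand is |N|^2 + F', and F' = \<open>G\<close> integrates to 0.\<close>
  define F where "F x = - (D1 x * cnj (D x)) + of_real (c / x) * (D x * cnj (D x))" for x
  define G where "G x = - (D1 x * cnj (D1 x) + D2 x * cnj (D x))
    + (of_real (c / x) * (D x * cnj (D1 x) + D1 x * cnj (D x)) + of_real (- c / x\<^sup>2) * (D x * cnj (D x)))" for x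
  define N where "N x = D1 x - of_real (c / x) * D x" for x
  have FG: "(F has_vector_derivative G x) (at x)" if x: "0 < x" for x
  proof -
    have "((\<lambda>x. c / x) has_real_derivative - c / x\<^sup>2) (at x)"
      using x by (auto intro!: derivative_eq_intros simp: power2_eq_square)
    then have "((\<lambda>x. complex_of_real (c / x)) has_vector_derivative of_real (- c / x\<^sup>2)) (at x)"
      using has_vector_derivative_of_real has_real_derivative_iff_has_vector_derivative by blast
    from this D1[OF x] D2[OF x] show ?thesis unfolding F_def[abs_def] G_def
      by (intro has_vector_derivative_add has_vector_derivative_minus has_vector_derivative_mult
          has_vector_derivative_cnj_comp)
  qed
  have "has_bochner_integral half_line G 0"
  proof (rule integral_derivative_compact_support[OF a FG])
    show "continuous_on {0<..} G" unfolding G_def by (intro continuous_intros) auto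
    show "F x = 0" if "x \<notin> {a..b}" for x using zero[OF that] by (simp add: F_def)
  qed
  moreover have "has_bochner_integral half_line (\<lambda>x. of_real ((cmod (N x))\<^sup>2))
      (complex_of_real (LINT x|half_line. (cmod (N x))\<^sup>2))"
  proof (intro has_bochner_integral_of_real has_bochner_integral_integrable half_line_integrable_compact_support[OF a])
    show "continuous_on {0<..} (\<lambda>x. (cmod (N x))\<^sup>2)" unfolding N_def by (intro continuous_intros) auto
    fix x :: real assume x: "x \<notin> {a..b}" "0 < x"
    have "D1 x = 0" using derivative_zero_outside[OF zero x(1) D1[OF x(2)]] .
    then show "(cmod (N x))\<^sup>2 = 0" using zero[OF x(1)] by (simp add: N_def)
  qed
  ultimately have "has_bochner_integral half_line (\<lambda>x. G x + of_real ((cmod (N x))\<^sup>2))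
      (0 + complex_of_real (LINT x|half_line. (cmod (N x))\<^sup>2))"
    by (rule has_bochner_integral_add)
  then have "(LINT x|half_line. G x + of_real ((cmod (N x))\<^sup>2)) = complex_of_real (LINT x|half_line. (cmod (N x))\<^sup>2)"
    by (simp add: has_bochner_integral_iff)
  moreover have "(- D2 x + of_real ((\<nu>\<^sup>2 - 1/4) * (1 / x\<^sup>2)) * D x) * cnj (D x) = G x + of_real ((cmod (N x))\<^sup>2)"
    if "x \<in> space half_line" for x
  proof -
    have x: "complex_of_real x \<noteq> 0" using that by simp
    show ?thesis unfolding c G_def N_def complex_norm_square using x
      by (simp add: field_simps power2_eq_square)
  qed
  ultimately show ?thesis
    unfolding l2_inner_def N_def c_def by (subst Bochner_Integration.integral_cong[OF refl]) auto
qed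

lemma test_function_derivatives:
  assumes "\<phi> \<in> test_functions"
  shows "(\<phi> has_vector_derivative vderiv \<phi> x) (at x)"
    and "(vderiv \<phi> has_vector_derivative (vderiv ^^ 2) \<phi> x) (at x)"
    and "continuous_on S ((vderiv ^^ 2) \<phi>)"
proof -
  have d: "(vderiv ^^ n) \<phi> differentiable (at x)" for n x
    using assms by (auto simp: test_functions_def)
  have "((vderiv ^^ n) \<phi> has_vector_derivative (vderiv ^^ Suc n) \<phi> x) (at x)" for n x
    using d[of n x] unfolding vector_derivative_works by (simp add: vderiv_def)
  from this[of 0] this[of 1]
  show "(\<phi> has_vector_derivative vderiv \<phi> x) (at x)"
    "(vderiv \<phi> has_vector_derivative (vderiv ^^ 2) \<phi> x) (at x)"
    by (simp_all add: numeral_2_eq_2)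
  show "continuous_on S ((vderiv ^^ 2) \<phi>)"
    using d by (intro continuous_at_imp_continuous_on ballI differentiable_imp_continuous_within)
qed

text \<open>Two integrations by parts. Their boundary term, the Wronskian \<open>F\<close> of \<phi>
  and the conjugate of g, has the compact support of \<phi>, so the behaviour of g at 0 and at
  infinity is free. This puts functions that are no test functions into the adjoint.\<close>

lemma bessel_minimal_symmetric:
  fixes g g1 g2 :: "real \<Rightarrow> complex"
  assumes \<phi>: "\<phi> \<in> test_functions"
    and g1: "\<And>x. 0 < x \<Longrightarrow> (g has_vector_derivative g1 x) (at x)"
    and g2: "\<And>x. 0 < x \<Longrightarrow> (g1 has_vector_derivative g2 x) (at x)"
    and cont: "continuous_on {0<..} g2"
  shows "l2_inner half_line (\<lambda>x. - (vderiv ^^ 2) \<phi> x + of_real ((\<nu>\<^sup>2 - 1/4) * (1 / x\<^sup>2)) * \<phi> x) g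
    = l2_inner half_line \<phi> (\<lambda>x. - g2 x + of_real ((\<nu>\<^sup>2 - 1/4) * (1 / x\<^sup>2)) * g x)"
proof -
  note d = test_function_derivatives[OF \<phi>]
  obtain a b where a: "0 < a" and zero: "\<And>x. x \<notin> {a..b} \<Longrightarrow> \<phi> x = 0"
    using \<phi> by (auto simp: test_functions_def)
  have z1: "vderiv \<phi> x = 0" if "x \<notin> {a..b}" for x
    by (rule derivative_zero_outside[OF zero that d(1)])
  note [continuous_intros] = continuous_on_half_line_derivative[OF g1] continuous_on_half_line_derivative[OF g2] cont
    continuous_on_half_line_derivative[OF d(1)] continuous_on_half_line_derivative[OF d(2)] d(3)
  define q where "q x = complex_of_real ((\<nu>\<^sup>2 - 1/4) * (1 / x\<^sup>2))" for x
  define F where "F x = - (vderiv \<phi> x * cnj (g x)) + \<phi> x * cnj (g1 x)" for x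
  define G where "G x = - (vderiv \<phi> x * cnj (g1 x) + (vderiv ^^ 2) \<phi> x * cnj (g x))
    + (\<phi> x * cnj (g2 x) + vderiv \<phi> x * cnj (g1 x))" for x
  define R where "R x = \<phi> x * cnj (- g2 x + q x * g x)" for x
  have "has_bochner_integral half_line G 0"
  proof (rule integral_derivative_compact_support[OF a])
    show "(F has_vector_derivative G x) (at x)" if "0 < x" for x
      unfolding F_def[abs_def] G_def using d(1,2)[of x] g1[OF that] g2[OF that]
      by (intro has_vector_derivative_add has_vector_derivative_minus has_vector_derivative_mult
          has_vector_derivative_cnj_comp)
    show "continuous_on {0<..} G" unfolding G_def by (intro continuous_intros)
    show "F x = 0" if "x \<notin> {a..b}" for x using zero[OF that] z1[OF that] by (simp add: F_def)
  qed
  moreover have "integrable half_line R"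
  proof (rule half_line_integrable_compact_support[OF a])
    show "continuous_on {0<..} R" unfolding R_def q_def by (intro continuous_intros) auto
    show "R x = 0" if "x \<notin> {a..b}" for x using zero[OF that] by (simp add: R_def)
  qed
  ultimately have "(LINT x|half_line. G x + R x) = (LINT x|half_line. R x)"
    by (simp add: has_bochner_integral_iff)
  moreover have "(- (vderiv ^^ 2) \<phi> x + q x * \<phi> x) * cnj (g x) = G x + R x" for x
    by (simp add: G_def R_def q_def algebra_simps)
  ultimately show ?thesis unfolding l2_inner_def R_def[symmetric] q_def[symmetric] by simp
qed


section \<open>Gaussians in the Friedrichs domain\<close>


definition bessel_gaussian :: "real \<Rightarrow> complex \<Rightarrow> complex \<Rightarrow> real \<Rightarrow> complex" where
  "bessel_gaussian \<nu> A z x = A * of_real (x powr (\<nu> + 1/2)) * exp (- z * of_real (x\<^sup>2))"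

definition bessel_gaussian_deriv :: "real \<Rightarrow> complex \<Rightarrow> complex \<Rightarrow> real \<Rightarrow> complex" where
  "bessel_gaussian_deriv \<nu> A z x = (of_real ((\<nu> + 1/2) / x) - 2 * z * of_real x) * bessel_gaussian \<nu> A z x"

text \<open>The differential expression applied to the Gaussian. The inverse square term is gone
  because c = \<nu> + 1/2 solves c (c - 1) = \<nu>^2 - 1/4.\<close>

definition bessel_gaussian_image :: "real \<Rightarrow> complex \<Rightarrow> complex \<Rightarrow> real \<Rightarrow> complex" where
  "bessel_gaussian_image \<nu> A z x =
    (4 * z * of_real (\<nu> + 1) - 4 * z\<^sup>2 * of_real (x\<^sup>2)) * bessel_gaussian \<nu> A z x"

lemma bessel_gaussian_derivative:
  assumes x: "0 < x"
  shows "(bessel_gaussian \<nu> A z has_vector_derivative bessel_gaussian_deriv \<nu> A z x) (at x)"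
proof -
  have "((\<lambda>x. x powr (\<nu> + 1/2)) has_real_derivative (\<nu> + 1/2) * x powr (\<nu> + 1/2 - 1)) (at x)"
    using x by (rule has_real_derivative_powr)
  then have "((\<lambda>x. A * of_real (x powr (\<nu> + 1/2)) * exp (- z * of_real (x\<^sup>2))) has_vector_derivative
      A * of_real (x powr (\<nu> + 1/2)) * ((- 2 * z * of_real x) * exp (- z * of_real (x\<^sup>2)))
      + A * of_real ((\<nu> + 1/2) * x powr (\<nu> + 1/2 - 1)) * exp (- z * of_real (x\<^sup>2))) (at x)"
    by (intro has_vector_derivative_mult exp_complex_square_derivative has_vector_derivative_mult_right
        has_vector_derivative_of_real_complex)
  moreover have "(\<nu> + 1/2) * x powr (\<nu> + 1/2 - 1) = (\<nu> + 1/2) / x * x powr (\<nu> + 1/2)"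
  proof -
    have e: "\<nu> + 1/2 - 1 = \<nu> - 1/2" by simp
    have "x powr (\<nu> + 1/2) = x * x powr (\<nu> - 1/2)"
      using x powr_mult_base[of x "\<nu> - 1/2"] by (simp add: add.commute)
    then show ?thesis unfolding e using x by simp
  qed
  ultimately show ?thesis
    unfolding bessel_gaussian_def[abs_def] bessel_gaussian_deriv_def
    by (simp only: of_real_mult) (simp add: algebra_simps)
qed

lemma bessel_gaussian_derivative2:
  assumes x: "0 < x"
  shows "(bessel_gaussian_deriv \<nu> A z has_vector_derivative
    of_real ((\<nu>\<^sup>2 - 1/4) * (1 / x\<^sup>2)) * bessel_gaussian \<nu> A z x - bessel_gaussian_image \<nu> A z x) (at x)"
proof -
  define c where "c = \<nu> + 1/2"
  have c: "\<nu>\<^sup>2 - 1/4 = c\<^sup>2 - c" "\<nu> + 1 = c + 1/2" by (simp_all add: c_def power2_eq_square field_simps)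
  have "((\<lambda>x. c / x) has_real_derivative - c / x\<^sup>2) (at x)"
    using x by (auto intro!: derivative_eq_intros simp: power2_eq_square)
  then have "((\<lambda>x. (of_real (c / x) - 2 * z * of_real x) * bessel_gaussian \<nu> A z x) has_vector_derivative
      (of_real (c / x) - 2 * z * of_real x) * bessel_gaussian_deriv \<nu> A z x
      + (of_real (- c / x\<^sup>2) - 2 * z * of_real 1) * bessel_gaussian \<nu> A z x) (at x)"
    by (intro has_vector_derivative_mult bessel_gaussian_derivative x has_vector_derivative_diff
        has_vector_derivative_of_real_complex has_vector_derivative_mult_right) auto
  moreover have "(of_real (c / x) - 2 * z * of_real x) * bessel_gaussian_deriv \<nu> A z x
      + (of_real (- c / x\<^sup>2) - 2 * z * of_real 1) * bessel_gaussian \<nu> A z x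
    = of_real ((\<nu>\<^sup>2 - 1/4) * (1 / x\<^sup>2)) * bessel_gaussian \<nu> A z x - bessel_gaussian_image \<nu> A z x"
    unfolding bessel_gaussian_deriv_def bessel_gaussian_image_def c c_def[symmetric]
    using x by (simp add: field_simps power2_eq_square)
  ultimately show ?thesis
    unfolding bessel_gaussian_deriv_def[abs_def] c_def by simp
qed

lemma cmod_bessel_gaussian:
  "cmod (bessel_gaussian \<nu> A z x) = cmod A * x powr (\<nu> + 1/2) * exp (- Re z * x\<^sup>2)"
proof -
  have "Re (- z * of_real (x\<^sup>2)) = - Re z * x\<^sup>2" by (simp del: of_real_power)
  then show ?thesis by (simp only: bessel_gaussian_def norm_mult norm_exp_eq_Re norm_of_real) simp
qed

lemma bessel_gaussian_measurable:
  "continuous_on {0<..} g \<Longrightarrow> (\<lambda>x. g x * bessel_gaussian \<nu> A z x) \<in> borel_measurable half_line"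
  unfolding bessel_gaussian_def
  by (intro half_line_measurable_continuous continuous_intros) auto

lemma power_times_bessel_gaussian_l2:
  assumes "0 \<le> \<nu>" "0 < Re z"
  shows "(\<lambda>x. of_real (x ^ j) * bessel_gaussian \<nu> A z x) \<in> l2 half_line"
  unfolding l2_def
proof (intro CollectI conjI)
  show "(\<lambda>x. of_real (x ^ j) * bessel_gaussian \<nu> A z x) \<in> borel_measurable half_line"
    by (intro bessel_gaussian_measurable continuous_intros)
  have "integrable half_line (\<lambda>x. (cmod A)\<^sup>2 * (x powr (2 * j + 2 * \<nu> + 1) * exp (- (2 * Re z) * x\<^sup>2)))"
    using gaussian_moment[of "2 * j + 2 * \<nu> + 1" "2 * Re z"] assms
    by (intro integrable_mult_right) (auto simp: has_bochner_integral_iff)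
  moreover have "(cmod (of_real (x ^ j) * bessel_gaussian \<nu> A z x))\<^sup>2
      = (cmod A)\<^sup>2 * (x powr (2 * j + 2 * \<nu> + 1) * exp (- (2 * Re z) * x\<^sup>2))" if "x \<in> space half_line" for x
  proof -
    have x: "0 < x" using that by simp
    have "x powr (2 * j + 2 * \<nu> + 1) = (x ^ j)\<^sup>2 * (x powr (\<nu> + 1/2))\<^sup>2"
    proof -
      have "x powr (2 * j + 2 * \<nu> + 1) = x powr (real (j * 2)) * x powr ((\<nu> + 1/2) * real 2)"
        by (simp add: powr_add[symmetric] algebra_simps)
      also have "\<dots> = x ^ (j * 2) * (x powr (\<nu> + 1/2)) ^ 2"
        using x by (simp only: powr_realpow powr_powr[symmetric]) (simp add: powr_realpow)
      finally show ?thesis by (simp add: power_mult)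
    qed
    moreover have "exp (- (2 * Re z) * x\<^sup>2) = (exp (- Re z * x\<^sup>2))\<^sup>2"
      by (simp add: power2_eq_square exp_add[symmetric])
    ultimately show ?thesis
      using x by (simp only: norm_mult cmod_bessel_gaussian power_mult_distrib norm_of_real)
        (simp add: power_mult_distrib)
  qed
  ultimately show "integrable half_line (\<lambda>x. (cmod (of_real (x ^ j) * bessel_gaussian \<nu> A z x))\<^sup>2)"
    by (subst Bochner_Integration.integrable_cong[OF refl]) auto
qed

lemma bessel_gaussian_l2:
  assumes "0 \<le> \<nu>" "0 < Re z"
  shows "bessel_gaussian \<nu> A z \<in> l2 half_line"
  using power_times_bessel_gaussian_l2[OF assms, of 0] by simp

lemma bessel_gaussian_image_l2:
  assumes "0 \<le> \<nu>" "0 < Re z"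
  shows "bessel_gaussian_image \<nu> A z \<in> l2 half_line"
proof -
  have "(\<lambda>x. (4 * z * of_real (\<nu> + 1)) * bessel_gaussian \<nu> A z x - (4 * z\<^sup>2) * (of_real (x ^ 2) * bessel_gaussian \<nu> A z x)) \<in> l2 half_line"
    by (intro l2_diff l2_scale bessel_gaussian_l2 power_times_bessel_gaussian_l2 assms)
  then show ?thesis by (simp add: bessel_gaussian_image_def[abs_def] algebra_simps)
qed

lemma bessel_gaussian_image_eq:
  "bessel_gaussian_image \<nu> A z x = - (of_real ((\<nu>\<^sup>2 - 1/4) * (1 / x\<^sup>2)) * bessel_gaussian \<nu> A z x - bessel_gaussian_image \<nu> A z x)
    + of_real ((\<nu>\<^sup>2 - 1/4) * (1 / x\<^sup>2)) * bessel_gaussian \<nu> A z x"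
  by simp

lemma bessel_gaussian_adjoint:
  assumes \<nu>: "0 \<le> \<nu>" and z: "0 < Re z"
  shows "(bessel_gaussian \<nu> A z, bessel_gaussian_image \<nu> A z) \<in> l2_adjoint half_line (bessel_minimal \<nu>)"
proof -
  have "l2_inner half_line (\<lambda>x. - (vderiv ^^ 2) \<phi> x + of_real ((\<nu>\<^sup>2 - 1/4) * (1 / x\<^sup>2)) * \<phi> x) (bessel_gaussian \<nu> A z)
      = l2_inner half_line \<phi> (bessel_gaussian_image \<nu> A z)" if "\<phi> \<in> test_functions" for \<phi>
    by (subst bessel_gaussian_image_eq[abs_def])
      (intro bessel_minimal_symmetric[OF that bessel_gaussian_derivative bessel_gaussian_derivative2];
        auto simp: bessel_gaussian_def bessel_gaussian_image_def intro!: continuous_intros)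
  then show ?thesis using assms
    by (auto simp: l2_adjoint_def bessel_minimal_def bessel_gaussian_l2 bessel_gaussian_image_l2)
qed


section \<open>Convergence of the cut-off Gaussians\<close>

abbreviation log_cutoff :: "real \<Rightarrow> real \<Rightarrow> complex" where
  "log_cutoff L \<equiv> cutoff_extension L (\<lambda>x. 1)"

definition cutoff_deriv :: "real \<Rightarrow> real \<Rightarrow> complex" where
  "cutoff_deriv L = cutoff_extension L
    (\<lambda>x. of_real (- 2 / L\<^sup>2 * ln x * x powr - 1 * (1 / log_weight L x)\<^sup>2))"

lemma cutoff_derivative:
  assumes "0 < L"
  shows "(log_cutoff L has_vector_derivative cutoff_deriv L x) (at x)"
  using cutoff_extension_derivative(2)[OF assms cutoff_algebra.const[of 1 L 0] cutoff_algebra.const[of 0 L 0]]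
  by (simp add: cutoff_deriv_def power2_eq_square mult.assoc)

text \<open>On the support |ln x| < L, so the factor 2 |ln x| / L^2 is at most 2 / L; the two powers
  of 1 / w are absorbed by \<open>power_inverse_exp_le\<close> with k = 2. Hence 48 = 2 *
  4!.\<close>

lemma cutoff_deriv_bound:
  assumes L: "0 < L"
  shows "cmod (cutoff_deriv L x) \<le> (if x \<in> {exp (- L)..exp L} then 48 * exp 1 / (L * x) else 0)"
proof (cases "x \<in> {exp (- L)<..<exp L}")
  case True
  note iv = cutoff_interval[OF L True]
  have "cutoff_deriv L x = of_real (- 2 / L\<^sup>2 * ln x * x powr - 1 * (1 / log_weight L x)\<^sup>2 * exp (1 - 1 / log_weight L x))"
    using True by (simp add: cutoff_deriv_def cutoff_extension_def)
  then have "cmod (cutoff_deriv L x)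
      = \<bar>- 2 / L\<^sup>2 * ln x * x powr - 1 * (1 / log_weight L x)\<^sup>2 * exp (1 - 1 / log_weight L x)\<bar>"
    by (simp only: norm_of_real)
  also have "\<dots> = (2 / L\<^sup>2 * \<bar>ln x\<bar> * (1 / x)) * ((1 / log_weight L x)\<^sup>2 * exp (1 - 1 / log_weight L x))"
    using iv L by (simp add: abs_mult powr_minus divide_inverse)
  also have "\<dots> \<le> (2 / L\<^sup>2 * L * (1 / x)) * (exp 1 * fact (2 + 2) * (log_weight L x)\<^sup>2)"
    using iv L by (intro mult_mono power_inverse_exp_le mult_left_mono mult_nonneg_nonneg) auto
  also have "\<dots> \<le> (2 / L\<^sup>2 * L * (1 / x)) * (exp 1 * fact (2 + 2) * 1)"
    using iv L by (intro mult_left_mono power_le_one) auto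
  also have "\<dots> = 48 * exp 1 / (L * x)"
    using iv L by (simp add: power2_eq_square fact_numeral)
  finally show ?thesis using True by auto
next
  case False
  then have "cutoff_deriv L x = 0" by (auto simp: cutoff_deriv_def cutoff_extension_def)
  moreover have "0 < x" if "exp (- L) \<le> x" using that by (rule less_le_trans[rotated]) simp
  ultimately show ?thesis using L by auto
qed

lemma cutoff_minus_one_bound:
  assumes L: "0 < L"
  shows "cmod (log_cutoff L x - 1) \<le> 1"
proof (cases "x \<in> {exp (- L)<..<exp L}")
  case True
  note iv = cutoff_interval[OF L True]
  define e where "e = exp (1 - 1 / log_weight L x)"
  have "0 < e" "e \<le> 1" using iv by (auto simp: e_def)
  moreover have "log_cutoff L x - 1 = of_real (e - 1)"
    using True by (simp add: cutoff_extension_def e_def)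
  ultimately show ?thesis by (simp only: norm_of_real)
qed (auto simp: cutoff_extension_def)

lemma cutoff_tendsto_one:
  assumes x: "0 < x"
  shows "(\<lambda>n. log_cutoff (real (Suc n)) x) \<longlonglongrightarrow> 1"
proof -
  have "(\<lambda>n. ln x / real (Suc n)) \<longlonglongrightarrow> 0"
    using LIMSEQ_Suc[OF lim_const_over_n[of "ln x"]] by simp
  then have "(\<lambda>n. complex_of_real (exp (1 - 1 / (1 - (ln x / real (Suc n))\<^sup>2)))) \<longlonglongrightarrow> of_real (exp (1 - 1 / (1 - 0\<^sup>2)))"
    by (intro tendsto_intros) auto
  then have lim: "(\<lambda>n. complex_of_real (exp (1 - 1 / log_weight (real (Suc n)) x))) \<longlonglongrightarrow> 1"
    by (simp add: log_weight_def)
  obtain m where m: "\<bar>ln x\<bar> < real m" using reals_Archimedean2 by blast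
  have "\<forall>\<^sub>F n in sequentially. complex_of_real (exp (1 - 1 / log_weight (real (Suc n)) x))
      = log_cutoff (real (Suc n)) x"
    using eventually_ge_at_top[of m]
  proof eventually_elim
    fix n assume "m \<le> n"
    then have "- real (Suc n) < ln x" "ln x < real (Suc n)" using m by auto
    then have "exp (- real (Suc n)) < x" "x < exp (real (Suc n))"
      using x by (metis exp_less_mono exp_ln)+
    then show "complex_of_real (exp (1 - 1 / log_weight (real (Suc n)) x)) = log_cutoff (real (Suc n)) x"
      by (simp add: cutoff_extension_def)
  qed
  from Lim_transform_eventually[OF lim this] show ?thesis .
qed

lemma cutoff_continuous: "0 < L \<Longrightarrow> continuous_on S (log_cutoff L)"
  using cutoff_derivative by (intro continuous_at_imp_continuous_on) (auto intro: has_vector_derivative_continuous)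

text \<open>Dominated convergence: the cutoff differs from 1 by at most 1, so |g| dominates. The
  index \<open>Suc n\<close> keeps the cutoff parameter positive.\<close>

lemma cutoff_l2_convergence:
  assumes g: "g \<in> l2 half_line"
  shows "(\<lambda>x. g x * (log_cutoff (real (Suc n)) x - 1)) \<in> l2 half_line"
    and "(\<lambda>n. l2_norm half_line (\<lambda>x. g x * (log_cutoff (real (Suc n)) x - 1))) \<longlonglongrightarrow> 0"
proof -
  note [measurable] = l2_measurable[OF g]
  have [measurable]: "log_cutoff (real (Suc n)) \<in> borel_measurable half_line" for n
    by (intro half_line_measurable_continuous cutoff_continuous) simp
  have le: "cmod (g x * (log_cutoff (real (Suc n)) x - 1)) \<le> cmod (g x)" for n x
    unfolding norm_mult using cutoff_minus_one_bound[of "real (Suc n)" x] by (intro mult_left_le) auto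
  show "(\<lambda>x. g x * (log_cutoff (real (Suc n)) x - 1)) \<in> l2 half_line"
  proof (rule l2_dominated[OF _ g])
    show "AE x in half_line. cmod (g x * (log_cutoff (real (Suc n)) x - 1)) \<le> cmod (g x)"
      by (intro AE_I2 le)
  qed measurable
  have "(\<lambda>n. LINT x|half_line. (cmod (g x * (log_cutoff (real (Suc n)) x - 1)))\<^sup>2)
      \<longlonglongrightarrow> (LINT x|half_line. 0)"
  proof (rule integral_dominated_convergence[where w = "\<lambda>x. (cmod (g x))\<^sup>2"])
    show "integrable half_line (\<lambda>x. (cmod (g x))\<^sup>2)" using g by (rule l2_integrable)
    show "AE x in half_line. (\<lambda>n. (cmod (g x * (log_cutoff (real (Suc n)) x - 1)))\<^sup>2) \<longlonglongrightarrow> 0"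
    proof (rule AE_I2)
      fix x assume "x \<in> space half_line"
      then have "0 < x" by simp
      from cutoff_tendsto_one[OF this]
      have "(\<lambda>n. (cmod (g x * (log_cutoff (real (Suc n)) x - 1)))\<^sup>2) \<longlonglongrightarrow> (cmod (g x * (1 - 1)))\<^sup>2"
        by (intro tendsto_intros)
      then show "(\<lambda>n. (cmod (g x * (log_cutoff (real (Suc n)) x - 1)))\<^sup>2) \<longlonglongrightarrow> 0" by simp
    qed
    show "AE x in half_line. norm ((cmod (g x * (log_cutoff (real (Suc n)) x - 1)))\<^sup>2) \<le> (cmod (g x))\<^sup>2" for n
      using le by (intro AE_I2) (simp add: power_mono)
  qed measurable
  from tendsto_real_sqrt[OF this]
  show "(\<lambda>n. l2_norm half_line (\<lambda>x. g x * (log_cutoff (real (Suc n)) x - 1))) \<longlonglongrightarrow> 0"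
    by (simp add: l2_norm_def)
qed

text \<open>The squared modulus is a multiple of x x^(2 \<nu>) exp (- 2 Re z x^2). For x \<le> 1 the
  power x^(2 \<nu>) is at most 1, and beyond 1 the Gaussian beats the integer power \<open>k\<close>
  above \<nu>. The factor x that remains offsets one of the two powers of 1 / x in the squared
  derivative of the cutoff.\<close>

lemma bessel_gaussian_square_le:
  assumes \<nu>: "0 \<le> \<nu>" and z: "0 < Re z"
  shows "\<exists>K\<ge>0. \<forall>x>0. (cmod (bessel_gaussian \<nu> A z x))\<^sup>2 \<le> K * x"
proof -
  define k where "k = nat \<lceil>\<nu>\<rceil>"
  have k: "\<nu> \<le> real k" unfolding k_def by (rule real_nat_ceiling_ge)
  define a where "a = 2 * Re z"
  have a: "0 < a" using z by (simp add: a_def)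
  define K where "K = (cmod A)\<^sup>2 * (1 + fact k / a ^ k)"
  have "(cmod (bessel_gaussian \<nu> A z x))\<^sup>2 \<le> K * x" if x: "0 < x" for x
  proof -
    have "(cmod (bessel_gaussian \<nu> A z x))\<^sup>2 = (cmod A)\<^sup>2 * (x powr (\<nu> + 1/2))\<^sup>2 * (exp (- Re z * x\<^sup>2))\<^sup>2"
      by (simp only: cmod_bessel_gaussian power_mult_distrib)
    also have "(exp (- Re z * x\<^sup>2))\<^sup>2 = exp (- (a * x\<^sup>2))"
      by (simp add: power2_eq_square exp_add[symmetric] a_def)
    also have "(x powr (\<nu> + 1/2))\<^sup>2 = x * (x\<^sup>2) powr \<nu>"
      using x by (simp add: power2_eq_square powr_mult flip: powr_add) (simp add: powr_add)
    also have "(cmod A)\<^sup>2 * (x * (x\<^sup>2) powr \<nu>) * exp (- (a * x\<^sup>2)) = (cmod A)\<^sup>2 * x * ((x\<^sup>2) powr \<nu> * exp (- (a * x\<^sup>2)))"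
      by simp
    also have "\<dots> \<le> (cmod A)\<^sup>2 * x * (1 + fact k / a ^ k)"
    proof (intro mult_left_mono)
      show "(x\<^sup>2) powr \<nu> * exp (- (a * x\<^sup>2)) \<le> 1 + fact k / a ^ k"
      proof (cases "x\<^sup>2 \<le> 1")
        case True
        then have "(x\<^sup>2) powr \<nu> * exp (- (a * x\<^sup>2)) \<le> 1 * 1"
          using a \<nu> by (intro mult_mono powr_le1) auto
        moreover have "0 \<le> fact k / a ^ k" using a by simp
        ultimately show ?thesis by linarith
      next
        case False
        then have "(x\<^sup>2) powr \<nu> \<le> (x\<^sup>2) powr real k" using k by (intro powr_mono) auto
        also have "\<dots> = (x\<^sup>2) ^ k" using x by (intro powr_realpow) simp
        finally have "(x\<^sup>2) powr \<nu> * exp (- (a * x\<^sup>2)) \<le> (x\<^sup>2) ^ k * exp (- (a * x\<^sup>2))" by simp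
        also have "\<dots> \<le> fact k / a ^ k"
        proof -
          have "(a * x\<^sup>2) ^ k / fact k \<le> exp (a * x\<^sup>2)" using a by (intro power_div_fact_le_exp) simp
          then show ?thesis using a by (simp add: exp_minus field_simps power_mult_distrib)
        qed
        finally show ?thesis by simp
      qed
    qed (use x in simp)
    also have "\<dots> = K * x" by (simp add: K_def)
    finally show ?thesis .
  qed
  moreover have "0 \<le> K" using a by (simp add: K_def)
  ultimately show ?thesis by blast
qed

lemma integral_inverse_log_interval:
  assumes L: "0 < L"
  shows "has_bochner_integral half_line (\<lambda>x. if x \<in> {exp (- L)..exp L} then 1 / x else 0) (2 * L)"
proof (rule half_line_has_integral_nonneg)
  have pos: "0 < x" if "exp (- L) \<le> x" for x using that by (rule less_le_trans[rotated]) simp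
  have "((\<lambda>x. 1 / x) has_integral (ln (exp L) - ln (exp (- L)))) {exp (- L)..exp L}"
    using L pos by (intro fundamental_theorem_of_calculus)
      (auto intro!: derivative_eq_intros simp: has_real_derivative_iff_has_vector_derivative[symmetric] divide_inverse)
  then show "((\<lambda>x. if x \<in> {exp (- L)..exp L} then 1 / x else 0) has_integral 2 * L) {0<..}"
    using pos by (subst has_integral_restrict) auto
qed auto

text \<open>The logarithmic gain: x / (L x)^2 = 1 / (L^2 x), and the integral of 1 / x over the
  support is only 2 L, so the squared norm is of order 1 / L.\<close>

lemma bessel_gaussian_cutoff_deriv:
  assumes \<nu>: "0 \<le> \<nu>" and z: "0 < Re z"
  shows "(\<lambda>x. bessel_gaussian \<nu> A z x * cutoff_deriv (real (Suc n)) x) \<in> l2 half_line"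
    and "(\<lambda>n. l2_norm half_line (\<lambda>x. bessel_gaussian \<nu> A z x * cutoff_deriv (real (Suc n)) x)) \<longlonglongrightarrow> 0"
proof -
  obtain K where K: "0 \<le> K" "\<And>x. 0 < x \<Longrightarrow> (cmod (bessel_gaussian \<nu> A z x))\<^sup>2 \<le> K * x"
    using bessel_gaussian_square_le[OF assms] by blast
  define M where "M = K * (48 * exp 1)\<^sup>2"
  define B where "B L x = M / L\<^sup>2 * (if x \<in> {exp (- L)..exp L} then 1 / x else 0)" for L x :: real
  have B: "has_bochner_integral half_line (B L) (M / L\<^sup>2 * (2 * L))" if "0 < L" for L
    unfolding B_def using integral_inverse_log_interval[OF that] by (rule has_bochner_integral_mult_right) 
  have le: "(cmod (bessel_gaussian \<nu> A z x * cutoff_deriv L x))\<^sup>2 \<le> B L x" if L: "0 < L" and x: "0 < x" for L x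
  proof (cases "x \<in> {exp (- L)..exp L}")
    case True
    have "(cmod (bessel_gaussian \<nu> A z x * cutoff_deriv L x))\<^sup>2 \<le> (K * x) * (48 * exp 1 / (L * x))\<^sup>2"
      unfolding norm_mult power_mult_distrib[of "cmod _"]
      using K x cutoff_deriv_bound[OF L, of x] True by (intro mult_mono power_mono) auto
    also have "\<dots> = B L x" using True x L by (simp add: B_def M_def field_simps power2_eq_square)
    finally show ?thesis .
  next
    case False
    have "cutoff_deriv L x = 0" using cutoff_deriv_bound[OF L, of x] unfolding if_not_P[OF False] by simp
    moreover have "B L x = 0" unfolding B_def if_not_P[OF False] by simp
    ultimately show ?thesis by simp
  qed
  have meas: "(\<lambda>x. bessel_gaussian \<nu> A z x * cutoff_deriv (real (Suc n)) x) \<in> borel_measurable half_line" for n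
  proof -
    have "cutoff_deriv L \<in> borel_measurable half_line" for L
    proof -
      have "(\<lambda>x. indicator {exp (- L)<..<exp L} x * (complex_of_real (- 2 / L\<^sup>2 * ln x * x powr - 1 * (1 / log_weight L x)\<^sup>2)
          * of_real (exp (1 - 1 / log_weight L x)))) \<in> borel_measurable borel"
        unfolding log_weight_def by measurable
      moreover have "cutoff_deriv L = (\<lambda>x. indicator {exp (- L)<..<exp L} x * (complex_of_real (- 2 / L\<^sup>2 * ln x * x powr - 1 * (1 / log_weight L x)\<^sup>2)
          * of_real (exp (1 - 1 / log_weight L x))))"
        by (auto simp: cutoff_deriv_def cutoff_extension_def fun_eq_iff)
      ultimately have "cutoff_deriv L \<in> borel_measurable lebesgue" by (simp add: measurable_completion)
      then show ?thesis by (rule measurable_restrict_space1)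
    qed
    then show ?thesis using l2_measurable[OF bessel_gaussian_l2[OF assms]] by measurable
  qed
  show l2: "(\<lambda>x. bessel_gaussian \<nu> A z x * cutoff_deriv (real (Suc n)) x) \<in> l2 half_line" for n
    unfolding l2_def
  proof (intro CollectI conjI meas)
    show "integrable half_line (\<lambda>x. (cmod (bessel_gaussian \<nu> A z x * cutoff_deriv (real (Suc n)) x))\<^sup>2)"
    proof (rule Bochner_Integration.integrable_bound)
      show "integrable half_line (B (real (Suc n)))" using B[of "real (Suc n)"] by (simp add: has_bochner_integral_iff)
      show "AE x in half_line. norm ((cmod (bessel_gaussian \<nu> A z x * cutoff_deriv (real (Suc n)) x))\<^sup>2) \<le> norm (B (real (Suc n)) x)"
      proof (rule AE_I2)
        fix x assume "x \<in> space half_line"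
        then have "(cmod (bessel_gaussian \<nu> A z x * cutoff_deriv (real (Suc n)) x))\<^sup>2 \<le> B (real (Suc n)) x"
          by (intro le) auto
        then show "norm ((cmod (bessel_gaussian \<nu> A z x * cutoff_deriv (real (Suc n)) x))\<^sup>2) \<le> norm (B (real (Suc n)) x)"
          unfolding real_norm_def abs_of_nonneg[OF zero_le_power2] by (rule order_trans) (rule abs_ge_self)
      qed
    qed (use meas[of n] in measurable)
  qed
  have up: "l2_norm half_line (\<lambda>x. bessel_gaussian \<nu> A z x * cutoff_deriv (real (Suc n)) x) \<le> sqrt (2 * M / real (Suc n))" for n
    unfolding l2_norm_def
  proof (rule real_sqrt_le_mono)
    have "(LINT x|half_line. (cmod (bessel_gaussian \<nu> A z x * cutoff_deriv (real (Suc n)) x))\<^sup>2) \<le> (LINT x|half_line. B (real (Suc n)) x)"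
      using B[of "real (Suc n)"] l2_integrable[OF l2[of n]] le[of "real (Suc n)"]
      by (intro integral_mono) (auto simp: has_bochner_integral_iff)
    also have "\<dots> = M / (real (Suc n))\<^sup>2 * (2 * real (Suc n))"
      using B[of "real (Suc n)"] by (simp add: has_bochner_integral_iff)
    also have "\<dots> = 2 * M / real (Suc n)"
    proof -
      have "M / L\<^sup>2 * (2 * L) = 2 * M / L" if "0 < L" for L :: real
        using that by (simp add: power2_eq_square)
      from this[of "real (Suc n)"] show ?thesis by simp
    qed
    finally show "(LINT x|half_line. (cmod (bessel_gaussian \<nu> A z x * cutoff_deriv (real (Suc n)) x))\<^sup>2) \<le> 2 * M / real (Suc n)" .
  qed
  have lim: "(\<lambda>n. sqrt (2 * M / real (Suc n))) \<longlonglongrightarrow> 0"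
    using tendsto_real_sqrt[OF LIMSEQ_Suc[OF lim_const_over_n[of "2 * M"]]] by simp
  show "(\<lambda>n. l2_norm half_line (\<lambda>x. bessel_gaussian \<nu> A z x * cutoff_deriv (real (Suc n)) x)) \<longlonglongrightarrow> 0"
    by (rule tendsto_sandwich[OF always_eventually always_eventually tendsto_const lim])
      (intro allI l2_norm_nonneg up)+
qed


section \<open>Gaussians as limits in the form sense\<close>

lemma bessel_gaussian_cutoff_algebra: "bessel_gaussian \<nu> A z \<in> cutoff_algebra L z"
  unfolding bessel_gaussian_def[abs_def] by (intro cutoff_algebra.intros)

lemma cutoff_extension_eq_mult: "cutoff_extension L f x = f x * log_cutoff L x"
  by (simp add: cutoff_extension_def)

text \<open>The first order operator with \<partial> - c / x, c = \<nu> + 1/2, annihilates x^c, so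
  it maps the Gaussian \<open>W\<close> to the square integrable \<open>g\<close> = - 2 z x W, and
  it maps W times the cutoff to g times the cutoff plus W times the derivative of the cutoff. By
  \<open>bessel_form_eq_square\<close> the form of a difference is the squared norm of the
  difference of such images.\<close>

lemma bessel_gaussian_form_domain:
  assumes \<nu>: "0 \<le> \<nu>" and z: "0 < Re z"
  shows "bessel_gaussian \<nu> A z \<in> l2_form_domain half_line (bessel_minimal \<nu>)"
proof -
  define W where "W = bessel_gaussian \<nu> A z"
  define L where "L n = real (Suc n)" for n
  have L: "0 < L n" for n by (simp add: L_def)
  define ch where "ch n = log_cutoff (L n)" for n
  define \<phi> where "\<phi> n = cutoff_extension (L n) W" for n
  define \<psi> where "\<psi> n = (\<lambda>x. - (vderiv ^^ 2) (\<phi> n) x + of_real ((\<nu>\<^sup>2 - 1/4) * (1 / x\<^sup>2)) * \<phi> n x)" for n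
  have \<phi>eq: "\<phi> n x = W x * ch n x" for n x
    unfolding \<phi>_def ch_def by (rule cutoff_extension_eq_mult)
  have test: "\<phi> n \<in> test_functions" for n
    unfolding \<phi>_def W_def by (rule cutoff_extension_test_function[OF L bessel_gaussian_cutoff_algebra])
  have W2: "W \<in> l2 half_line" unfolding W_def by (rule bessel_gaussian_l2[OF assms])
  define g where "g x = (- 2 * z) * (of_real (x ^ 1) * W x)" for x
  have g2: "g \<in> l2 half_line"
    unfolding g_def W_def by (intro l2_scale power_times_bessel_gaussian_l2 assms)
  \<comment> \<open>The first order image of \<open>\<phi> n\<close> minus its limit
    \<open>g\<close>. In differences \<open>g\<close> cancels, so the Cauchy property follows from
    the convergence of \<open>r n\<close> to 0.\<close>
  define r where "r n x = g x * (ch n x - 1) + W x * cutoff_deriv (L n) x" for n x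
  have r2: "r n \<in> l2 half_line" for n
    unfolding r_def ch_def L_def W_def
    by (intro l2_add cutoff_l2_convergence(1) g2 bessel_gaussian_cutoff_deriv(1) assms)
  have rlim: "(\<lambda>n. l2_norm half_line (r n)) \<longlonglongrightarrow> 0"
  proof -
    have lim: "(\<lambda>n. l2_norm half_line (\<lambda>x. g x * (ch n x - 1)) + l2_norm half_line (\<lambda>x. W x * cutoff_deriv (L n) x)) \<longlonglongrightarrow> 0 + 0"
      unfolding ch_def L_def W_def
      by (intro tendsto_add cutoff_l2_convergence(2) g2 bessel_gaussian_cutoff_deriv(2) assms)
    have up: "l2_norm half_line (r n) \<le> l2_norm half_line (\<lambda>x. g x * (ch n x - 1)) + l2_norm half_line (\<lambda>x. W x * cutoff_deriv (L n) x)" for n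
      unfolding r_def ch_def L_def W_def
      by (intro l2_norm_triangle cutoff_l2_convergence(1) g2 bessel_gaussian_cutoff_deriv(1) assms)
    show ?thesis
      by (rule tendsto_sandwich[OF always_eventually always_eventually tendsto_const lim[simplified]])
        (intro allI l2_norm_nonneg up)+
  qed
  have d\<phi>: "vderiv (\<phi> n) x - of_real ((\<nu> + 1/2) / x) * \<phi> n x = g x * ch n x + W x * cutoff_deriv (L n) x"
    if x: "0 < x" for n x
  proof -
    have "((\<lambda>x. W x * ch n x) has_vector_derivative W x * cutoff_deriv (L n) x + bessel_gaussian_deriv \<nu> A z x * ch n x) (at x)"
      unfolding W_def ch_def by (intro has_vector_derivative_mult bessel_gaussian_derivative x cutoff_derivative L)
    then have "(\<phi> n has_vector_derivative W x * cutoff_deriv (L n) x + bessel_gaussian_deriv \<nu> A z x * ch n x) (at x)"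
      using \<phi>eq by presburger
    then have "vderiv (\<phi> n) x = W x * cutoff_deriv (L n) x + bessel_gaussian_deriv \<nu> A z x * ch n x"
      unfolding vderiv_def by (rule vector_derivative_at)
    then show ?thesis
      by (simp add: \<phi>eq bessel_gaussian_deriv_def g_def W_def algebra_simps)
  qed
  have form: "l2_inner half_line (\<lambda>x. \<psi> m x - \<psi> n x) (\<lambda>x. \<phi> m x - \<phi> n x)
      = of_real ((l2_norm half_line (\<lambda>x. r m x - r n x))\<^sup>2)" for m n
  proof -
    define D where "D x = \<phi> m x - \<phi> n x" for x
    define D1 where "D1 x = vderiv (\<phi> m) x - vderiv (\<phi> n) x" for x
    define D2 where "D2 x = (vderiv ^^ 2) (\<phi> m) x - (vderiv ^^ 2) (\<phi> n) x" for x
    have "l2_inner half_line (\<lambda>x. - D2 x + of_real ((\<nu>\<^sup>2 - 1/4) * (1 / x\<^sup>2)) * D x) D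
        = of_real (LINT x|half_line. (cmod (D1 x - of_real ((\<nu> + 1/2) / x) * D x))\<^sup>2)"
    \<comment> \<open>The sum \<open>L m + L n\<close> exceeds both parameters, so one interval
      carries both cutoffs.\<close>
    proof (rule bessel_form_eq_square[where a = "exp (- (L m + L n))" and b = "exp (L m + L n)"])
      fix x assume x: "x \<notin> {exp (- (L m + L n))..exp (L m + L n)}"
      have "\<phi> k x = 0" if "k \<in> {m, n}" for k
      proof -
        have "exp (- (L m + L n)) \<le> exp (- L k)" "exp (L k) \<le> exp (L m + L n)"
          using that L[of m] L[of n] by auto
        with x have "x \<notin> {exp (- L k)<..<exp (L k)}"
          by (meson atLeastAtMost_iff greaterThanLessThan_iff less_imp_le order_trans)
        then show ?thesis unfolding \<phi>_def cutoff_extension_def by (rule if_not_P)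
      qed
      then show "D x = 0" by (simp add: D_def)
    next
      show "(D has_vector_derivative D1 x) (at x)" for x
        unfolding D_def[abs_def] D1_def by (intro has_vector_derivative_diff test_function_derivatives test)
      show "(D1 has_vector_derivative D2 x) (at x)" for x
        unfolding D1_def[abs_def] D2_def by (intro has_vector_derivative_diff test_function_derivatives test)
      show "continuous_on {0<..} D2"
        unfolding D2_def[abs_def] by (intro continuous_on_diff test_function_derivatives test)
    qed simp
    moreover have "(LINT x|half_line. (cmod (D1 x - of_real ((\<nu> + 1/2) / x) * D x))\<^sup>2) = (l2_norm half_line (\<lambda>x. r m x - r n x))\<^sup>2"
      unfolding l2_norm_square
    proof (rule Bochner_Integration.integral_cong[OF refl])
      fix x assume "x \<in> space half_line"
      then have x: "0 < x" by simp
      have "D1 x - of_real ((\<nu> + 1/2) / x) * D x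
          = (vderiv (\<phi> m) x - of_real ((\<nu> + 1/2) / x) * \<phi> m x) - (vderiv (\<phi> n) x - of_real ((\<nu> + 1/2) / x) * \<phi> n x)"
        by (simp add: D_def D1_def right_diff_distrib)
      also have "\<dots> = r m x - r n x"
        unfolding d\<phi>[OF x] r_def by (simp add: algebra_simps)
      finally show "(cmod (D1 x - of_real ((\<nu> + 1/2) / x) * D x))\<^sup>2 = (cmod (r m x - r n x))\<^sup>2" by simp
    qed
    moreover have "(\<lambda>x. \<psi> m x - \<psi> n x) = (\<lambda>x. - D2 x + of_real ((\<nu>\<^sup>2 - 1/4) * (1 / x\<^sup>2)) * D x)"
    proof -
      have "(- a + q * u) - (- b + q * v) = - (a - b) + q * (u - v)" for a b q u v :: complex
        by (simp add: algebra_simps)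
      then show ?thesis unfolding \<psi>_def D2_def D_def by (simp only:)
    qed
    ultimately show ?thesis unfolding D_def[abs_def] by simp
  qed
  show ?thesis unfolding l2_form_domain_def W_def[symmetric]
  proof (rule CollectI, rule conjI[OF W2], rule exI[of _ \<phi>], rule exI[of _ \<psi>], intro conjI allI impI)
    show "(\<phi> n, \<psi> n) \<in> bessel_minimal \<nu>" for n
      unfolding bessel_minimal_def \<psi>_def using test by blast
    have "\<phi> n x - W x = W x * (ch n x - 1)" for n x by (simp add: \<phi>eq algebra_simps)
    then show "l2_tendsto half_line \<phi> W sequentially"
      unfolding l2_tendsto_iff_norm using cutoff_l2_convergence(2)[OF W2] by (simp add: ch_def L_def)
    fix \<epsilon> :: real assume \<epsilon>: "0 < \<epsilon>"
    \<comment> \<open>The form is a squared norm, and that norm is bounded by two norms of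
      remainders.\<close>
    then have "0 < sqrt \<epsilon> / 2" by simp
    from order_tendstoD(2)[OF rlim this] obtain K where K: "\<And>n. K \<le> n \<Longrightarrow> l2_norm half_line (r n) < sqrt \<epsilon> / 2"
      by (auto simp: eventually_sequentially)
    show "\<exists>K. \<forall>m\<ge>K. \<forall>n\<ge>K. cmod (l2_inner half_line (\<lambda>x. \<psi> m x - \<psi> n x) (\<lambda>x. \<phi> m x - \<phi> n x)) < \<epsilon>"
    proof (intro exI[of _ K] allI impI)
      fix m n assume "K \<le> m" "K \<le> n"
      have "l2_norm half_line (\<lambda>x. r m x - r n x) \<le> l2_norm half_line (r m) + l2_norm half_line (\<lambda>x. (- 1) * r n x)"
        using l2_norm_triangle[OF r2[of m] l2_scale[OF r2[of n], of "-1"]] by simp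
      also have "\<dots> < sqrt \<epsilon>"
        unfolding l2_norm_scale using K[OF \<open>K \<le> m\<close>] K[OF \<open>K \<le> n\<close>] by simp
      finally have "(l2_norm half_line (\<lambda>x. r m x - r n x))\<^sup>2 < (sqrt \<epsilon>)\<^sup>2"
        by (intro power_strict_mono l2_norm_nonneg) auto
      then show "cmod (l2_inner half_line (\<lambda>x. \<psi> m x - \<psi> n x) (\<lambda>x. \<phi> m x - \<phi> n x)) < \<epsilon>"
        unfolding form norm_of_real using \<epsilon> by simp
    qed
  qed
qed

lemma bessel_gaussian_friedrichs:
  assumes "0 \<le> \<nu>" "0 < Re z"
  shows "(bessel_gaussian \<nu> A z, bessel_gaussian_image \<nu> A z) \<in> bessel_friedrichs \<nu>"
  using bessel_gaussian_adjoint[OF assms] bessel_gaussian_form_domain[OF assms]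
  by (simp add: bessel_friedrichs_def friedrichs_extension_def)


section \<open>Evolution of Gaussians\<close>


lemma l2_norm_mono:
  assumes "f \<in> l2 M" "g \<in> l2 M" "\<And>x. x \<in> space M \<Longrightarrow> cmod (f x) \<le> cmod (g x)"
  shows "l2_norm M f \<le> l2_norm M g"
  unfolding l2_norm_def
  by (intro real_sqrt_le_mono integral_mono l2_integrable power_mono assms) auto

text \<open>In the parameter \<open>p = 1 / z\<close> the free evolution of Gaussians is the translation
  \<open>p \<mapsto> p + 4 i t\<close> along vertical lines of the right half-plane.\<close>

definition bessel_wave :: "real \<Rightarrow> complex \<Rightarrow> real \<Rightarrow> complex" where
  "bessel_wave \<nu> p = bessel_gaussian \<nu> (exp (- of_real (\<nu> + 1) * Ln p)) (1 / p)"

text \<open>The derivative is taken in the parameter \<open>p\<close>, not in \<open>x\<close>;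
  likewise for the second derivative below.\<close>

definition bessel_wave_deriv :: "real \<Rightarrow> complex \<Rightarrow> real \<Rightarrow> complex" where
  "bessel_wave_deriv \<nu> p x = (- of_real (\<nu> + 1) / p + of_real (x\<^sup>2) / p\<^sup>2) * bessel_wave \<nu> p x"

definition bessel_wave_deriv2 :: "real \<Rightarrow> complex \<Rightarrow> real \<Rightarrow> complex" where
  "bessel_wave_deriv2 \<nu> p x = ((- of_real (\<nu> + 1) / p + of_real (x\<^sup>2) / p\<^sup>2)\<^sup>2
    + of_real (\<nu> + 1) / p\<^sup>2 - 2 * of_real (x\<^sup>2) / p ^ 3) * bessel_wave \<nu> p x"

lemma Re_inverse_pos: "0 < Re p \<Longrightarrow> 0 < Re (1 / p)"
  by (simp add: Re_divide divide_pos_pos power2_eq_square add_pos_nonneg)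

lemma bessel_wave_has_derivative:
  assumes p: "0 < Re p"
  shows "((\<lambda>p. bessel_wave \<nu> p x) has_field_derivative bessel_wave_deriv \<nu> p x) (at p)"
proof -
  have p0: "p \<noteq> 0" "p \<notin> \<real>\<^sub>\<le>\<^sub>0" using p by (auto simp: complex_nonpos_Reals_iff)
  have "((\<lambda>p. exp (- of_real (\<nu> + 1) * Ln p) * of_real (x powr (\<nu> + 1/2)) * exp (- (1 / p) * of_real (x\<^sup>2)))
      has_field_derivative (- of_real (\<nu> + 1) / p + of_real (x\<^sup>2) / p\<^sup>2)
        * (exp (- of_real (\<nu> + 1) * Ln p) * of_real (x powr (\<nu> + 1/2)) * exp (- (1 / p) * of_real (x\<^sup>2)))) (at p)"
    using p0 by (auto intro!: derivative_eq_intros) (simp add: field_simps power2_eq_square)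
  then show ?thesis
    by (simp add: bessel_wave_def bessel_wave_deriv_def bessel_gaussian_def)
qed

lemma bessel_wave_has_derivative2:
  assumes p: "0 < Re p"
  shows "((\<lambda>p. bessel_wave_deriv \<nu> p x) has_field_derivative bessel_wave_deriv2 \<nu> p x) (at p)"
proof -
  have p0: "p \<noteq> 0" using p by auto
  have "((\<lambda>p. (- of_real (\<nu> + 1) / p + of_real (x\<^sup>2) / p\<^sup>2) * bessel_wave \<nu> p x) has_field_derivative
     (of_real (\<nu> + 1) / p\<^sup>2 - 2 * of_real (x\<^sup>2) / p ^ 3) * bessel_wave \<nu> p x
     + bessel_wave_deriv \<nu> p x * (- of_real (\<nu> + 1) / p + of_real (x\<^sup>2) / p\<^sup>2)) (at p)"
  proof (rule DERIV_mult[OF _ bessel_wave_has_derivative[OF p]])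
    show "((\<lambda>p. - of_real (\<nu> + 1) / p + of_real (x\<^sup>2) / p\<^sup>2) has_field_derivative
       of_real (\<nu> + 1) / p\<^sup>2 - 2 * of_real (x\<^sup>2) / p ^ 3) (at p)"
      using p0 by (auto intro!: derivative_eq_intros) (simp add: field_simps eval_nat_numeral)
  qed
  moreover have "(u - v) * w + (a * w) * a = (a\<^sup>2 + u - v) * w" for a u v w :: complex
    by (simp add: power2_eq_square algebra_simps)
  ultimately show ?thesis
    unfolding bessel_wave_deriv_def bessel_wave_deriv2_def by (simp only:)
qed

lemma bessel_wave_l2:
  assumes "0 \<le> \<nu>" "0 < Re p"
  shows "bessel_wave \<nu> p \<in> l2 half_line"
  unfolding bessel_wave_def by (intro bessel_gaussian_l2 assms Re_inverse_pos)

lemma bessel_wave_deriv_l2: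
  assumes "0 \<le> \<nu>" "0 < Re p"
  shows "bessel_wave_deriv \<nu> p \<in> l2 half_line"
proof -
  have "(\<lambda>x. (- of_real (\<nu> + 1) / p) * bessel_wave \<nu> p x + (1 / p\<^sup>2) * (of_real (x ^ 2) * bessel_wave \<nu> p x)) \<in> l2 half_line"
    unfolding bessel_wave_def by (intro l2_add l2_scale power_times_bessel_gaussian_l2 bessel_gaussian_l2 assms Re_inverse_pos)
  then show ?thesis by (simp add: bessel_wave_deriv_def[abs_def] algebra_simps)
qed

text \<open>The prefactor p^(- (\<nu> + 1)) of the wave is chosen for this: with z = 1 / p its
  derivative supplies the constant term 4 z (\<nu> + 1) of the image, and the derivative of the
  exponent supplies the term in x^2. The operator thus acts as - 4 times the derivative in p, which
  makes the evolution a translation in p.\<close>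

lemma bessel_wave_friedrichs:
  assumes "0 \<le> \<nu>" "0 < Re p"
  shows "(bessel_wave \<nu> p, \<lambda>x. - 4 * bessel_wave_deriv \<nu> p x) \<in> bessel_friedrichs \<nu>"
proof -
  have "(\<lambda>x. - 4 * bessel_wave_deriv \<nu> p x) = bessel_gaussian_image \<nu> (exp (- of_real (\<nu> + 1) * Ln p)) (1 / p)"
    by (auto simp: bessel_wave_deriv_def bessel_gaussian_image_def bessel_wave_def fun_eq_iff
        power_divide algebra_simps)
  then show ?thesis
    using bessel_gaussian_friedrichs[OF assms(1) Re_inverse_pos[OF assms(2)]] by (simp add: bessel_wave_def)
qed

text \<open>On a bounded piece of a vertical line in the right half-plane |q| is at least \<rho> and
  Re (1 / q) is bounded below. One Gaussian times a polynomial in x therefore dominates uniformly in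
  q, and it is square integrable.\<close>

lemma bessel_wave_deriv2_bound:
  assumes \<nu>: "0 \<le> \<nu>" and \<rho>: "0 < \<rho>"
  shows "\<exists>E\<in>l2 half_line. \<forall>q x. Re q = \<rho> \<longrightarrow> cmod q \<le> R \<longrightarrow> 0 < x \<longrightarrow> cmod (bessel_wave_deriv2 \<nu> q x) \<le> cmod (E x)"
proof -
  \<comment> \<open>A lower bound for Re (1 / q) = \<rho> / |q|^2; this form of the denominator is
    positive whatever the sign of \<open>R\<close>.\<close>
  define a where "a = \<rho> / (\<rho> + \<bar>R\<bar>)\<^sup>2"
  define C where "C = exp (- (\<nu> + 1) * ln \<rho>)"
  define G where "G = bessel_gaussian \<nu> (of_real C) (of_real a)"
  define \<alpha> \<beta> \<gamma> where "\<alpha> = (\<nu> + 1)\<^sup>2 / \<rho>\<^sup>2 + (\<nu> + 1) / \<rho>\<^sup>2" and "\<beta> = 2 * (\<nu> + 1) / \<rho> ^ 3 + 2 / \<rho> ^ 3" and "\<gamma> = 1 / \<rho> ^ 4"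
  have pos: "0 \<le> \<alpha>" "0 \<le> \<beta>" "0 \<le> \<gamma>" using \<nu> \<rho> by (auto simp: \<alpha>_def \<beta>_def \<gamma>_def)
  define E where "E x = of_real \<alpha> * G x + (of_real \<beta> * (of_real (x ^ 2) * G x) + of_real \<gamma> * (of_real (x ^ 4) * G x))" for x
  have a: "0 < a" using \<rho> by (simp add: a_def add_pos_nonneg)
  have "E \<in> l2 half_line"
    unfolding E_def G_def using a
    by (intro l2_add l2_scale power_times_bessel_gaussian_l2 bessel_gaussian_l2 \<nu>) auto
  moreover have "cmod (bessel_wave_deriv2 \<nu> q x) \<le> cmod (E x)" if q: "Re q = \<rho>" "cmod q \<le> R" and x: "0 < x" for q x
  proof -
    have q0: "q \<noteq> 0" using q \<rho> by auto
    have \<rho>q: "\<rho> \<le> cmod q" using complex_Re_le_cmod[of q] q by simp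
    have pw: "cmod (w / q ^ k) \<le> cmod w / \<rho> ^ k" for w k
      using \<rho>q \<rho> by (simp add: norm_divide norm_power frac_le power_mono)
    have W: "cmod (bessel_wave \<nu> q x) \<le> cmod (G x)"
    proof -
      have "a \<le> Re (1 / q)"
      proof -
        have "Re (1 / q) = \<rho> / (cmod q)\<^sup>2" by (simp add: Re_divide q cmod_power2)
        moreover have "(cmod q)\<^sup>2 \<le> (\<rho> + \<bar>R\<bar>)\<^sup>2" using q \<rho> by (intro power_mono) auto
        ultimately show ?thesis using \<rho> q0 by (simp add: a_def frac_le)
      qed
      then have "exp (- Re (1 / q) * x\<^sup>2) \<le> exp (- a * x\<^sup>2)" by (simp add: mult_right_mono)
      moreover have "cmod (exp (- of_real (\<nu> + 1) * Ln q)) \<le> C"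
      proof -
        have "cmod (exp (- of_real (\<nu> + 1) * Ln q)) = exp (- (\<nu> + 1) * ln (cmod q))"
          using q0 by (simp add: norm_exp_eq_Re)
        also have "\<dots> \<le> C"
        proof -
          have "ln \<rho> \<le> ln (cmod q)" using \<rho> \<rho>q q0 by (subst ln_le_cancel_iff) auto
          then show ?thesis unfolding C_def using \<nu> by (simp add: mult_left_mono)
        qed
        finally show ?thesis .
      qed
      moreover have "0 \<le> C" by (simp add: C_def)
      ultimately show ?thesis unfolding bessel_wave_def G_def cmod_bessel_gaussian
        by (intro mult_mono) auto
    qed
    have "cmod ((- of_real (\<nu> + 1) / q + of_real (x\<^sup>2) / q\<^sup>2)\<^sup>2 + of_real (\<nu> + 1) / q\<^sup>2 - 2 * of_real (x\<^sup>2) / q ^ 3)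
        \<le> ((\<nu> + 1) / \<rho> + x\<^sup>2 / \<rho>\<^sup>2)\<^sup>2 + (\<nu> + 1) / \<rho>\<^sup>2 + 2 * x\<^sup>2 / \<rho> ^ 3"
    proof -
      have 1: "cmod (- of_real (\<nu> + 1) / q + of_real (x\<^sup>2) / q\<^sup>2) \<le> (\<nu> + 1) / \<rho> + x\<^sup>2 / \<rho>\<^sup>2"
      proof (rule norm_triangle_mono)
        show "cmod (- of_real (\<nu> + 1) / q) \<le> (\<nu> + 1) / \<rho>"
          using pw[of "- of_real (\<nu> + 1)" 1] \<nu> unfolding norm_minus_cancel norm_of_real by simp
        show "cmod (of_real (x\<^sup>2) / q\<^sup>2) \<le> x\<^sup>2 / \<rho>\<^sup>2"
          using pw[of "of_real (x\<^sup>2)" 2] unfolding norm_of_real by simp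
      qed
      have 2: "cmod (of_real (\<nu> + 1) / q\<^sup>2) \<le> (\<nu> + 1) / \<rho>\<^sup>2"
        using pw[of "of_real (\<nu> + 1)" 2] \<nu> unfolding norm_of_real by simp
      have 3: "cmod (2 * of_real (x\<^sup>2) / q ^ 3) \<le> 2 * x\<^sup>2 / \<rho> ^ 3"
        using pw[of "2 * of_real (x\<^sup>2)" 3] by (simp add: norm_mult norm_power)
      have "cmod ((- of_real (\<nu> + 1) / q + of_real (x\<^sup>2) / q\<^sup>2)\<^sup>2) \<le> ((\<nu> + 1) / \<rho> + x\<^sup>2 / \<rho>\<^sup>2)\<^sup>2"
        unfolding norm_power using 1 by (intro power_mono) auto
      from norm_triangle_mono[OF this 2] 3 show ?thesis
        by (intro order_trans[OF norm_triangle_ineq4] add_mono)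
    qed
    also have "\<dots> = \<alpha> + \<beta> * x ^ 2 + \<gamma> * x ^ 4"
      using \<rho> by (simp add: \<alpha>_def \<beta>_def \<gamma>_def field_simps power2_eq_square power3_eq_cube power4_eq_xxxx)
    finally have "cmod (bessel_wave_deriv2 \<nu> q x) \<le> (\<alpha> + \<beta> * x ^ 2 + \<gamma> * x ^ 4) * cmod (G x)"
      unfolding bessel_wave_deriv2_def norm_mult using pos by (intro mult_mono W) auto
    also have "\<dots> = cmod (E x)"
    proof -
      have "E x = of_real (\<alpha> + \<beta> * x ^ 2 + \<gamma> * x ^ 4) * G x" by (simp add: E_def algebra_simps)
      moreover have "0 \<le> \<alpha> + \<beta> * x ^ 2 + \<gamma> * x ^ 4" using pos by simp
      ultimately show ?thesis by (simp only: norm_mult norm_of_real abs_of_nonneg)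
    qed
    finally show ?thesis .
  qed
  ultimately show ?thesis by blast
qed

text \<open>Second order Taylor expansion in p along the segment to p + 4 i h, pointwise in x. The
  squared step is 16 h^2, so after division by h the remainder is at most 16 |h| times one fixed L^2
  function. The radius |p| + 4 covers all steps with |h| \<le> 1.\<close>

lemma bessel_wave_difference_quotient:
  assumes \<nu>: "0 \<le> \<nu>" and p: "0 < Re p"
  shows "((\<lambda>h. l2_norm half_line (\<lambda>x. (bessel_wave \<nu> (p + 4 * \<i> * of_real h) x - bessel_wave \<nu> p x) / of_real h
    - 4 * \<i> * bessel_wave_deriv \<nu> p x)) \<longlongrightarrow> 0) (at 0)"
proof -
  obtain E where E: "E \<in> l2 half_line"
    "\<And>q x. Re q = Re p \<Longrightarrow> cmod q \<le> cmod p + 4 \<Longrightarrow> 0 < x \<Longrightarrow> cmod (bessel_wave_deriv2 \<nu> q x) \<le> cmod (E x)"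
    using bessel_wave_deriv2_bound[OF \<nu> p, of "cmod p + 4"] by blast
  define Q where "Q h x = (bessel_wave \<nu> (p + 4 * \<i> * of_real h) x - bessel_wave \<nu> p x) / of_real h
    - 4 * \<i> * bessel_wave_deriv \<nu> p x" for h x
  have le: "l2_norm half_line (Q h) \<le> \<bar>h\<bar> * (16 * l2_norm half_line E)" if h: "h \<noteq> 0" "\<bar>h\<bar> \<le> 1" for h
  proof -
    define p' where "p' = p + 4 * \<i> * of_real h"
    have seg: "Re q = Re p \<and> cmod q \<le> cmod p + 4" if q: "q \<in> closed_segment p p'" for q
    proof -
      obtain u where u: "0 \<le> u" "u \<le> 1" "q = p + of_real u * (4 * \<i> * of_real h)"
        using q by (auto simp: closed_segment_def p'_def scaleR_conv_of_real algebra_simps)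
      have "cmod q \<le> cmod p + cmod (of_real u * (4 * \<i> * of_real h))" unfolding u by (rule norm_triangle_ineq)
      also have "cmod (of_real u * (4 * \<i> * of_real h)) = u * \<bar>h\<bar> * 4" using u by (simp add: norm_mult)
      also have "\<dots> \<le> 1 * 1 * 4" using u h by (intro mult_mono) auto
      finally show ?thesis by (simp add: u)
    qed
    have pt: "cmod (Q h x) \<le> cmod (of_real (16 * \<bar>h\<bar>) * E x)" if x: "x \<in> space half_line" for x
    proof -
      define f where "f i q = (if i = 0 then bessel_wave \<nu> q x else if i = Suc 0 then bessel_wave_deriv \<nu> q x
        else bessel_wave_deriv2 \<nu> q x)" for i q
      have "cmod (f 0 p' - (\<Sum>i\<le>Suc 0. f i p * (p' - p) ^ i / fact i)) \<le> cmod (E x) * cmod (p' - p) ^ Suc (Suc 0) / fact (Suc 0)"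
      proof (rule complex_Taylor[where S = "closed_segment p p'"])
        fix i q assume q: "q \<in> closed_segment p p'" and i: "i \<le> Suc 0"
        have "0 < Re q" using seg[OF q] p by simp
        then have "(f i has_field_derivative f (Suc i) q) (at q)"
          using i bessel_wave_has_derivative[of q \<nu> x] bessel_wave_has_derivative2[of q \<nu> x]
          by (cases i) (auto simp: f_def[abs_def])
        then show "(f i has_field_derivative f (Suc i) q) (at q within closed_segment p p')"
          by (rule has_field_derivative_at_within)
      next
        fix q assume "q \<in> closed_segment p p'"
        then show "cmod (f (Suc (Suc 0)) q) \<le> cmod (E x)" using seg[of q] E(2)[of q x] x by (simp add: f_def)
      qed auto
      then have "cmod (bessel_wave \<nu> p' x - bessel_wave \<nu> p x - bessel_wave_deriv \<nu> p x * (4 * \<i> * of_real h)) \<le> cmod (E x) * (16 * h\<^sup>2)"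
        by (simp add: f_def p'_def norm_mult power2_eq_square algebra_simps)
      moreover have "Q h x = (bessel_wave \<nu> p' x - bessel_wave \<nu> p x - bessel_wave_deriv \<nu> p x * (4 * \<i> * of_real h)) / of_real h"
        using h by (simp add: Q_def p'_def diff_divide_distrib)
      ultimately have "cmod (Q h x) \<le> cmod (E x) * (16 * h\<^sup>2) / \<bar>h\<bar>"
        by (simp add: norm_divide divide_right_mono)
      also have "\<dots> = cmod (of_real (16 * \<bar>h\<bar>) * E x)"
        using h by (simp add: norm_mult power2_eq_square abs_if)
      finally show ?thesis .
    qed
    have "Q h \<in> l2 half_line"
    proof -
      have "(\<lambda>x. (1 / of_real h) * (bessel_wave \<nu> (p + 4 * \<i> * of_real h) x - bessel_wave \<nu> p x)
          - (4 * \<i>) * bessel_wave_deriv \<nu> p x) \<in> l2 half_line"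
        using p by (intro l2_diff l2_scale bessel_wave_l2 bessel_wave_deriv_l2 \<nu>) auto
      then show ?thesis by (simp add: Q_def[abs_def])
    qed
    from l2_norm_mono[OF this l2_scale[OF E(1)] pt]
    show ?thesis unfolding l2_norm_scale norm_of_real by (simp add: abs_mult mult.assoc mult.left_commute)
  qed
  have lim: "((\<lambda>h. \<bar>h\<bar> * (16 * l2_norm half_line E)) \<longlongrightarrow> 0) (at 0)"
    by (intro tendsto_mult_left_zero tendsto_rabs_zero tendsto_ident_at)
  have "((\<lambda>h. l2_norm half_line (Q h)) \<longlongrightarrow> 0) (at 0)"
  proof (rule tendsto_sandwich[OF _ _ tendsto_const lim])
    show "\<forall>\<^sub>F h in at 0. 0 \<le> l2_norm half_line (Q h)" by (intro always_eventually allI l2_norm_nonneg)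
    show "\<forall>\<^sub>F h in at 0. l2_norm half_line (Q h) \<le> \<bar>h\<bar> * (16 * l2_norm half_line E)"
      unfolding eventually_at using le by (intro exI[of _ 1]) auto
  qed
  then show ?thesis unfolding Q_def .
qed


section \<open>Uniqueness of orbits and the evolution of the Gaussians\<close>

lemma unitary_group_isometry:
  assumes U: "unitary_group M U" and f: "f \<in> l2 M"
  shows "l2_norm M (U t f) = l2_norm M f"
proof -
  have "l2_inner M g g = of_real (LINT x|M. (cmod (g x))\<^sup>2)" for g
    unfolding l2_inner_def complex_norm_square[symmetric] by (rule integral_complex_of_real)
  moreover have "l2_inner M (U t f) (U t f) = l2_inner M f f"
    using U f by (auto simp: unitary_group_def)
  ultimately show ?thesis by (simp add: l2_norm_def)
qed

text \<open>Writing \<open>w (s + h) - U (s + h) w\<^sub>0 = (w (s + h) - U h (w s)) + U h (w s - U s w\<^sub>0)\<close>, isometry bounds the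
  increment of \<open>\<parallel>w s - U s w\<^sub>0\<parallel>\<close> by the norm of the first bracket, which is \<open>o(h)\<close>.\<close>

lemma unitary_group_unique_orbit:
  fixes w :: "real \<Rightarrow> 'a \<Rightarrow> complex"
  assumes U: "unitary_group M U" and w: "\<And>s. w s \<in> l2 M"
    and gen: "\<And>s. (w s, v s) \<in> group_generator M U"
    and deriv: "\<And>s. ((\<lambda>h. l2_norm M (\<lambda>x. (w (s + h) x - w s x) / of_real h - v s x)) \<longlongrightarrow> 0) (at 0)"
  shows "AE x in M. U t (w 0) x = w t x"
proof -
  have U2: "U t f \<in> l2 M" if "f \<in> l2 M" for t f using U that by (auto simp: unitary_group_def)
  have lin: "AE x in M. U t (\<lambda>y. a * f y + b * g y) x = a * U t f x + b * U t g x"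
    if "f \<in> l2 M" "g \<in> l2 M" for t a b f g
    using U that unfolding unitary_group_def by blast
  have v: "v s \<in> l2 M" for s using gen by (auto simp: group_generator_def)
  have genlim: "((\<lambda>h. l2_norm M (\<lambda>x. (U h (w s) x - w s x) / of_real h - v s x)) \<longlongrightarrow> 0) (at 0)" for s
    using gen[of s] by (simp add: group_generator_def l2_tendsto_iff_norm)
  define D where "D s = l2_norm M (\<lambda>x. w s x - U s (w 0) x)" for s
  have inc: "\<bar>D (s + h) - D s\<bar> \<le> l2_norm M (\<lambda>x. w (s + h) x - U h (w s) x)" for s h
  proof -
    define X where "X x = w (s + h) x - U (s + h) (w 0) x" for x
    \<comment> \<open>A difference written as a linear combination, the shape in which
      \<open>unitary_group\<close> provides linearity.\<close>
    define Y0 where "Y0 x = 1 * w s x + (- 1) * U s (w 0) x" for x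
    define Y where "Y = U h Y0"
    have X: "X \<in> l2 M" unfolding X_def by (intro l2_diff w U2)
    have Y0: "Y0 \<in> l2 M" unfolding Y0_def by (intro l2_add l2_scale w U2)
    have Y: "Y \<in> l2 M" unfolding Y_def by (intro U2 Y0)
    have "AE x in M. Y x = 1 * U h (w s) x + (- 1) * U h (U s (w 0)) x"
      unfolding Y_def Y0_def by (rule lin[OF w U2[OF w]])
    moreover have "AE x in M. U (h + s) (w 0) x = U h (U s (w 0)) x"
      using U w by (auto simp: unitary_group_def)
    ultimately have "AE x in M. X x - Y x = w (s + h) x - U h (w s) x"
      by eventually_elim (simp add: X_def add.commute)
    then have "l2_norm M (\<lambda>x. X x - Y x) = l2_norm M (\<lambda>x. w (s + h) x - U h (w s) x)"
      using X Y w U2 by (intro l2_norm_cong_AE) (auto intro!: borel_measurable_diff dest: l2_measurable)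
    moreover have "D s = l2_norm M Y"
      unfolding Y_def unitary_group_isometry[OF U Y0] by (simp add: D_def Y0_def[abs_def])
    moreover have "D (s + h) = l2_norm M X" by (simp add: D_def X_def[abs_def])
    ultimately show ?thesis using l2_norm_diff_abs_le[OF X Y] by simp
  qed
  have "(D has_real_derivative 0) (at s)" for s
    unfolding DERIV_def
  proof (rule Lim_null_comparison)
    show "((\<lambda>h. l2_norm M (\<lambda>x. (w (s + h) x - w s x) / of_real h - v s x)
        + l2_norm M (\<lambda>x. (U h (w s) x - w s x) / of_real h - v s x)) \<longlongrightarrow> 0) (at 0)"
      using tendsto_add[OF deriv[of s] genlim[of s]] by simp
    show "\<forall>\<^sub>F h in at 0. norm ((D (s + h) - D s) / h) \<le> l2_norm M (\<lambda>x. (w (s + h) x - w s x) / of_real h - v s x)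
        + l2_norm M (\<lambda>x. (U h (w s) x - w s x) / of_real h - v s x)"
      unfolding eventually_at
    proof (intro exI[of _ 1] conjI ballI impI)
      fix h :: real assume "h \<noteq> 0 \<and> dist h 0 < 1"
      then have h: "h \<noteq> 0" by simp
      define a where "a x = (w (s + h) x - w s x) / of_real h - v s x" for x
      define b where "b x = (U h (w s) x - w s x) / of_real h - v s x" for x
      have q: "(\<lambda>x. (1 / of_real h) * (f x - g x) - v s x) \<in> l2 M" if "f \<in> l2 M" "g \<in> l2 M" for f g
        using that v by (intro l2_diff l2_scale)
      have ab: "a \<in> l2 M" "b \<in> l2 M"
        unfolding a_def b_def using q[OF w w] q[OF U2[OF w] w] by simp_all
      have "\<bar>(D (s + h) - D s) / h\<bar> = \<bar>1 / h\<bar> * \<bar>D (s + h) - D s\<bar>" by (simp add: abs_mult[symmetric])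
      also have "\<dots> \<le> \<bar>1 / h\<bar> * l2_norm M (\<lambda>x. w (s + h) x - U h (w s) x)" by (intro mult_left_mono inc) simp
      also have "\<dots> = l2_norm M (\<lambda>x. of_real (1 / h) * (w (s + h) x - U h (w s) x))"
        unfolding l2_norm_scale norm_of_real by (rule refl)
      also have "(\<lambda>x. of_real (1 / h) * (w (s + h) x - U h (w s) x)) = (\<lambda>x. a x + (- 1) * b x)"
        by (simp add: a_def b_def fun_eq_iff diff_divide_distrib)
      also have "l2_norm M \<dots> \<le> l2_norm M a + l2_norm M (\<lambda>x. (- 1) * b x)"
        by (intro l2_norm_triangle ab l2_scale)
      also have "\<dots> = l2_norm M a + l2_norm M b" unfolding l2_norm_scale by simp
      finally show "norm ((D (s + h) - D s) / h) \<le> l2_norm M (\<lambda>x. (w (s + h) x - w s x) / of_real h - v s x)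
          + l2_norm M (\<lambda>x. (U h (w s) x - w s x) / of_real h - v s x)"
        by (simp add: a_def[abs_def] b_def[abs_def])
    qed simp
  qed
  then have "D t = D 0" by (intro DERIV_isconst_all) auto
  moreover have "D 0 = 0"
  proof -
    have "AE x in M. U 0 (w 0) x = w 0 x" using U w by (auto simp: unitary_group_def)
    then have "AE x in M. w 0 x - U 0 (w 0) x = 0" by (auto elim: eventually_mono)
    then show ?thesis unfolding D_def by (subst l2_norm_eq_0_iff) (auto intro: l2_diff w U2)
  qed
  ultimately have "D t = 0" by simp
  then have "AE x in M. w t x - U t (w 0) x = 0"
    unfolding D_def by (subst (asm) l2_norm_eq_0_iff) (auto intro: l2_diff w U2)
  then show ?thesis by (auto elim: eventually_mono)
qed

text \<open>Along p + 4 i s the time derivative is 4 i times the derivative in p, which is - i times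
  the image under the operator. The explicit curve thus has the derivative that the generator
  prescribes.\<close>

lemma schroedinger_group_bessel_wave:
  assumes \<nu>: "0 \<le> \<nu>" and p: "0 < Re p"
    and U: "schroedinger_group half_line (bessel_friedrichs \<nu>) U"
  shows "AE x in half_line. U t (bessel_wave \<nu> p) x = bessel_wave \<nu> (p + 4 * \<i> * of_real t) x"
proof -
  define w where "w s = bessel_wave \<nu> (p + 4 * \<i> * of_real s)" for s
  have Re: "0 < Re (p + 4 * \<i> * of_real s)" for s using p by simp
  have "AE x in half_line. U t (w 0) x = w t x"
  proof (rule unitary_group_unique_orbit[where v = "\<lambda>s x. 4 * \<i> * bessel_wave_deriv \<nu> (p + 4 * \<i> * of_real s) x"])
    show "unitary_group half_line U" using U by (simp add: schroedinger_group_def)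
    show "w s \<in> l2 half_line" for s unfolding w_def by (rule bessel_wave_l2[OF \<nu> Re])
    show "(w s, \<lambda>x. 4 * \<i> * bessel_wave_deriv \<nu> (p + 4 * \<i> * of_real s) x) \<in> group_generator half_line U" for s
    proof -
      have "(\<lambda>x. 4 * \<i> * bessel_wave_deriv \<nu> (p + 4 * \<i> * of_real s) x)
          = (\<lambda>x. - \<i> * (- 4 * bessel_wave_deriv \<nu> (p + 4 * \<i> * of_real s) x))"
        by (simp add: mult.assoc mult.left_commute)
      moreover have "group_generator half_line U = {(f, \<lambda>x. - \<i> * g x) | f g. (f, g) \<in> bessel_friedrichs \<nu>}"
        using U by (simp add: schroedinger_group_def)
      moreover have "(w s, \<lambda>x. - \<i> * (- 4 * bessel_wave_deriv \<nu> (p + 4 * \<i> * of_real s) x))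
          \<in> {(f, \<lambda>x. - \<i> * g x) | f g. (f, g) \<in> bessel_friedrichs \<nu>}"
        unfolding w_def by (rule CollectI, intro exI conjI, rule refl, rule bessel_wave_friedrichs[OF \<nu> Re])
      ultimately show ?thesis by (simp only:)
    qed
    show "((\<lambda>h. l2_norm half_line (\<lambda>x. (w (s + h) x - w s x) / of_real h
        - 4 * \<i> * bessel_wave_deriv \<nu> (p + 4 * \<i> * of_real s) x)) \<longlongrightarrow> 0) (at 0)" for s
      using bessel_wave_difference_quotient[OF \<nu> Re[of s]] by (simp add: w_def algebra_simps)
  qed
  then show ?thesis by (simp add: w_def)
qed

text \<open>Unitarity shifts the unknown evolution of \<open>u\<close> onto the Gaussian, whose
  evolution is explicit.\<close>

lemma schroedinger_group_pairing:
  assumes \<nu>: "0 \<le> \<nu>" and p: "0 < Re p"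
    and U: "schroedinger_group half_line (bessel_friedrichs \<nu>) U" and u: "u \<in> l2 half_line"
  shows "l2_inner half_line (U t u) (bessel_wave \<nu> (p + 4 * \<i> * of_real t)) = l2_inner half_line u (bessel_wave \<nu> p)"
proof -
  have ug: "unitary_group half_line U" using U by (simp add: schroedinger_group_def)
  have w: "bessel_wave \<nu> p \<in> l2 half_line" "bessel_wave \<nu> (p + 4 * \<i> * of_real t) \<in> l2 half_line"
    using p by (auto intro: bessel_wave_l2[OF \<nu>])
  have U2: "U t f \<in> l2 half_line" if "f \<in> l2 half_line" for f using ug that by (auto simp: unitary_group_def)
  have "l2_inner half_line (U t u) (U t (bessel_wave \<nu> p)) = l2_inner half_line u (bessel_wave \<nu> p)"
    using ug u w by (auto simp: unitary_group_def)
  moreover have "l2_inner half_line (U t u) (U t (bessel_wave \<nu> p)) = l2_inner half_line (U t u) (bessel_wave \<nu> (p + 4 * \<i> * of_real t))"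
    unfolding l2_inner_def
  proof (rule integral_cong_AE)
    note [measurable] = l2_measurable[OF U2[OF u]] l2_measurable[OF U2[OF w(1)]] l2_measurable[OF w(2)]
    show "(\<lambda>x. U t u x * cnj (U t (bessel_wave \<nu> p) x)) \<in> borel_measurable half_line"
      "(\<lambda>x. U t u x * cnj (bessel_wave \<nu> (p + 4 * \<i> * of_real t) x)) \<in> borel_measurable half_line"
      by measurable
    show "AE x in half_line. U t u x * cnj (U t (bessel_wave \<nu> p) x) = U t u x * cnj (bessel_wave \<nu> (p + 4 * \<i> * of_real t) x)"
      using schroedinger_group_bessel_wave[OF \<nu> p U, of t] by eventually_elim simp
  qed
  ultimately show ?thesis by simp
qed

text \<open>With \<open>\<kappa> = 1 / (4 T)\<close>: multiplication of \<open>U T u\<close> by \<open>exp (- i \<kappa> x\<^sup>2)\<close> turns the parameters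
  \<open>1 / p = \<kappa>\<^sup>2 / m + i \<kappa>\<close> and \<open>1 / (p + 4 i T) = m - i \<kappa>\<close> into the Gaussian moments of the Hankel transform
  of \<open>exp (i \<kappa> y\<^sup>2) u\<close>.\<close>

lemma schroedinger_group_gaussian_moment:
  assumes \<nu>: "0 \<le> \<nu>" and T: "0 < T" and m: "0 < m"
    and U: "schroedinger_group half_line (bessel_friedrichs \<nu>) U" and u: "u \<in> l2 half_line"
  defines "\<kappa> \<equiv> 1 / (4 * T)"
  shows "(LINT x|half_line. exp (- \<i> * of_real (\<kappa> * x\<^sup>2)) * U T u x * of_real (x powr (\<nu> + 1/2) * exp (- m * x\<^sup>2)))
    = exp (- \<i> * of_real (pi / 2 * (\<nu> + 1))) * of_real ((\<kappa> / m) powr (\<nu> + 1)) *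
      (LINT y|half_line. u y * of_real (y powr (\<nu> + 1/2)) * exp (\<i> * of_real (\<kappa> * y\<^sup>2)) * of_real (exp (- (\<kappa>\<^sup>2 / m) * y\<^sup>2)))"
proof -
  define z where "z = Complex m (- \<kappa>)"
  define \<zeta> where "\<zeta> = Complex (\<kappa>\<^sup>2 / m) \<kappa>"
  have \<kappa>: "0 < \<kappa>" using T by (simp add: \<kappa>_def)
  have nz: "z \<noteq> 0" "\<zeta> \<noteq> 0" using \<kappa> by (auto simp: z_def \<zeta>_def complex_eq_iff)
  have nr: "z \<notin> \<real>\<^sub>\<le>\<^sub>0" "\<zeta> \<notin> \<real>\<^sub>\<le>\<^sub>0" using \<kappa> m by (auto simp: z_def \<zeta>_def complex_nonpos_Reals_iff)
  have \<zeta>z: "\<zeta> = of_real (\<kappa> / m) * (\<i> * z)"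
    using m by (simp add: z_def \<zeta>_def complex_eq_iff power2_eq_square)
  have pp: "1 / \<zeta> + 4 * \<i> * of_real T = 1 / z"
  proof -
    have "1 / \<zeta> + 4 * \<i> * of_real T = 1 / \<zeta> + \<i> / of_real \<kappa>" using T by (simp add: \<kappa>_def)
    also have "\<dots> = (of_real \<kappa> + \<i> * \<zeta>) / (\<zeta> * of_real \<kappa>)" using nz \<kappa> by (simp add: field_simps)
    also have "of_real \<kappa> + \<i> * \<zeta> = of_real (\<kappa> / m) * (\<i> * of_real \<kappa>)"
      using m by (simp add: \<zeta>_def complex_eq_iff power2_eq_square)
    also have "of_real (\<kappa> / m) * (\<i> * of_real \<kappa>) / (\<zeta> * of_real \<kappa>) = 1 / z"
      unfolding \<zeta>z using nz \<kappa> m by (simp add: field_simps)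
    finally show ?thesis .
  qed
  have Re\<zeta>: "0 < Re (1 / \<zeta>)" using \<kappa> m by (intro Re_inverse_pos) (simp add: \<zeta>_def)
  have pair: "l2_inner half_line (U T u) (bessel_wave \<nu> (1 / z)) = l2_inner half_line u (bessel_wave \<nu> (1 / \<zeta>))"
    using schroedinger_group_pairing[OF \<nu> Re\<zeta> U u, of T] unfolding pp .
  define s where "s = complex_of_real (\<nu> + 1)"
  have inner: "l2_inner half_line f (bessel_wave \<nu> (1 / q))
      = cnj (exp (s * Ln q)) * (LINT x|half_line. f x * of_real (x powr (\<nu> + 1/2)) * exp (- cnj q * of_real (x\<^sup>2)))"
    if "q \<notin> \<real>\<^sub>\<le>\<^sub>0" for f q
  proof -
    have "Ln (1 / q) = - Ln q" using Ln_inverse[OF that] by (simp add: inverse_eq_divide)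
    then have "exp (- of_real (\<nu> + 1) * Ln (1 / q)) = exp (s * Ln q)"
      by (simp only: s_def minus_mult_minus)
    then have "bessel_wave \<nu> (1 / q) x = exp (s * Ln q) * of_real (x powr (\<nu> + 1/2)) * exp (- q * of_real (x\<^sup>2))" for x
      by (simp only: bessel_wave_def bessel_gaussian_def) simp
    then have "cnj (bessel_wave \<nu> (1 / q) x)
        = cnj (exp (s * Ln q)) * of_real (x powr (\<nu> + 1/2)) * exp (- cnj q * of_real (x\<^sup>2))" for x
      by (simp only: complex_cnj_mult exp_cnj[of "- q * of_real (x\<^sup>2)"] complex_cnj_minus complex_cnj_complex_of_real)
    then have "f x * cnj (bessel_wave \<nu> (1 / q) x)
        = cnj (exp (s * Ln q)) * (f x * of_real (x powr (\<nu> + 1/2)) * exp (- cnj q * of_real (x\<^sup>2)))" for x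
      by (simp only: mult.assoc mult.left_commute)
    then show ?thesis unfolding l2_inner_def by (simp only: integral_mult_right_zero)
  qed
  \<comment> \<open>The branch matters, as \<nu> + 1 need not be an integer. No multiple of 2 pi i
    appears: z lies in the open fourth quadrant, so multiplication by i adds pi / 2 within the
    principal range.\<close>
  have Ln: "Ln \<zeta> = of_real (ln (\<kappa> / m)) + (Ln z + \<i> * of_real pi / 2)"
    unfolding \<zeta>z using \<kappa> m nz Ln_of_real[of "\<kappa> / m"]
    by (subst Ln_times_of_real) (auto simp: Ln_times_ii z_def)
  have "cnj (exp (s * Ln \<zeta>)) = cnj (exp (s * Ln z)) * (exp (- \<i> * of_real (pi / 2 * (\<nu> + 1))) * of_real ((\<kappa> / m) powr (\<nu> + 1)))"
  proof -
    have "s * Ln \<zeta> = s * Ln z + (\<i> * of_real (pi / 2 * (\<nu> + 1)) + of_real ((\<nu> + 1) * ln (\<kappa> / m)))"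
      unfolding Ln s_def by (simp add: algebra_simps)
    then have "exp (s * Ln \<zeta>) = exp (s * Ln z) * (exp (\<i> * of_real (pi / 2 * (\<nu> + 1))) * of_real (exp ((\<nu> + 1) * ln (\<kappa> / m))))"
      by (simp only: exp_add exp_of_real)
    moreover have "exp ((\<nu> + 1) * ln (\<kappa> / m)) = (\<kappa> / m) powr (\<nu> + 1)" using \<kappa> m by (simp add: powr_def)
    moreover have "cnj (exp (\<i> * of_real (pi / 2 * (\<nu> + 1)))) = exp (- \<i> * of_real (pi / 2 * (\<nu> + 1)))"
      by (simp only: exp_cnj complex_cnj_mult complex_cnj_i complex_cnj_complex_of_real)
    ultimately show ?thesis by (simp only: complex_cnj_mult complex_cnj_complex_of_real)
  qed
  moreover have "cnj (exp (s * Ln z)) \<noteq> 0" by simp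
  ultimately have eq: "(LINT x|half_line. U T u x * of_real (x powr (\<nu> + 1/2)) * exp (- cnj z * of_real (x\<^sup>2)))
    = exp (- \<i> * of_real (pi / 2 * (\<nu> + 1))) * of_real ((\<kappa> / m) powr (\<nu> + 1))
      * (LINT x|half_line. u x * of_real (x powr (\<nu> + 1/2)) * exp (- cnj \<zeta> * of_real (x\<^sup>2)))"
    using pair unfolding inner[OF nr(1)] inner[OF nr(2)] by (simp add: mult.assoc)
  have "exp (- cnj z * of_real (x\<^sup>2)) = exp (- \<i> * of_real (\<kappa> * x\<^sup>2)) * of_real (exp (- m * x\<^sup>2))" for x
  proof -
    have "- cnj z * of_real (x\<^sup>2) = - \<i> * of_real (\<kappa> * x\<^sup>2) + of_real (- m * x\<^sup>2)"
      by (simp add: z_def complex_eq_iff)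
    then show ?thesis by (simp only: exp_add exp_of_real)
  qed
  moreover have "exp (- cnj \<zeta> * of_real (x\<^sup>2)) = exp (\<i> * of_real (\<kappa> * x\<^sup>2)) * of_real (exp (- (\<kappa>\<^sup>2 / m) * x\<^sup>2))" for x
  proof -
    have "- cnj \<zeta> * of_real (x\<^sup>2) = \<i> * of_real (\<kappa> * x\<^sup>2) + of_real (- (\<kappa>\<^sup>2 / m) * x\<^sup>2)"
      by (simp add: \<zeta>_def complex_eq_iff)
    then show ?thesis by (simp only: exp_add exp_of_real)
  qed
  ultimately show ?thesis using eq
    by (simp only: of_real_mult mult.assoc mult.left_commute mult.commute)
qed


section \<open>Power series of the solution\<close>


lemma square_power_eq_powr:
  fixes x :: real
  assumes "0 < x"
  shows "(x\<^sup>2) ^ k = x powr (2 * real k)"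
  using powr_realpow[OF assms, of "2 * k"] by (simp add: power_mult)

text \<open>Restrict Euler's integral for Gamma (s + 1) to t \<ge> q, where t^s \<ge> q^s, and
  integrate exp (- t). This is \<open>power_div_fact_le_exp\<close> for real exponents.\<close>

lemma powr_le_exp_mult_Gamma:
  fixes q s :: real
  assumes q: "0 < q" and s: "0 \<le> s"
  shows "q powr s \<le> exp q * Gamma (s + 1)"
proof -
  have f: "((\<lambda>t. t powr s / exp t) has_integral Gamma (s + 1)) {0..}"
    using Gamma_integral_real[of "s + 1"] s by simp
  have g: "((\<lambda>t. if t \<in> {q..} then q powr s * exp (- 1 * t) else 0) has_integral q powr s * (exp (- 1 * q) / 1)) {0..}"
    using q has_integral_mult_right[OF has_integral_exp_minus_to_infinity[of 1 q], of "q powr s"]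
    by (subst has_integral_restrict) auto
  have "q powr s * (exp (- 1 * q) / 1) \<le> Gamma (s + 1)"
    by (rule has_integral_le[OF g f])
      (use q s in \<open>auto simp: exp_minus divide_inverse intro!: mult_right_mono powr_mono2\<close>)
  then show ?thesis by (simp add: exp_minus field_simps)
qed

text \<open>Here the support of the datum enters: Cauchy-Schwarz on [0, N], where the integral of
  y^(2 r) is N^(2 r + 1) / (2 r + 1) and the denominator is at least 1.\<close>

lemma supported_moment:
  assumes u: "u \<in> l2 half_line" and N: "0 < N"
    and supp: "AE x in half_line. x \<notin> {0..N} \<longrightarrow> u x = 0" and r: "0 \<le> r"
  shows "integrable half_line (\<lambda>y. cmod (u y) * y powr r)"
    and "(LINT y|half_line. cmod (u y) * y powr r) \<le> N powr (r + 1/2) * l2_norm half_line u"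
proof -
  define g where "g y = (if y \<in> {0..N} then y powr r else 0)" for y
  have eq: "AE y in half_line. cmod (u y) * y powr r = cmod (u y) * g y"
    using supp by eventually_elim (auto simp: g_def)
  have um: "(\<lambda>y. cmod (u y)) \<in> borel_measurable half_line" using l2_measurable[OF u] by measurable
  have rm: "(\<lambda>y. y powr r) \<in> borel_measurable half_line"
    by (intro half_line_measurable_continuous continuous_intros) auto
  have gm: "g \<in> borel_measurable half_line"
  proof -
    have "g \<in> borel_measurable borel" unfolding g_def by measurable
    then have "g \<in> borel_measurable lebesgue" by (simp add: measurable_completion)
    then show ?thesis by (rule measurable_restrict_space1)
  qed
  have "((\<lambda>y. y powr (2 * r)) has_integral N powr (2 * r + 1) / (2 * r + 1)) {0..N}"
    using r N by (intro has_integral_powr_from_0) auto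
  then have "((\<lambda>y. if y \<in> {0..N} then y powr (2 * r) else 0) has_integral N powr (2 * r + 1) / (2 * r + 1)) {0..}"
    by (subst has_integral_restrict) auto
  then have "has_bochner_integral half_line (\<lambda>y. if y \<in> {0..N} then y powr (2 * r) else 0) (N powr (2 * r + 1) / (2 * r + 1))"
    by (intro half_line_has_integral_nonneg has_integral_open_half_line) auto
  moreover have "(\<lambda>y. if y \<in> {0..N} then y powr (2 * r) else 0) = (\<lambda>y. (g y)\<^sup>2)"
    by (auto simp: g_def fun_eq_iff power2_eq_square simp flip: powr_add)
  ultimately have g2: "has_bochner_integral half_line (\<lambda>y. (g y)\<^sup>2) (N powr (2 * r + 1) / (2 * r + 1))" by simp
  have "integrable half_line (\<lambda>y. cmod (u y) * g y)"
    using g2 um gm l2_integrable[OF u] by (intro real_product_integrable) (auto simp: has_bochner_integral_iff)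
  then show i: "integrable half_line (\<lambda>y. cmod (u y) * y powr r)"
    using integrable_cong_AE[OF _ _ eq] um rm gm by simp
  have "(LINT y|half_line. cmod (u y) * y powr r) = (LINT y|half_line. cmod (u y) * g y)"
    using um rm gm eq by (intro integral_cong_AE) auto
  also have "\<dots> \<le> sqrt (LINT y|half_line. (cmod (u y))\<^sup>2) * sqrt (LINT y|half_line. (g y)\<^sup>2)"
    using g2 um gm l2_integrable[OF u] by (intro integral_mult_le_sqrt) (auto simp: has_bochner_integral_iff)
  also have "\<dots> = l2_norm half_line u * sqrt (N powr (2 * r + 1) / (2 * r + 1))"
    using g2 by (simp add: l2_norm_def has_bochner_integral_iff)
  also have "\<dots> \<le> l2_norm half_line u * N powr (r + 1/2)"
  proof (intro mult_left_mono l2_norm_nonneg)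
    have "N powr (2 * r + 1) / (2 * r + 1) \<le> N powr (2 * r + 1) / 1"
      using r by (intro divide_left_mono) auto
    also have "\<dots> = (N powr (r + 1/2))\<^sup>2"
      by (simp add: power2_eq_square flip: powr_add)
    finally have "sqrt (N powr (2 * r + 1) / (2 * r + 1)) \<le> sqrt ((N powr (r + 1/2))\<^sup>2)"
      by (rule real_sqrt_le_mono)
    then show "sqrt (N powr (2 * r + 1) / (2 * r + 1)) \<le> N powr (r + 1/2)" by simp
  qed
  finally show "(LINT y|half_line. cmod (u y) * y powr r) \<le> N powr (r + 1/2) * l2_norm half_line u"
    by (simp add: mult.commute)
qed

text \<open>Sum and integral are interchanged by summable L^1 bounds, once for the exponential
  series tested against the datum and once for the power series of the solution.\<close>

lemma integral_sums_dominated: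
  fixes f :: "nat \<Rightarrow> 'a \<Rightarrow> complex"
  assumes i: "\<And>k. integrable M (f k)" and B: "\<And>k. (LINT x|M. cmod (f k x)) \<le> B k" "summable B"
    and pt: "\<And>x. x \<in> space M \<Longrightarrow> summable (\<lambda>k. cmod (f k x))"
    and g: "\<And>x. x \<in> space M \<Longrightarrow> (\<Sum>k. f k x) = g x"
  shows "integrable M g" and "(\<lambda>k. LINT x|M. f k x) sums (LINT x|M. g x)"
proof -
  have S: "summable (\<lambda>k. LINT x|M. norm (f k x))"
    by (rule summable_comparison_test'[OF B(2), of 0]) (use B(1) in auto)
  have A: "AE x in M. summable (\<lambda>k. norm (f k x))" using pt by auto
  have "integrable M (\<lambda>x. \<Sum>k. f k x)" by (rule integrable_suminf[OF i A S])
  then show "integrable M g" using g by (subst (asm) Bochner_Integration.integrable_cong[OF refl]) auto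
  have "(\<lambda>k. LINT x|M. f k x) sums (LINT x|M. (\<Sum>k. f k x))" by (rule sums_integral[OF i A S])
  then show "(\<lambda>k. LINT x|M. f k x) sums (LINT x|M. g x)"
    using g by (subst (asm) Bochner_Integration.integral_cong[OF refl]) auto
qed

text \<open>Regroup the powers as Q sqrt x (Q x)^(\<nu> + k) (Q x)^k. The Gamma factor absorbs (Q
  x)^(\<nu> + k) at the cost of exp (Q x), and a term of the exponential series is left. The bound
  does not depend on \<nu>.\<close>

lemma hankel_coefficient_bound:
  fixes Q x \<nu> :: real
  assumes Q: "0 < Q" and x: "0 < x" and \<nu>: "0 \<le> \<nu>"
  shows "Q powr (\<nu> + 1 + 2 * real k) / (fact k * Gamma (\<nu> + 1 + real k)) * (x powr (\<nu> + 1/2) * (x\<^sup>2) ^ k)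
    \<le> Q * sqrt x * exp (Q * x) * ((Q * x) ^ k / fact k)"
proof -
  have G: "0 < Gamma (\<nu> + 1 + real k)" using \<nu> by (intro Gamma_real_pos) auto
  have "Q powr (\<nu> + 1 + 2 * real k) = Q * Q powr (\<nu> + real k) * Q ^ k"
  proof -
    have "Q powr (\<nu> + 1 + 2 * real k) = Q powr (1 + (\<nu> + real k) + real k)" by (simp add: algebra_simps)
    also have "\<dots> = Q * Q powr (\<nu> + real k) * Q ^ k" using Q by (simp only: powr_add powr_realpow powr_one)
    finally show ?thesis .
  qed
  moreover have "x powr (\<nu> + 1/2) * (x\<^sup>2) ^ k = sqrt x * x powr (\<nu> + real k) * x ^ k"
  proof -
    have "(x\<^sup>2) ^ k = x powr real k * x ^ k" using x by (simp add: powr_realpow power2_eq_square power_mult_distrib)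
    then have "x powr (\<nu> + 1/2) * (x\<^sup>2) ^ k = (x powr (1/2) * x powr \<nu> * x powr real k) * x ^ k"
      by (simp add: powr_add)
    then show ?thesis using x by (simp add: powr_half_sqrt powr_add)
  qed
  ultimately have "Q powr (\<nu> + 1 + 2 * real k) / (fact k * Gamma (\<nu> + 1 + real k)) * (x powr (\<nu> + 1/2) * (x\<^sup>2) ^ k)
      = (Q * sqrt x * ((Q * x) ^ k / fact k)) * ((Q * x) powr (\<nu> + real k) / Gamma (\<nu> + 1 + real k))"
    using Q x by (simp add: powr_mult power_mult_distrib)
  also have "\<dots> \<le> (Q * sqrt x * ((Q * x) ^ k / fact k)) * exp (Q * x)"
  proof (rule mult_left_mono)
    have "(Q * x) powr (\<nu> + real k) \<le> exp (Q * x) * Gamma (\<nu> + 1 + real k)"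
      using powr_le_exp_mult_Gamma[of "Q * x" "\<nu> + real k"] Q x \<nu> by (simp add: add.assoc add.commute add.left_commute)
    then show "(Q * x) powr (\<nu> + real k) / Gamma (\<nu> + 1 + real k) \<le> exp (Q * x)" using G by (simp add: divide_le_eq)
  qed (use Q x in auto)
  finally show ?thesis by (simp add: mult.assoc mult.left_commute mult.commute)
qed

text \<open>Expanding exp (- (\<kappa>^2 / m) y^2) writes the Gaussian moments of the solution as a
  series in 1 / m whose coefficients are the moments \<open>\<mu> k\<close> of the datum. Tested
  against x^c exp (- m x^2), the term x^(c + 2 k) gives Gamma (\<nu> + 1 + k) / (2 m^(\<nu> + 1 +
  k)). A power series with the same moments can therefore be written down term by term, and the
  moments determine the function.\<close>

lemma schroedinger_group_series:
  assumes \<nu>: "0 \<le> \<nu>" and T: "0 < T" and N: "0 < N"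
    and U: "schroedinger_group half_line (bessel_friedrichs \<nu>) U" and u: "u \<in> l2 half_line"
    and supp: "AE x in half_line. x \<notin> {0..N} \<longrightarrow> u x = 0"
  defines "\<kappa> \<equiv> 1 / (4 * T)"
  shows "\<exists>a. (\<forall>k. cmod (a k) \<le> 2 * l2_norm half_line u * ((\<kappa> * N) powr (\<nu> + 1 + 2 * real k) / (fact k * Gamma (\<nu> + 1 + real k))))
    \<and> (\<forall>x>0. summable (\<lambda>k. a k * of_real ((x\<^sup>2) ^ k)))
    \<and> (AE x in half_line. exp (- \<i> * of_real (\<kappa> * x\<^sup>2)) * U T u x = of_real (x powr (\<nu> + 1/2)) * (\<Sum>k. a k * of_real ((x\<^sup>2) ^ k)))"
proof -
  have \<kappa>: "0 < \<kappa>" using T by (simp add: \<kappa>_def)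
  define c where "c = \<nu> + 1/2"
  have c: "0 \<le> c" using \<nu> by (simp add: c_def)
  define A where "A = l2_norm half_line u"
  have A: "0 \<le> A" by (simp add: A_def l2_norm_nonneg)
  define \<eta> where "\<eta> = exp (- \<i> * of_real (pi / 2 * (\<nu> + 1)))"
  have \<eta>: "cmod \<eta> = 1" by (simp add: \<eta>_def norm_exp_eq_Re)
  define f where "f y = u y * of_real (y powr c) * exp (\<i> * of_real (\<kappa> * y\<^sup>2))" for y
  define \<mu> where "\<mu> k = (LINT y|half_line. f y * of_real ((y\<^sup>2) ^ k))" for k :: nat
  define G where "G k = Gamma (\<nu> + 1 + real k)" for k
  have G: "0 < G k" for k unfolding G_def using \<nu> by (intro Gamma_real_pos) auto
  \<comment> \<open>Found by equating the coefficients of m^(- (\<nu> + 1 + k)) in the two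
    expansions. These are the coefficients of the Hankel kernel 2 \<kappa> sqrt (x y) J_\<nu>(2
    \<kappa> x y).\<close>
  define \<gamma> where "\<gamma> k = 2 * \<kappa> powr (\<nu> + 1) * (- (\<kappa>\<^sup>2)) ^ k / (fact k * G k)" for k
  define a where "a k = \<eta> * of_real (\<gamma> k) * \<mu> k" for k
  define Q where "Q = \<kappa> * N"
  have Q: "0 < Q" using \<kappa> N by (simp add: Q_def)
  have [measurable]: "u \<in> borel_measurable half_line" by (rule l2_measurable[OF u])
  have [measurable]: "(\<lambda>y. y powr r) \<in> borel_measurable half_line" for r
    by (intro half_line_measurable_continuous continuous_intros) auto
  have fm: "f \<in> borel_measurable half_line"
  proof -
    have [measurable]: "(\<lambda>y. exp (\<i> * complex_of_real (\<kappa> * y\<^sup>2))) \<in> borel_measurable half_line"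
      by (intro half_line_measurable_continuous continuous_intros)
    show ?thesis unfolding f_def by measurable
  qed
  have pm: "(\<lambda>y. complex_of_real (p y)) \<in> borel_measurable half_line" if "continuous_on {0<..} p" for p
    using that by (intro half_line_measurable_continuous continuous_intros)
  have fk: "cmod (f y * of_real ((y\<^sup>2) ^ k)) = cmod (u y) * y powr (c + 2 * real k)" if "y \<in> space half_line" for y k
  proof -
    have y: "0 < y" using that by simp
    have "(y\<^sup>2) ^ k = y powr (2 * real k)" using y by (rule square_power_eq_powr)
    then show ?thesis using y by (simp add: f_def norm_mult norm_power norm_exp_eq_Re powr_add)
  qed
  have fi: "integrable half_line (\<lambda>y. f y * of_real ((y\<^sup>2) ^ k))"
    and fb: "(LINT y|half_line. cmod (f y * of_real ((y\<^sup>2) ^ k))) \<le> N powr (\<nu> + 1 + 2 * real k) * A" for k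
  proof -
    note sm = supported_moment[OF u N supp, of "c + 2 * real k"]
    show "integrable half_line (\<lambda>y. f y * of_real ((y\<^sup>2) ^ k))"
    proof (rule Bochner_Integration.integrable_bound)
      show "integrable half_line (\<lambda>y. cmod (u y) * y powr (c + 2 * real k))" using sm(1) c by simp
      show "(\<lambda>y. f y * of_real ((y\<^sup>2) ^ k)) \<in> borel_measurable half_line"
        by (intro borel_measurable_times fm pm continuous_intros)
      show "AE y in half_line. norm (f y * of_real ((y\<^sup>2) ^ k)) \<le> norm (cmod (u y) * y powr (c + 2 * real k))"
        by (intro AE_I2) (simp only: fk, simp)
    qed
    have "(LINT y|half_line. cmod (f y * of_real ((y\<^sup>2) ^ k))) = (LINT y|half_line. cmod (u y) * y powr (c + 2 * real k))"
      by (intro Bochner_Integration.integral_cong[OF refl] fk)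
    also have "\<dots> \<le> N powr (c + 2 * real k + 1/2) * A" unfolding A_def using sm(2) c by simp
    also have "c + 2 * real k + 1/2 = \<nu> + 1 + 2 * real k" by (simp add: c_def)
    finally show "(LINT y|half_line. cmod (f y * of_real ((y\<^sup>2) ^ k))) \<le> N powr (\<nu> + 1 + 2 * real k) * A" .
  qed
  have \<mu>: "cmod (\<mu> k) \<le> N powr (\<nu> + 1 + 2 * real k) * A" for k
    unfolding \<mu>_def by (rule order_trans[OF integral_norm_bound fb])
  have \<gamma>: "\<bar>\<gamma> k\<bar> = 2 * \<kappa> powr (\<nu> + 1 + 2 * real k) / (fact k * G k)" for k
  proof -
    have "\<kappa> powr (\<nu> + 1 + 2 * real k) = \<kappa> powr (\<nu> + 1) * (\<kappa>\<^sup>2) ^ k"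
    proof -
      have "(\<kappa>\<^sup>2) ^ k = \<kappa> powr (2 * real k)" using \<kappa> by (rule square_power_eq_powr)
      then show ?thesis by (simp add: powr_add)
    qed
    then show ?thesis using G[of k] \<kappa> by (simp add: \<gamma>_def abs_mult power_abs)
  qed
  have ab: "cmod (a k) \<le> 2 * A * (Q powr (\<nu> + 1 + 2 * real k) / (fact k * G k))" for k
  proof -
    have "cmod (a k) = \<bar>\<gamma> k\<bar> * cmod (\<mu> k)" by (simp add: a_def norm_mult \<eta>)
    also have "\<dots> \<le> \<bar>\<gamma> k\<bar> * (N powr (\<nu> + 1 + 2 * real k) * A)" by (intro mult_left_mono \<mu>) auto
    also have "\<dots> = 2 * A * (Q powr (\<nu> + 1 + 2 * real k) / (fact k * G k))"
      unfolding \<gamma> Q_def using \<kappa> N by (simp add: powr_mult)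
    finally show ?thesis .
  qed
  define S where "S x = (\<Sum>k. a k * of_real ((x\<^sup>2) ^ k))" for x
  have moment1: "(\<lambda>k. of_real ((- (\<kappa>\<^sup>2 / m)) ^ k / fact k) * \<mu> k) sums
      (LINT y|half_line. u y * of_real (y powr c) * exp (\<i> * of_real (\<kappa> * y\<^sup>2)) * of_real (exp (- (\<kappa>\<^sup>2 / m) * y\<^sup>2)))"
    if m: "0 < m" for m
  proof -
    define F where "F k y = of_real ((- (\<kappa>\<^sup>2 / m)) ^ k / fact k) * (f y * of_real ((y\<^sup>2) ^ k))" for k y
    have Fe: "F k y = f y * of_real ((- (\<kappa>\<^sup>2 / m) * y\<^sup>2) ^ k /\<^sub>R fact k)" for k y
    proof -
      have "of_real (r ^ k / fact k) * (w * of_real (s ^ k)) = w * of_real ((r * s) ^ k /\<^sub>R fact k)"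
        for r s :: real and w :: complex
        by (simp add: power_mult_distrib divide_inverse)
      then show ?thesis unfolding F_def by (simp only:)
    qed
    have "(\<lambda>k. LINT y|half_line. F k y) sums (LINT y|half_line. f y * of_real (exp (- (\<kappa>\<^sup>2 / m) * y\<^sup>2)))"
    proof (rule integral_sums_dominated(2))
      show "integrable half_line (F k)" for k unfolding F_def by (intro integrable_mult_right fi)
      show "(LINT y|half_line. cmod (F k y)) \<le> (\<kappa>\<^sup>2 / m * N\<^sup>2) ^ k /\<^sub>R fact k * (N powr (\<nu> + 1) * A)" for k
      proof -
        have "(LINT y|half_line. cmod (F k y)) = ((\<kappa>\<^sup>2 / m) ^ k / fact k) * (LINT y|half_line. cmod (f y * of_real ((y\<^sup>2) ^ k)))"
          unfolding F_def norm_mult[of "of_real _"] norm_of_real using m by (simp add: power_abs)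
        also have "\<dots> \<le> ((\<kappa>\<^sup>2 / m) ^ k / fact k) * (N powr (\<nu> + 1 + 2 * real k) * A)"
          using m by (intro mult_left_mono fb) auto
        also have "N powr (\<nu> + 1 + 2 * real k) = N powr (\<nu> + 1) * (N\<^sup>2) ^ k"
        proof -
          have "(N\<^sup>2) ^ k = N powr (2 * real k)" using N by (rule square_power_eq_powr)
          then show ?thesis by (simp add: powr_add)
        qed
        finally show ?thesis by (simp add: power_mult_distrib divide_inverse mult.assoc mult.left_commute mult.commute)
      qed
      show "summable (\<lambda>k. (\<kappa>\<^sup>2 / m * N\<^sup>2) ^ k /\<^sub>R fact k * (N powr (\<nu> + 1) * A))"
        by (intro summable_mult2 summable_exp_generic)
      fix y
      have "summable (\<lambda>k. cmod (f y) * norm ((- (\<kappa>\<^sup>2 / m) * y\<^sup>2) ^ k /\<^sub>R fact k))"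
        by (intro summable_mult summable_norm_exp)
      then show "summable (\<lambda>k. cmod (F k y))" unfolding Fe norm_mult norm_of_real real_norm_def .
      have "(\<lambda>k. (- (\<kappa>\<^sup>2 / m) * y\<^sup>2) ^ k /\<^sub>R fact k) sums exp (- (\<kappa>\<^sup>2 / m) * y\<^sup>2)" by (rule exp_converges)
      then have "(\<lambda>k. F k y) sums (f y * of_real (exp (- (\<kappa>\<^sup>2 / m) * y\<^sup>2)))"
        unfolding Fe by (intro sums_mult sums_of_real)
      then show "(\<Sum>k. F k y) = f y * of_real (exp (- (\<kappa>\<^sup>2 / m) * y\<^sup>2))" by (rule sums_unique[symmetric])
    qed
    then show ?thesis unfolding F_def by (simp add: \<mu>_def f_def)
  qed
  have aS: "summable (\<lambda>k. cmod (a k * of_real ((x\<^sup>2) ^ k)))" if x: "0 < x" for x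
  proof (rule summable_comparison_test'[of _ 0])
    define K where "K = 2 * A * (Q * sqrt x * exp (Q * x)) / x powr c"
    show "summable (\<lambda>k. K * ((Q * x) ^ k /\<^sub>R fact k))" by (intro summable_mult summable_exp_generic)
    fix k
    have "cmod (a k * of_real ((x\<^sup>2) ^ k)) = cmod (a k) * (x\<^sup>2) ^ k" by (simp add: norm_mult norm_power)
    also have "\<dots> \<le> 2 * A * (Q powr (\<nu> + 1 + 2 * real k) / (fact k * G k)) * (x\<^sup>2) ^ k"
      by (intro mult_right_mono ab) auto
    also have "\<dots> = 2 * A / x powr c * (Q powr (\<nu> + 1 + 2 * real k) / (fact k * G k) * (x powr c * (x\<^sup>2) ^ k))"
      using x by simp
    also have "\<dots> \<le> 2 * A / x powr c * (Q * sqrt x * exp (Q * x) * ((Q * x) ^ k / fact k))"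
      unfolding c_def G_def using A x by (intro mult_left_mono hankel_coefficient_bound Q \<nu>) auto
    also have "\<dots> = K * ((Q * x) ^ k /\<^sub>R fact k)" by (simp add: K_def divide_inverse)
    finally show "norm (cmod (a k * of_real ((x\<^sup>2) ^ k))) \<le> K * ((Q * x) ^ k /\<^sub>R fact k)" by simp
  qed
  have moment2: "integrable half_line (\<lambda>x. of_real (x powr c) * S x * of_real (x powr c * exp (- m * x\<^sup>2)))"
      "(\<lambda>k. a k * of_real (G k / (2 * m powr (\<nu> + 1 + real k)))) sums
        (LINT x|half_line. of_real (x powr c) * S x * of_real (x powr c * exp (- m * x\<^sup>2)))"
    if m: "0 < m" for m
  proof -
    define E where "E k x = x powr (2 * \<nu> + 1 + 2 * real k) * exp (- m * x\<^sup>2)" for k x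
    have E: "has_bochner_integral half_line (E k) (G k / (2 * m powr (\<nu> + 1 + real k)))" for k
      using gaussian_moment[of "2 * \<nu> + 1 + 2 * real k" m] m \<nu>
      by (simp add: E_def[abs_def] G_def add_divide_distrib algebra_simps)
    have E0: "0 \<le> E k x" for k x by (simp add: E_def)
    have Ee: "of_real (x powr c) * (a k * of_real ((x\<^sup>2) ^ k)) * of_real (x powr c * exp (- m * x\<^sup>2)) = a k * of_real (E k x)"
      if "0 < x" for k x
    proof -
      have "x powr (2 * \<nu> + 1 + 2 * real k) = x powr (c + c + 2 * real k)" by (simp add: c_def algebra_simps)
      also have "\<dots> = x powr c * x powr c * (x\<^sup>2) ^ k"
      proof -
        have "(x\<^sup>2) ^ k = x powr (2 * real k)" using that by (rule square_power_eq_powr)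
        then show ?thesis by (simp only: powr_add)
      qed
      finally show ?thesis by (simp add: E_def mult.assoc mult.left_commute mult.commute)
    qed
    define D where "D k = a k * of_real (G k / (2 * m powr (\<nu> + 1 + real k)))" for k
    have int: "(LINT x|half_line. a k * of_real (E k x)) = D k" for k
      using has_bochner_integral_of_real[OF E[of k], where 'a = complex] by (simp add: has_bochner_integral_iff D_def)
    have i: "integrable half_line (\<lambda>x. a k * complex_of_real (E k x))" for k
      using E[of k] by (intro integrable_mult_right integrable_of_real) (simp add: has_bochner_integral_iff)
    have b: "(LINT x|half_line. cmod (a k * complex_of_real (E k x))) \<le> (Q\<^sup>2 / m) ^ k /\<^sub>R fact k * (A * (Q powr (\<nu> + 1) / m powr (\<nu> + 1)))" for k
    proof -
      have "(LINT x|half_line. cmod (a k * complex_of_real (E k x))) = cmod (a k) * (G k / (2 * m powr (\<nu> + 1 + real k)))"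
        using E[of k] E0[of k] by (simp add: norm_mult has_bochner_integral_iff)
      also have "\<dots> \<le> (2 * A * (Q powr (\<nu> + 1 + 2 * real k) / (fact k * G k))) * (G k / (2 * m powr (\<nu> + 1 + real k)))"
        using G[of k] by (intro mult_right_mono ab) auto
      also have "\<dots> = A * Q powr (\<nu> + 1 + 2 * real k) / (fact k * m powr (\<nu> + 1 + real k))"
        using G[of k] by simp
      also have "Q powr (\<nu> + 1 + 2 * real k) = Q powr (\<nu> + 1) * (Q\<^sup>2) ^ k"
      proof -
        have "(Q\<^sup>2) ^ k = Q powr (2 * real k)" using Q by (rule square_power_eq_powr)
        then show ?thesis by (simp add: powr_add)
      qed
      also have "m powr (\<nu> + 1 + real k) = m powr (\<nu> + 1) * m ^ k" using m by (simp add: powr_add powr_realpow)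
      also have "A * (Q powr (\<nu> + 1) * (Q\<^sup>2) ^ k) / (fact k * (m powr (\<nu> + 1) * m ^ k))
          = (Q\<^sup>2 / m) ^ k /\<^sub>R fact k * (A * (Q powr (\<nu> + 1) / m powr (\<nu> + 1)))"
      proof -
        have "B * (X * q) / (f * (Y * w)) = inverse f * (q / w) * (B * (X / Y))" for B X q f Y w :: real
          by (simp add: divide_inverse)
        then show ?thesis by (simp only: power_divide real_scaleR_def)
      qed
      finally show ?thesis .
    qed
    have sB: "summable (\<lambda>k. (Q\<^sup>2 / m) ^ k /\<^sub>R fact k * (A * (Q powr (\<nu> + 1) / m powr (\<nu> + 1))))"
      by (intro summable_mult2 summable_exp_generic)
    have sp: "summable (\<lambda>k. cmod (a k * complex_of_real (E k x)))" if "x \<in> space half_line" for x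
    proof -
      have x: "0 < x" using that by simp
      have "summable (\<lambda>k. (x powr c * x powr c * exp (- m * x\<^sup>2)) * cmod (a k * of_real ((x\<^sup>2) ^ k)))"
        by (intro summable_mult aS x)
      then show ?thesis by (simp add: Ee[OF x, symmetric] norm_mult mult.assoc mult.left_commute mult.commute)
    qed
    have se: "(\<Sum>k. a k * complex_of_real (E k x)) = of_real (x powr c) * S x * of_real (x powr c * exp (- m * x\<^sup>2))"
      if "x \<in> space half_line" for x
    proof -
      have x: "0 < x" using that by simp
      have "summable (\<lambda>k. a k * of_real ((x\<^sup>2) ^ k))" by (rule summable_norm_cancel[OF aS[OF x]])
      then have "(\<lambda>k. a k * of_real ((x\<^sup>2) ^ k)) sums S x" unfolding S_def by (rule summable_sums)
      then have "(\<lambda>k. of_real (x powr c) * (a k * of_real ((x\<^sup>2) ^ k)) * of_real (x powr c * exp (- m * x\<^sup>2)))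
          sums (of_real (x powr c) * S x * of_real (x powr c * exp (- m * x\<^sup>2)))"
        by (intro sums_mult sums_mult2)
      then show ?thesis unfolding Ee[OF x] by (rule sums_unique[symmetric])
    qed
    show "integrable half_line (\<lambda>x. of_real (x powr c) * S x * of_real (x powr c * exp (- m * x\<^sup>2)))"
      by (rule integral_sums_dominated(1)[OF i b sB sp se])
    have "(\<lambda>k. LINT x|half_line. a k * complex_of_real (E k x)) sums
        (LINT x|half_line. of_real (x powr c) * S x * of_real (x powr c * exp (- m * x\<^sup>2)))"
      by (rule integral_sums_dominated(2)[OF i b sB sp se])
    then show "(\<lambda>k. a k * of_real (G k / (2 * m powr (\<nu> + 1 + real k)))) sums
        (LINT x|half_line. of_real (x powr c) * S x * of_real (x powr c * exp (- m * x\<^sup>2)))"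
      unfolding int D_def .
  qed
  define v where "v x = exp (- \<i> * of_real (\<kappa> * x\<^sup>2)) * U T u x" for x
  have v2: "v \<in> l2 half_line"
  proof -
    have "U T u \<in> l2 half_line" using U u by (auto simp: schroedinger_group_def unitary_group_def)
    moreover have "v \<in> borel_measurable half_line"
    proof -
      have "(\<lambda>x. exp (- \<i> * complex_of_real (\<kappa> * x\<^sup>2))) \<in> borel_measurable half_line"
        by (intro half_line_measurable_continuous continuous_intros)
      then show ?thesis unfolding v_def using l2_measurable[OF \<open>U T u \<in> l2 half_line\<close>] by (rule borel_measurable_times)
    qed
    ultimately show ?thesis
      by (intro l2_dominated[of v half_line "U T u"]) (auto simp: v_def norm_mult norm_exp_eq_Re)
  qed
  have moment: "(LINT x|half_line. v x * of_real (x powr c * exp (- m * x\<^sup>2)))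
      = (LINT x|half_line. of_real (x powr c) * S x * of_real (x powr c * exp (- m * x\<^sup>2)))" if m: "0 < m" for m
  proof -
    define I where "I = (LINT y|half_line. u y * of_real (y powr c) * exp (\<i> * of_real (\<kappa> * y\<^sup>2)) * of_real (exp (- (\<kappa>\<^sup>2 / m) * y\<^sup>2)))"
    have "(LINT x|half_line. v x * of_real (x powr c * exp (- m * x\<^sup>2))) = \<eta> * of_real ((\<kappa> / m) powr (\<nu> + 1)) * I"
      unfolding v_def c_def \<eta>_def I_def \<kappa>_def by (rule schroedinger_group_gaussian_moment[OF \<nu> T m U u])
    moreover have "(\<lambda>k. \<eta> * of_real ((\<kappa> / m) powr (\<nu> + 1)) * (of_real ((- (\<kappa>\<^sup>2 / m)) ^ k / fact k) * \<mu> k)) sums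
        (\<eta> * of_real ((\<kappa> / m) powr (\<nu> + 1)) * I)"
      unfolding I_def by (intro sums_mult moment1 m)
    moreover have "\<eta> * of_real ((\<kappa> / m) powr (\<nu> + 1)) * (of_real ((- (\<kappa>\<^sup>2 / m)) ^ k / fact k) * \<mu> k)
        = a k * of_real (G k / (2 * m powr (\<nu> + 1 + real k)))" for k
    proof -
      have "\<gamma> k * (G k / (2 * m powr (\<nu> + 1 + real k))) = (\<kappa> / m) powr (\<nu> + 1) * ((- (\<kappa>\<^sup>2 / m)) ^ k / fact k)"
      proof -
        have "m powr (\<nu> + 1 + real k) = m powr (\<nu> + 1) * m ^ k" using m by (simp add: powr_add powr_realpow)
        moreover have "(- (\<kappa>\<^sup>2 / m)) ^ k = (- (\<kappa>\<^sup>2)) ^ k / m ^ k" by (simp flip: power_divide)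
        moreover have "(\<kappa> / m) powr (\<nu> + 1) = \<kappa> powr (\<nu> + 1) / m powr (\<nu> + 1)" using \<kappa> m by (simp add: powr_divide)
        ultimately show ?thesis using G[of k] by (simp add: \<gamma>_def)
      qed
      then have "of_real (\<gamma> k) * of_real (G k / (2 * m powr (\<nu> + 1 + real k)))
          = complex_of_real ((\<kappa> / m) powr (\<nu> + 1)) * of_real ((- (\<kappa>\<^sup>2 / m)) ^ k / fact k)"
        by (simp only: of_real_mult[symmetric])
      then show ?thesis unfolding a_def by (simp only: mult.assoc mult.left_commute mult.commute)
    qed
    ultimately show ?thesis using moment2(2)[OF m] by (simp only: sums_unique2)
  qed
  \<comment> \<open>Including the weight for m = 1 makes \<open>h\<close> integrable, and
    multiplication by exp (- x^2)^j then leads to the moment identity at m = 1 + j.\<close>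
  define h where "h x = (v x - of_real (x powr c) * S x) * of_real (x powr c * exp (- 1 * x\<^sup>2))" for x
  have vi: "integrable half_line (\<lambda>x. v x * of_real (x powr c * exp (- m * x\<^sup>2)))" if m: "0 < m" for m
  proof -
    have "bessel_gaussian \<nu> 1 (of_real m) \<in> l2 half_line" using m by (intro bessel_gaussian_l2 \<nu>) simp
    from l2_product_integrable[OF v2 this]
    have "integrable half_line (\<lambda>x. v x * cnj (bessel_gaussian \<nu> 1 (of_real m) x))" .
    moreover have "cnj (bessel_gaussian \<nu> 1 (of_real m) x) = of_real (x powr c * exp (- m * x\<^sup>2))" for x
    proof -
      have "bessel_gaussian \<nu> 1 (of_real m) x = of_real (x powr c * exp (- m * x\<^sup>2))"
        unfolding bessel_gaussian_def c_def of_real_mult exp_of_real[symmetric] by simp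
      then show ?thesis by (simp only: complex_cnj_complex_of_real)
    qed
    ultimately show ?thesis by simp
  qed
  have "AE x in half_line. h x = 0"
  proof (rule gaussian_moments_unique)
    have "integrable half_line (\<lambda>x. v x * of_real (x powr c * exp (- 1 * x\<^sup>2))
        - of_real (x powr c) * S x * of_real (x powr c * exp (- 1 * x\<^sup>2)))"
      by (rule Bochner_Integration.integrable_diff[OF vi moment2(1)]) auto
    then show "integrable half_line h" unfolding h_def[abs_def] left_diff_distrib .
    fix j :: nat
    define m where "m = 1 + real j"
    have m: "0 < m" by (simp add: m_def)
    have "h x * of_real (exp (- x\<^sup>2) ^ j) = v x * of_real (x powr c * exp (- m * x\<^sup>2))
        - of_real (x powr c) * S x * of_real (x powr c * exp (- m * x\<^sup>2))" for x
    proof -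
      have "exp (- 1 * x\<^sup>2) * exp (- x\<^sup>2) ^ j = exp (- m * x\<^sup>2)"
        by (simp add: m_def exp_of_nat_mult[symmetric] exp_add[symmetric] algebra_simps)
      then have "of_real (x powr c * exp (- 1 * x\<^sup>2)) * of_real (exp (- x\<^sup>2) ^ j) = complex_of_real (x powr c * exp (- m * x\<^sup>2))"
        by (simp only: of_real_mult[symmetric] mult.assoc)
      then show ?thesis unfolding h_def mult.assoc[of "_ - _"] by (simp only: left_diff_distrib)
    qed
    then show "(LINT x|half_line. h x * of_real (exp (- x\<^sup>2) ^ j)) = 0"
      using moment[OF m] vi[OF m] moment2(1)[OF m] by simp
  qed
  then have "AE x in half_line. v x = of_real (x powr c) * S x"
    using AE_space by eventually_elim (auto simp: h_def)
  moreover have "\<forall>x>0. summable (\<lambda>k. a k * of_real ((x\<^sup>2) ^ k))"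
    using summable_norm_cancel[OF aS] by blast
  ultimately show ?thesis
    using ab unfolding v_def S_def c_def A_def Q_def G_def by blast
qed


section \<open>The observability estimate\<close>


text \<open>For j \<ge> n and B \<ge> 1 one has q^j \<le> (B q)^j / B^n: summing the exponential
  series at B q instead of q gains B^n on the tail and costs exp (B q). The other factor exp q comes
  from \<open>hankel_coefficient_bound\<close>. \<open>B\<close> stays free so that it can be
  matched with the interpolation loss.\<close>

lemma hankel_series_tail_bound:
  fixes a :: "nat \<Rightarrow> complex"
  assumes \<nu>: "0 \<le> \<nu>" and Q: "0 < Q" and A: "0 \<le> A" and B: "1 \<le> B" and x: "0 < x" "x \<le> d"
    and a: "\<And>k. cmod (a k) \<le> 2 * A * (Q powr (\<nu> + 1 + 2 * real k) / (fact k * Gamma (\<nu> + 1 + real k)))"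
  shows "cmod (of_real (x powr (\<nu> + 1/2)) * (\<Sum>k. a (k + n) * of_real ((x\<^sup>2) ^ (k + n))))
    \<le> 2 * A * Q * sqrt d * exp ((1 + B) * (Q * d)) / B ^ n"
proof -
  define q where "q = Q * d"
  have q: "0 < q" "Q * x \<le> q" using Q x by (auto simp: q_def)
  define D where "D = 2 * A * Q * sqrt d * exp q / B ^ n"
  have D: "0 \<le> D" using A Q B x by (simp add: D_def)
  define g where "g k = (B * q) ^ k /\<^sub>R fact k" for k :: nat
  have sg: "summable g" "suminf g = exp (B * q)"
    unfolding g_def by (rule summable_exp_generic) (simp add: exp_def)
  have g0: "0 \<le> g k" for k using B q by (simp add: g_def)
  define f where "f k = a (k + n) * complex_of_real ((x\<^sup>2) ^ (k + n))" for k
  have le: "x powr (\<nu> + 1/2) * cmod (f k) \<le> D * g (k + n)" for k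
  proof -
    define j where "j = k + n"
    have "x powr (\<nu> + 1/2) * cmod (f k) = cmod (a j) * (x powr (\<nu> + 1/2) * (x\<^sup>2) ^ j)"
      by (simp add: f_def j_def norm_mult norm_power)
    also have "\<dots> \<le> 2 * A * (Q powr (\<nu> + 1 + 2 * real j) / (fact j * Gamma (\<nu> + 1 + real j))) * (x powr (\<nu> + 1/2) * (x\<^sup>2) ^ j)"
      by (intro mult_right_mono a) auto
    also have "\<dots> \<le> 2 * A * (Q * sqrt x * exp (Q * x) * ((Q * x) ^ j / fact j))"
      unfolding mult.assoc[of "2 * A"] using A by (intro mult_left_mono hankel_coefficient_bound Q x \<nu>) auto
    also have "\<dots> \<le> 2 * A * (Q * sqrt d * exp q * (q ^ j / fact j))"
      using A Q x q by (intro mult_left_mono mult_mono divide_right_mono power_mono) auto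
    also have "q ^ j / fact j \<le> g j / B ^ n"
    proof -
      have "q ^ j * B ^ n \<le> q ^ j * B ^ j" using B q by (intro mult_left_mono power_increasing) (auto simp: j_def)
      then have "q ^ j \<le> (B * q) ^ j / B ^ n" using B by (simp add: pos_le_divide_eq power_mult_distrib mult.commute)
      then have "q ^ j / fact j \<le> ((B * q) ^ j / B ^ n) / fact j" by (rule divide_right_mono) simp
      then show ?thesis by (simp add: g_def divide_inverse mult.commute mult.left_commute)
    qed
    then have "2 * A * (Q * sqrt d * exp q * (q ^ j / fact j)) \<le> 2 * A * (Q * sqrt d * exp q * (g j / B ^ n))"
      using A Q x by (intro mult_left_mono) auto
    finally show ?thesis by (simp add: D_def j_def mult.assoc)
  qed
  have "cmod (of_real (x powr (\<nu> + 1/2)) * (\<Sum>k. f k)) = cmod (\<Sum>k. of_real (x powr (\<nu> + 1/2)) * f k)"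
  proof -
    have "summable (\<lambda>k. D * g (k + n))" using sg(1) by (intro summable_mult summable_ignore_initial_segment)
    then have "summable (\<lambda>k. of_real (x powr (\<nu> + 1/2)) * f k)"
      by (rule summable_comparison_test'[where N = 0]) (use le in \<open>simp add: norm_mult\<close>)
    then have "summable f" using x by (subst (asm) summable_cmult_iff) auto
    then show ?thesis by (simp add: suminf_mult)
  qed
  also have "\<dots> \<le> (\<Sum>k. D * g (k + n))"
    using sg(1) le by (intro norm_suminf_le summable_mult summable_ignore_initial_segment) (auto simp: norm_mult)
  also have "\<dots> = D * (\<Sum>k. g (k + n))"
    using sg(1) by (intro suminf_mult summable_ignore_initial_segment)
  also have "\<dots> \<le> D * exp (B * q)"
    using suminf_split_initial_segment[OF sg(1), of n] sum_nonneg[of "{..<n}" g] g0 sg(2) D by (intro mult_left_mono) auto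
  also have "\<dots> = 2 * A * Q * sqrt d * exp ((1 + B) * (Q * d)) / B ^ n"
    by (simp add: D_def q_def distrib_right exp_add)
  finally show ?thesis unfolding f_def .
qed

lemma half_line_constant_on_interval:
  assumes "0 \<le> c" "c \<le> d" "0 \<le> K"
  shows "has_bochner_integral half_line (\<lambda>x. if x \<in> {c..d} then K else 0) (K * (d - c))"
proof -
  have "((\<lambda>x. K) has_integral K * (d - c)) {c..d}"
    using has_integral_const_real[of K c d] assms by (simp add: mult.commute)
  then have "((\<lambda>x. if x \<in> {c..d} then K else 0) has_integral K * (d - c)) {0..}"
    using assms by (subst has_integral_restrict) auto
  then show ?thesis using assms by (intro half_line_has_integral_nonneg has_integral_open_half_line) auto
qed

text \<open>On [b, 2 b], which up to its end point b lies outside [0, b], f has the modulus of the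
  polynomial part plus \<open>R\<close>. Interpolation carries the mass of the polynomial part back
  to [0, b], where it controls f again up to \<open>R\<close>. The two squared triangle inequalities
  produce the factor 4 and the multiples of b \<rho>.\<close>

lemma mass_inside_le_mass_outside:
  fixes f R :: "real \<Rightarrow> complex" and a :: "nat \<Rightarrow> complex"
  assumes f: "f \<in> l2 half_line" and b: "0 < b" and n: "0 < n" and c: "0 \<le> c" and \<rho>: "0 \<le> \<rho>"
    and R: "\<And>x. 0 < x \<Longrightarrow> x \<le> 2 * b \<Longrightarrow> (cmod (R x))\<^sup>2 \<le> \<rho>"
    and eq: "AE x in half_line. cmod (f x) = cmod (of_real (x powr c) * (\<Sum>k<n. a k * of_real (x\<^sup>2) ^ k) + R x)"
  shows "(LINT x|half_line. (cmod (f x))\<^sup>2)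
    \<le> (4 * exp (8 * real n) + 1) * (LINT x|half_line. (if x \<le> b then 0 else (cmod (f x))\<^sup>2)) + (4 * exp (8 * real n) + 2) * (b * \<rho>)"
proof -
  define M where "M = exp (8 * real n)"
  have M: "0 < M" by (simp add: M_def)
  define q where "q s = (\<Sum>k<n. a k * of_real s ^ k)" for s
  define P where "P x = of_real (x powr c) * q (x\<^sup>2)" for x
  define J where "J = integral {b..2 * b} (\<lambda>y. (cmod (P y))\<^sup>2)"
  have contP: "continuous_on {b..2 * b} (\<lambda>y. (cmod (P y))\<^sup>2)"
    unfolding P_def q_def using b by (intro continuous_intros) auto
  have J0: "0 \<le> J" unfolding J_def by (intro integral_nonneg integrable_continuous_interval contP) auto
  have Pin: "(cmod (P x))\<^sup>2 \<le> M / b * J" if x: "0 < x" "x \<le> b" for x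
  proof -
    have "(cmod (q (x\<^sup>2)))\<^sup>2 \<le> M / b * integral {b..2 * b} (\<lambda>y. (cmod (q (y\<^sup>2)))\<^sup>2)"
      unfolding M_def q_def using even_polynomial_le_integral[OF b n, of x a] x by simp
    then have "(x powr c)\<^sup>2 * (cmod (q (x\<^sup>2)))\<^sup>2 \<le> (x powr c)\<^sup>2 * (M / b * integral {b..2 * b} (\<lambda>y. (cmod (q (y\<^sup>2)))\<^sup>2))"
      by (intro mult_left_mono) auto
    also have "\<dots> = M / b * integral {b..2 * b} (\<lambda>y. (x powr c)\<^sup>2 * (cmod (q (y\<^sup>2)))\<^sup>2)"
      by (simp add: mult.left_commute)
    also have "integral {b..2 * b} (\<lambda>y. (x powr c)\<^sup>2 * (cmod (q (y\<^sup>2)))\<^sup>2) \<le> J"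
      unfolding J_def
    proof (rule integral_le)
      show "(\<lambda>y. (x powr c)\<^sup>2 * (cmod (q (y\<^sup>2)))\<^sup>2) integrable_on {b..2 * b}"
        unfolding q_def by (intro integrable_continuous_interval continuous_intros)
      show "(\<lambda>y. (cmod (P y))\<^sup>2) integrable_on {b..2 * b}" by (intro integrable_continuous_interval contP)
      fix y assume "y \<in> {b..2 * b}"
      \<comment> \<open>The factor x^c is in general no polynomial, but it is increasing, so it
        costs nothing when mass moves from y \<ge> b to x \<le> b.\<close>
      then have "(x powr c)\<^sup>2 \<le> (y powr c)\<^sup>2" using x c by (intro power_mono powr_mono2) auto
      then show "(x powr c)\<^sup>2 * (cmod (q (y\<^sup>2)))\<^sup>2 \<le> (cmod (P y))\<^sup>2"
        by (simp add: P_def norm_mult power_mult_distrib mult_right_mono)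
    qed
    finally show ?thesis using M b by (simp add: P_def norm_mult power_mult_distrib mult_left_mono divide_right_mono)
  qed
  have fi: "integrable half_line (\<lambda>x. (cmod (f x))\<^sup>2)" by (rule l2_integrable[OF f])
  define fin where "fin x = (if x \<le> b then (cmod (f x))\<^sup>2 else 0)" for x
  define fout where "fout x = (if x \<le> b then 0 else (cmod (f x))\<^sup>2)" for x
  have [measurable]: "f \<in> borel_measurable half_line" by (rule l2_measurable[OF f])
  have [measurable]: "(\<lambda>x. x) \<in> borel_measurable half_line"
    by (intro half_line_measurable_continuous continuous_intros)
  have fin: "integrable half_line fin"
    by (rule Bochner_Integration.integrable_bound[OF fi]) (unfold fin_def, measurable, use b in auto)
  have fout: "integrable half_line fout"
    by (rule Bochner_Integration.integrable_bound[OF fi]) (unfold fout_def, measurable, use b in auto)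
  have split: "(LINT x|half_line. (cmod (f x))\<^sup>2) = (LINT x|half_line. fin x) + (LINT x|half_line. fout x)"
    unfolding Bochner_Integration.integral_add[OF fin fout, symmetric]
    by (intro Bochner_Integration.integral_cong) (auto simp: fin_def fout_def)
  have sq: "(cmod (u + w))\<^sup>2 \<le> 2 * (cmod u)\<^sup>2 + 2 * (cmod w)\<^sup>2" for u w
    using cmod_add_square_le[of 1 u w] by simp
  have PR: "AE x in half_line. cmod (f x) = cmod (P x + R x)" using eq by (simp add: P_def q_def)
  have Jle: "J \<le> 2 * (LINT x|half_line. fout x) + 2 * \<rho> * b"
  proof -
    have "((\<lambda>y. (cmod (P y))\<^sup>2) has_integral J) {b..2 * b}"
      unfolding J_def by (intro integrable_integral integrable_continuous_interval contP)
    then have "((\<lambda>y. if y \<in> {b..2 * b} then (cmod (P y))\<^sup>2 else 0) has_integral J) {0<..}"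
      using b by (subst has_integral_restrict) auto
    then have PJ: "has_bochner_integral half_line (\<lambda>y. if y \<in> {b..2 * b} then (cmod (P y))\<^sup>2 else 0) J"
      by (rule half_line_has_integral_nonneg) auto
    have K: "has_bochner_integral half_line (\<lambda>x. if x \<in> {b..2 * b} then 2 * \<rho> else 0) (2 * \<rho> * (2 * b - b))"
      using b \<rho> by (intro half_line_constant_on_interval) auto
    have "J = (LINT y|half_line. (if y \<in> {b..2 * b} then (cmod (P y))\<^sup>2 else 0))"
      using PJ by (simp add: has_bochner_integral_iff)
    also have "\<dots> \<le> (LINT y|half_line. 2 * fout y + (if y \<in> {b..2 * b} then 2 * \<rho> else 0))"
    proof (rule integral_mono_AE)
      show "integrable half_line (\<lambda>y. if y \<in> {b..2 * b} then (cmod (P y))\<^sup>2 else 0)"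
        using PJ by (simp add: has_bochner_integral_iff)
      show "integrable half_line (\<lambda>y. 2 * fout y + (if y \<in> {b..2 * b} then 2 * \<rho> else 0))"
        using K fout by (simp add: has_bochner_integral_iff)
      \<comment> \<open>At y = b the left side may be positive while \<open>fout\<close> is 0, so
        this null set is removed.\<close>
      have "AE y in lebesgue. y \<notin> {b}" by (intro AE_not_in) auto
      then have "AE y in half_line. y \<noteq> b" unfolding half_line_AE_iff by (elim eventually_mono) auto
      then show "AE y in half_line. (if y \<in> {b..2 * b} then (cmod (P y))\<^sup>2 else 0) \<le> 2 * fout y + (if y \<in> {b..2 * b} then 2 * \<rho> else 0)"
        using PR
      proof eventually_elim
        fix y assume y: "y \<noteq> b" "cmod (f y) = cmod (P y + R y)"
        show "(if y \<in> {b..2 * b} then (cmod (P y))\<^sup>2 else 0) \<le> 2 * fout y + (if y \<in> {b..2 * b} then 2 * \<rho> else 0)"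
        proof (cases "y \<in> {b..2 * b}")
          case True
          have "(cmod (P y))\<^sup>2 \<le> 2 * (cmod (P y + R y))\<^sup>2 + 2 * (cmod (R y))\<^sup>2"
            using sq[of "P y + R y" "- R y"] by simp
          also have "\<dots> \<le> 2 * (cmod (P y + R y))\<^sup>2 + 2 * \<rho>" using R[of y] True b by simp
          also have "(cmod (P y + R y))\<^sup>2 = fout y" using y True by (simp add: fout_def)
          finally show ?thesis using True by simp
        next
          case False
          show ?thesis unfolding if_not_P[OF False] by (simp add: fout_def)
        qed
      qed
    qed
    also have "\<dots> = 2 * (LINT x|half_line. fout x) + 2 * \<rho> * (2 * b - b)"
      using K fout by (simp add: has_bochner_integral_iff)
    finally show ?thesis by simp
  qed
  have "(LINT x|half_line. fin x) \<le> (LINT x|half_line. (if x \<in> {0..b} then 2 * (M / b * J) + 2 * \<rho> else 0))"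
  proof (rule integral_mono_AE[OF fin])
    have nn: "0 \<le> 2 * (M / b * J) + 2 * \<rho>" using M b J0 \<rho> by simp
    show "integrable half_line (\<lambda>x. if x \<in> {0..b} then 2 * (M / b * J) + 2 * \<rho> else 0)"
      using half_line_constant_on_interval[of 0 b, OF _ _ nn] b unfolding has_bochner_integral_iff by simp
    show "AE x in half_line. fin x \<le> (if x \<in> {0..b} then 2 * (M / b * J) + 2 * \<rho> else 0)"
      using PR AE_space
    proof eventually_elim
      fix x assume x: "cmod (f x) = cmod (P x + R x)" "x \<in> space half_line"
      show "fin x \<le> (if x \<in> {0..b} then 2 * (M / b * J) + 2 * \<rho> else 0)"
      proof (cases "x \<le> b")
        case True
        have "fin x \<le> 2 * (cmod (P x))\<^sup>2 + 2 * (cmod (R x))\<^sup>2" using True x sq[of "P x" "R x"] by (simp add: fin_def)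
        also have "\<dots> \<le> 2 * (M / b * J) + 2 * \<rho>"
          using Pin[of x] R[of x] True x b by (intro add_mono mult_left_mono) auto
        finally show ?thesis using True x by simp
      qed (simp add: fin_def)
    qed
  qed
  also have "\<dots> = (2 * (M / b * J) + 2 * \<rho>) * (b - 0)"
    using half_line_constant_on_interval[of 0 b "2 * (M / b * J) + 2 * \<rho>"] b M J0 \<rho>
    by (intro has_bochner_integral_integral_eq) auto
  also have "\<dots> = 2 * M * J + 2 * \<rho> * b" using b by (simp add: distrib_right)
  also have "\<dots> \<le> 2 * M * (2 * (LINT x|half_line. fout x) + 2 * \<rho> * b) + 2 * \<rho> * b"
    using Jle M by (intro add_right_mono mult_left_mono) auto
  finally have "(LINT x|half_line. fin x) \<le> 4 * M * (LINT x|half_line. fout x) + (4 * M + 2) * (b * \<rho>)"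
    by (simp add: algebra_simps)
  then show ?thesis unfolding split M_def[symmetric] fout_def[symmetric] by (simp add: algebra_simps)
qed

lemma exp_neg_6_le: "exp (- 6 :: real) \<le> 1 / 64"
proof -
  have "(4::real) ^ 3 \<le> exp 2 ^ 3" using four_le_exp_2 by (intro power_mono) auto
  also have "\<dots> = exp 6" by (simp add: exp_of_nat_mult[symmetric])
  finally show ?thesis by (simp add: exp_minus field_simps)
qed

lemma outside_integral_eq:
  assumes "0 < b"
  shows "(LINT x:({0<..} - {0..b})|lebesgue. (cmod (f x))\<^sup>2)
    = (LINT x|half_line. (if x \<le> b then 0 else (cmod (f x))\<^sup>2))"
proof -
  have "(LINT x|half_line. (if x \<le> b then 0 else (cmod (f x))\<^sup>2))
      = (LINT x|lebesgue. (if x \<in> {0<..} then (if x \<le> b then 0 else (cmod (f x))\<^sup>2) else 0))"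
    by (rule Lebesgue_Measure.integral_restrict_UNIV[symmetric]) simp
  also have "\<dots> = (LINT x:({0<..} - {0..b})|lebesgue. (cmod (f x))\<^sup>2)"
    unfolding set_lebesgue_integral_def using assms
    by (intro Bochner_Integration.integral_cong) (auto simp: indicator_def)
  finally show ?thesis by simp
qed

theorem theorem1p4:
  fixes \<nu> :: real
  assumes "0 \<le> \<nu>"
  shows "\<exists>C>0. \<forall>b>0. \<forall>T>0. \<forall>N>0. \<forall>U. \<forall>u\<^sub>0\<in>l2 half_line.
    schroedinger_group half_line (bessel_friedrichs \<nu>) U \<longrightarrow>
    (AE x in half_line. x \<notin> {0..N} \<longrightarrow> u\<^sub>0 x = 0) \<longrightarrow>
    (LINT x|half_line. (cmod (u\<^sub>0 x))\<^sup>2)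
      \<le> exp (C * (1 + b * N / T)) * (LINT x:({0<..} - {0..b})|lebesgue. (cmod (U T u\<^sub>0 x))\<^sup>2)"
proof -
  \<comment> \<open>\<open>B ^ n\<close> enters squared, so the remainder gains exp (- 16 n), twice
    the exponent of the interpolation loss exp (8 n).\<close>
  define B where "B = exp (8::real)"
  have B: "1 \<le> B" by (simp add: B_def)
  \<comment> \<open>The final factor is at most exp (8 n + 4). With n \<le> (4 + 2 B) q + 5 and q =
    b N / (2 T) this gives 44 = 8 * 5 + 4 and 8 q = 4 b N / T. The value is the same for all \<nu>,
    as the coefficient bound is uniform in \<nu>.\<close>
  define C where "C = 44 + 4 * (4 + 2 * B)"
  have "(LINT x|half_line. (cmod (u x))\<^sup>2) \<le> exp (C * (1 + b * N / T)) * (LINT x:({0<..} - {0..b})|lebesgue. (cmod (U T u x))\<^sup>2)"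
    if b: "0 < b" and T: "0 < T" and N: "0 < N" and u: "u \<in> l2 half_line"
      and U: "schroedinger_group half_line (bessel_friedrichs \<nu>) U"
      and supp: "AE x in half_line. x \<notin> {0..N} \<longrightarrow> u x = 0" for b T N :: real and U u
  proof -
    define A where "A = l2_norm half_line u"
    have A: "0 \<le> A" by (simp add: A_def l2_norm_nonneg)
    define Q where "Q = 1 / (4 * T) * N"
    have Q: "0 < Q" using T N by (simp add: Q_def)
    define q where "q = Q * (2 * b)"
    have q: "0 < q" "q = b * N / (2 * T)"
      using Q b by (simp_all add: q_def) (simp add: Q_def)
    \<comment> \<open>The rate 4 + 2 B comes from q^2 exp (2 (1 + B) q) \<le> exp ((4 + 2 B) q) in
      the squared remainder; the additional 4 keeps the exponent below - 6 even for small q.\<close>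
    define n where "n = nat \<lceil>(4 + 2 * B) * q\<rceil> + 4"
    have n: "(4 + 2 * B) * q + 4 \<le> real n" "real n \<le> (4 + 2 * B) * q + 5" "4 \<le> n"
    proof -
      define X where "X = (4 + 2 * B) * q"
      have "0 \<le> X" using q(1) B by (simp add: X_def)
      then have "real (nat \<lceil>X\<rceil>) \<le> X + 1" using of_int_ceiling_le_add_one[of X] by simp
      moreover have "X \<le> real (nat \<lceil>X\<rceil>)" by (rule real_nat_ceiling_ge)
      ultimately show "(4 + 2 * B) * q + 4 \<le> real n" "real n \<le> (4 + 2 * B) * q + 5" "4 \<le> n"
        by (simp_all add: n_def flip: X_def)
    qed
    define f where "f = U T u"
    have ug: "unitary_group half_line U" using U by (simp add: schroedinger_group_def)
    have f: "f \<in> l2 half_line" using ug u by (auto simp: f_def unitary_group_def)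
    have fA: "(LINT x|half_line. (cmod (f x))\<^sup>2) = A\<^sup>2"
      using unitary_group_isometry[OF ug u, of T] by (simp add: f_def A_def flip: l2_norm_square)
    obtain a where a: "\<And>k. cmod (a k) \<le> 2 * A * (Q powr (\<nu> + 1 + 2 * real k) / (fact k * Gamma (\<nu> + 1 + real k)))"
      and sum: "\<And>x. 0 < x \<Longrightarrow> summable (\<lambda>k. a k * of_real ((x\<^sup>2) ^ k))"
      and rep: "AE x in half_line. exp (- \<i> * of_real (1 / (4 * T) * x\<^sup>2)) * U T u x
        = of_real (x powr (\<nu> + 1/2)) * (\<Sum>k. a k * of_real ((x\<^sup>2) ^ k))"
      using schroedinger_group_series[OF assms T N U u supp] unfolding A_def Q_def by blast
    define R where "R x = of_real (x powr (\<nu> + 1/2)) * (\<Sum>k. a (k + n) * of_real ((x\<^sup>2) ^ (k + n)))" for x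
    define \<rho> where "\<rho> = (2 * A * Q * sqrt (2 * b) * exp ((1 + B) * q) / B ^ n)\<^sup>2"
    have R: "(cmod (R x))\<^sup>2 \<le> \<rho>" if "0 < x" "x \<le> 2 * b" for x
      unfolding R_def \<rho>_def q_def
      by (intro power_mono hankel_series_tail_bound assms Q A B that a) auto
    have "AE x in half_line. cmod (f x) = cmod (of_real (x powr (\<nu> + 1/2)) * (\<Sum>k<n. a k * of_real (x\<^sup>2) ^ k) + R x)"
      using rep AE_space
    proof eventually_elim
      fix x assume r: "exp (- \<i> * of_real (1 / (4 * T) * x\<^sup>2)) * U T u x
          = of_real (x powr (\<nu> + 1/2)) * (\<Sum>k. a k * of_real ((x\<^sup>2) ^ k))" and "x \<in> space half_line"
      then have "(\<Sum>k. a k * of_real ((x\<^sup>2) ^ k)) = (\<Sum>k. a (k + n) * of_real ((x\<^sup>2) ^ (k + n))) + (\<Sum>k<n. a k * of_real ((x\<^sup>2) ^ k))"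
        by (intro suminf_split_initial_segment sum) simp
      moreover have "cmod (f x) = cmod (exp (- \<i> * of_real (1 / (4 * T) * x\<^sup>2)) * U T u x)"
        by (simp add: f_def norm_mult norm_exp_eq_Re)
      ultimately show "cmod (f x) = cmod (of_real (x powr (\<nu> + 1/2)) * (\<Sum>k<n. a k * of_real (x\<^sup>2) ^ k) + R x)"
        unfolding r R_def by (simp add: algebra_simps)
    qed
    then have main: "A\<^sup>2 \<le> (4 * exp (8 * real n) + 1) * (LINT x|half_line. (if x \<le> b then 0 else (cmod (f x))\<^sup>2))
        + (4 * exp (8 * real n) + 2) * (b * \<rho>)"
      unfolding fA[symmetric] using n(3) assms R
      by (intro mass_inside_le_mass_outside f b) (auto simp: \<rho>_def)
    define E where "E = (LINT x|half_line. (if x \<le> b then 0 else (cmod (f x))\<^sup>2))"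
    have E: "0 \<le> E" unfolding E_def by (intro Bochner_Integration.integral_nonneg) auto
    define M where "M = exp (8 * real n)"
    have M: "1 \<le> M" by (simp add: M_def)
    have "(4 * M + 2) * (b * \<rho>) \<le> A\<^sup>2 / 4"
    proof -
      have "b * \<rho> = 2 * A\<^sup>2 * (q\<^sup>2 * exp ((1 + B) * q) ^ 2 / (B ^ n)\<^sup>2)"
        using b by (simp add: \<rho>_def q_def power_mult_distrib power_divide power2_eq_square)
      also have "(B ^ n)\<^sup>2 = exp (16 * real n)"
        by (simp add: B_def power2_eq_square exp_of_nat_mult[symmetric] exp_add[symmetric])
      also have "exp ((1 + B) * q) ^ 2 = exp (2 * (1 + B) * q)"
        by (simp add: power2_eq_square exp_add[symmetric])
      also have "2 * A\<^sup>2 * (q\<^sup>2 * exp (2 * (1 + B) * q) / exp (16 * real n)) \<le> 2 * A\<^sup>2 * (exp (2 * q) * exp (2 * (1 + B) * q) / exp (16 * real n))"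
      proof (intro mult_left_mono divide_right_mono mult_right_mono)
        have "q\<^sup>2 \<le> (exp q)\<^sup>2" using q exp_ge_add_one_self[of q] by (intro power_mono) linarith+
        then show "q\<^sup>2 \<le> exp (2 * q)" by (simp add: power2_eq_square exp_add[symmetric])
      qed auto
      also have "exp (2 * q) * exp (2 * (1 + B) * q) / exp (16 * real n) = exp ((4 + 2 * B) * q - 16 * real n)"
        by (simp add: exp_add[symmetric] exp_diff[symmetric] algebra_simps)
      finally have b\<rho>: "b * \<rho> \<le> 2 * A\<^sup>2 * exp ((4 + 2 * B) * q - 16 * real n)" .
      have "(4 * M + 2) * (b * \<rho>) \<le> (6 * M) * (2 * A\<^sup>2 * exp ((4 + 2 * B) * q - 16 * real n))"
        using M b by (intro mult_mono b\<rho>) (auto simp: \<rho>_def)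
      also have "\<dots> = 12 * A\<^sup>2 * (M * exp ((4 + 2 * B) * q - 16 * real n))" by simp
      also have "M * exp ((4 + 2 * B) * q - 16 * real n) = exp (8 * real n + ((4 + 2 * B) * q - 16 * real n))"
        by (simp only: M_def exp_add)
      \<comment> \<open>The exponent equals (4 + 2 B) q - 8 n, and - 6 is enough because 12 / 64 is
        below the quarter that is to be absorbed.\<close>
      also have "12 * A\<^sup>2 * \<dots> \<le> 12 * A\<^sup>2 * exp (- 6)"
        using n by (intro mult_left_mono) auto
      also have "\<dots> \<le> 12 * A\<^sup>2 * (1 / 64)" by (intro mult_left_mono exp_neg_6_le) auto
      also have "\<dots> \<le> A\<^sup>2 / 4" by simp
      finally show ?thesis .
    qed
    with main have "A\<^sup>2 \<le> (4 * M + 1) * E + A\<^sup>2 / 4" unfolding M_def[symmetric] E_def[symmetric] by linarith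
    moreover have "0 \<le> (4 * M + 1) * E" using M E by simp
    ultimately have "A\<^sup>2 \<le> 2 * ((4 * M + 1) * E)" by linarith
    also have "\<dots> \<le> 2 * ((4 * M + M) * E)" using M E by (intro mult_left_mono mult_right_mono) auto
    also have "\<dots> = 10 * M * E" by simp
    also have "\<dots> \<le> exp (C * (1 + b * N / T)) * E"
    proof (rule mult_right_mono[OF _ E])
      have "(4::real) ^ 2 \<le> exp 2 ^ 2" using four_le_exp_2 by (intro power_mono) auto
      also have "\<dots> = exp 4" by (simp add: power2_eq_square exp_add[symmetric])
      finally have "10 * M \<le> exp 4 * M" using M by (intro mult_right_mono) auto
      also have "\<dots> = exp (8 * real n + 4)" by (simp add: M_def exp_add)
      also have "\<dots> \<le> exp (C * (1 + b * N / T))"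
      proof -
        have "8 * real n + 4 \<le> 8 * (4 + 2 * B) * q + 44" using n(2) by (simp add: algebra_simps)
        also have "\<dots> = 4 * (4 + 2 * B) * (b * N / T) + 44"
          unfolding q(2) using T by (simp add: field_simps)
        also have "\<dots> \<le> C * (b * N / T) + C" using B b N T by (intro add_mono mult_right_mono) (auto simp: C_def)
        finally show ?thesis by (simp add: distrib_left)
      qed
      finally show "10 * M \<le> exp (C * (1 + b * N / T))" .
    qed
    finally show ?thesis
      unfolding E_def f_def outside_integral_eq[OF b] by (simp add: A_def l2_norm_square)
  qed
  moreover have "0 < C" using B by (simp add: C_def)
  ultimately show ?thesis by blast
qed

end
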